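(* There exists a polynomial time algorithm that computes (i) a $(\alpha_{\mathrm{med}}+3)$-approximation with GF-violation at most $2$ for the doubly constrained fair $k$-median problem, where $\alpha_{\mathrm{med}}$ is the approximation factor of a given approximation algorithm for DS-fair $k$-median; (ii) a $\left(\sqrt{1+(\sqrt{\alpha_{\mathrm{means}}}+1)^2}+1\right)^2$-approximation with GF-violation at most $2$ for the doubly constrained fair $k$-means problem, where $\alpha_{\mathrm{means}}$ is the approximation factor of a given approximation algorithm for DS-fair $k$-means. Here a $\beta$-approximation with GF-violation at most $2$ means an output clustering satisfying diverse center selection, with every cluster group fair with additive violation at most $2$, and with cost at most $\beta$ times the optimal cost of a clustering satisfying both group fairness (with no violation) and diverse center selection.
   Context: Let $(P,d)$ be a finite metric space with $|P|=n$, $k\in\{1,\dots,n\}$, and $P=P_1\,\dot\cup\,\dots\,\dot\cup\,P_m$ a partition into color classes, $H=\{1,\dots,m\}$. A $k$-clustering is a pair $(\mathcal{C},\varphi)$ with $\mathcal{C}\subseteq P$, $|\mathcal{C}|\le k$, $\varphi:P\to\mathcal{C}$; clusters are $\varphi^{-1}(c)$. The $k$-median cost is $\sum_{p\in P}d(p,\varphi(p))$ and the $k$-means cost is $\sum_{p\in P}d(p,\varphi(p))^2$. Group fairness (GF): given $0\le\ell_h\le u_h\le1$, a cluster $C$ is group fair with additive violation $\rho$ if $\ell_h|C|-\rho\le|C\cap P_h|\le u_h|C|+\rho$ for all $h$ (group fair if $\rho=0$). Diverse center selection (DS): given integers $L_h\le U_h$ with $\sum_hL_h\le k\le\sum_hU_h$,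 $\mathcal{C}$ satisfies DS if $L_h\le|\mathcal{C}\cap P_h|\le U_h$ for all $h$. The doubly constrained fair $k$-median (resp. $k$-means) problem asks for a clustering satisfying GF and DS minimizing the $k$-median (resp. $k$-means) cost; instances are assumed feasible. An $\alpha$-approximation algorithm for DS-fair $k$-median (resp. $k$-means) is a polynomial-time algorithm returning a clustering satisfying DS of cost at most $\alpha$ times the optimum over clusterings satisfying DS. *)

theory Defs
  imports "HOL-Analysis.Analysis" "HOL-Computational_Algebra.Polynomial"
begin

section \<open>Polynomial-time algorithms\<close>

text \<open>
  The model of computation is Jones's WHILE language over binary trees (N. D. Jones,
  Computability and Complexity from a Programming Perspective, MIT Press 1997).
  Every operation takes constant time on a representation with shared subtrees
  (assigning a tree copies a pointer, and the only test is whether a tree is a leaf), so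
  running times are polynomially related to those of Turing machines.
  The running time is the number of expression nodes evaluated plus the number of commands
  executed.
\<close>

datatype tree = Leaf | Node tree tree

fun left :: "tree \<Rightarrow> tree" where
  "left Leaf = Leaf"
| "left (Node a b) = a"

fun right :: "tree \<Rightarrow> tree" where
  "right Leaf = Leaf"
| "right (Node a b) = b"

datatype expr = Var nat | NilE | ConsE expr expr | HdE expr | TlE expr

type_synonym store = "nat \<Rightarrow> tree"

primrec expr_val :: "expr \<Rightarrow> store \<Rightarrow> tree" where
  "expr_val (Var x) s = s x"
| "expr_val NilE s = Leaf"
| "expr_val (ConsE e f) s = Node (expr_val e s) (expr_val f s)"
| "expr_val (HdE e) s = left (expr_val e s)"
| "expr_val (TlE e) s = right (expr_val e s)"

primrec expr_time :: "expr \<Rightarrow> nat" where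
  "expr_time (Var x) = 1"
| "expr_time NilE = 1"
| "expr_time (ConsE e f) = expr_time e + expr_time f + 1"
| "expr_time (HdE e) = expr_time e + 1"
| "expr_time (TlE e) = expr_time e + 1"

datatype com = Skip | Assign nat expr | Seq com com | If expr com com | While expr com

text \<open>\<open>exec c s t s'\<close>: started in store \<open>s\<close>, the program \<open>c\<close> halts after time \<open>t\<close> in store \<open>s'\<close>.\<close>

inductive exec :: "com \<Rightarrow> store \<Rightarrow> nat \<Rightarrow> store \<Rightarrow> bool" where
  Skip: "exec Skip s 1 s"
| Assign: "exec (Assign x e) s (expr_time e + 1) (s(x := expr_val e s))"
| Seq: "exec c s t s' \<Longrightarrow> exec d s' t' s'' \<Longrightarrow> exec (Seq c d) s (t + t' + 1) s''"
| IfTrue: "expr_val e s \<noteq> Leaf \<Longrightarrow> exec c s t s' \<Longrightarrow>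
    exec (If e c d) s (expr_time e + t + 1) s'"
| IfFalse: "expr_val e s = Leaf \<Longrightarrow> exec d s t s' \<Longrightarrow>
    exec (If e c d) s (expr_time e + t + 1) s'"
| WhileFalse: "expr_val e s = Leaf \<Longrightarrow> exec (While e c) s (expr_time e + 1) s"
| WhileTrue: "expr_val e s \<noteq> Leaf \<Longrightarrow> exec c s t s' \<Longrightarrow> exec (While e c) s' t' s'' \<Longrightarrow>
    exec (While e c) s (expr_time e + t + t' + 1) s''"

text \<open>
  The input is passed in variable \<open>0\<close>, all other variables being empty, and the output is read
  off variable \<open>0\<close>. Nothing is required of the program on inputs that do not encode an
  instance in \<open>I\<close>. The input length \<open>size (enc x)\<close> is the number of inner nodes of the tree.
\<close>

definition poly_time_solves ::
  "com \<Rightarrow> 'i set \<Rightarrow> ('i \<Rightarrow> tree) \<Rightarrow> ('i \<Rightarrow> tree \<Rightarrow> bool) \<Rightarrow> bool" where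
  "poly_time_solves A I enc correct \<longleftrightarrow>
    (\<exists>p :: nat poly. \<forall>x\<in>I. \<exists>t s.
      exec A ((\<lambda>_. Leaf)(0 := enc x)) t s \<and> t \<le> poly p (size (enc x)) \<and> correct x (s 0))"


section \<open>Instances and clusterings\<close>

text \<open>
  The points are \<open>0, \<dots>, n - 1\<close> and the colors \<open>0, \<dots>, m - 1\<close>. Since instances are inputs
  of algorithms, distances and group fairness bounds are rational. Only the
  values of the functions at points and colors are relevant.
\<close>

record ds_instance =
  num_points :: nat
  distance :: "nat \<Rightarrow> nat \<Rightarrow> rat"
  max_clusters :: nat
  num_colors :: nat
  color :: "nat \<Rightarrow> nat"
  center_lower :: "nat \<Rightarrow> int"
  center_upper :: "nat \<Rightarrow> int"

record dc_instance = ds_instance +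
  group_lower :: "nat \<Rightarrow> rat"
  group_upper :: "nat \<Rightarrow> rat"

abbreviation points :: "'a ds_instance_scheme \<Rightarrow> nat set" where
  "points I \<equiv> {..<num_points I}"

abbreviation colors :: "'a ds_instance_scheme \<Rightarrow> nat set" where
  "colors I \<equiv> {..<num_colors I}"

definition color_class :: "'a ds_instance_scheme \<Rightarrow> nat \<Rightarrow> nat set" where
  "color_class I h = {p \<in> points I. color I p = h}"

definition valid_ds_instance :: "'a ds_instance_scheme \<Rightarrow> bool" where
  "valid_ds_instance I \<longleftrightarrow>
    Metric_space (points I) (\<lambda>p q. real_of_rat (distance I p q)) \<and>
    1 \<le> max_clusters I \<and> max_clusters I \<le> num_points I \<and>
    color I \<in> points I \<rightarrow> colors I \<and>
    (\<forall>h\<in>colors I. center_lower I h \<le> center_upper I h) \<and>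
    (\<Sum>h\<in>colors I. center_lower I h) \<le> int (max_clusters I) \<and>
    int (max_clusters I) \<le> (\<Sum>h\<in>colors I. center_upper I h)"

definition valid_dc_instance :: "dc_instance \<Rightarrow> bool" where
  "valid_dc_instance I \<longleftrightarrow>
    valid_ds_instance I \<and>
    (\<forall>h\<in>colors I. 0 \<le> group_lower I h \<and> group_lower I h \<le> group_upper I h \<and> group_upper I h \<le> 1)"

type_synonym clustering = "nat set \<times> (nat \<Rightarrow> nat)"

definition clusterings :: "'a ds_instance_scheme \<Rightarrow> clustering set" where
  "clusterings I =
    {(C, \<phi>). C \<subseteq> points I \<and> card C \<le> max_clusters I \<and> \<phi> \<in> points I \<rightarrow>\<^sub>E C}"

lemma finite_clusterings: "finite (clusterings I)"
proof (rule finite_subset)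
  show "clusterings I \<subseteq> (SIGMA C:Pow (points I). points I \<rightarrow>\<^sub>E C)"
    by (auto simp: clusterings_def)
  show "finite (SIGMA C:Pow (points I). points I \<rightarrow>\<^sub>E C)"
    by (intro finite_SigmaI finite_PiE) (auto intro: finite_subset)
qed

definition cluster :: "'a ds_instance_scheme \<Rightarrow> clustering \<Rightarrow> nat \<Rightarrow> nat set" where
  "cluster I S c = {p \<in> points I. snd S p = c}"

definition median_cost :: "'a ds_instance_scheme \<Rightarrow> clustering \<Rightarrow> real" where
  "median_cost I S = (\<Sum>p\<in>points I. real_of_rat (distance I p (snd S p)))"

definition means_cost :: "'a ds_instance_scheme \<Rightarrow> clustering \<Rightarrow> real" where
  "means_cost I S = (\<Sum>p\<in>points I. (real_of_rat (distance I p (snd S p)))\<^sup>2)"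

definition diverse_centers :: "'a ds_instance_scheme \<Rightarrow> nat set \<Rightarrow> bool" where
  "diverse_centers I C \<longleftrightarrow>
    (\<forall>h\<in>colors I. center_lower I h \<le> int (card (C \<inter> color_class I h)) \<and>
                   int (card (C \<inter> color_class I h)) \<le> center_upper I h)"

definition group_fair :: "dc_instance \<Rightarrow> rat \<Rightarrow> nat set \<Rightarrow> bool" where
  "group_fair I \<rho> K \<longleftrightarrow>
    (\<forall>h\<in>colors I.
      group_lower I h * of_nat (card K) - \<rho> \<le> of_nat (card (K \<inter> color_class I h)) \<and>
      of_nat (card (K \<inter> color_class I h)) \<le> group_upper I h * of_nat (card K) + \<rho>)"

definition ds_solutions :: "'a ds_instance_scheme \<Rightarrow> clustering set" where
  "ds_solutions I = {S \<in> clusterings I. diverse_centers I (fst S)}"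

definition dc_solutions :: "rat \<Rightarrow> dc_instance \<Rightarrow> clustering set" where
  "dc_solutions \<rho> I = {S \<in> ds_solutions I. \<forall>c\<in>fst S. group_fair I \<rho> (cluster I S c)}"


section \<open>Encodings\<close>

text \<open>
  Numbers are encoded in binary, least significant bit first. The numbers of points and of
  colors are given by the lengths of the lists of point colors and of center bounds.
\<close>

definition enc_list :: "('a \<Rightarrow> tree) \<Rightarrow> 'a list \<Rightarrow> tree" where
  "enc_list f xs = foldr (\<lambda>x. Node (f x)) xs Leaf"

definition enc_bool :: "bool \<Rightarrow> tree" where
  "enc_bool b = (if b then Node Leaf Leaf else Leaf)"

fun enc_nat :: "nat \<Rightarrow> tree" where
  "enc_nat n = (if n = 0 then Leaf else Node (enc_bool (odd n)) (enc_nat (n div 2)))"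

declare enc_nat.simps [simp del]

definition enc_int :: "int \<Rightarrow> tree" where
  "enc_int i = Node (enc_bool (i < 0)) (enc_nat (nat \<bar>i\<bar>))"

definition enc_rat :: "rat \<Rightarrow> tree" where
  "enc_rat r = (case quotient_of r of (a, b) \<Rightarrow> Node (enc_int a) (enc_int b))"

definition enc_ds_instance :: "'a ds_instance_scheme \<Rightarrow> tree" where
  "enc_ds_instance I =
    Node (enc_list (\<lambda>p. enc_list (\<lambda>q. enc_rat (distance I p q)) [0..<num_points I])
           [0..<num_points I])
   (Node (enc_nat (max_clusters I))
   (Node (enc_list (\<lambda>p. enc_nat (color I p)) [0..<num_points I])
         (enc_list (\<lambda>h. Node (enc_int (center_lower I h)) (enc_int (center_upper I h)))
           [0..<num_colors I])))"

definition enc_dc_instance :: "dc_instance \<Rightarrow> tree" where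
  "enc_dc_instance I =
    Node (enc_ds_instance I)
         (enc_list (\<lambda>h. Node (enc_rat (group_lower I h)) (enc_rat (group_upper I h)))
           [0..<num_colors I])"

definition enc_clustering :: "'a ds_instance_scheme \<Rightarrow> clustering \<Rightarrow> tree" where
  "enc_clustering I S =
    Node (enc_list enc_nat (sorted_list_of_set (fst S)))
         (enc_list (\<lambda>p. enc_nat (snd S p)) [0..<num_points I])"


section \<open>Approximation algorithms\<close>

text \<open>
  Both notions concern feasible instances only, so the minima are over nonempty sets,
  which are finite by \<open>finite_clusterings\<close>.
\<close>

definition ds_approximation ::
  "(ds_instance \<Rightarrow> clustering \<Rightarrow> real) \<Rightarrow> real \<Rightarrow> com \<Rightarrow> bool" where
  "ds_approximation cost \<alpha> A \<longleftrightarrow>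
    poly_time_solves A {I. valid_ds_instance I \<and> ds_solutions I \<noteq> {}} enc_ds_instance
      (\<lambda>I out. \<exists>S\<in>ds_solutions I. out = enc_clustering I S \<and>
         cost I S \<le> \<alpha> * Min (cost I ` ds_solutions I))"

text \<open>
  The violation \<open>\<rho>\<close> is granted to the output only; feasibility and the optimum refer to
  clusterings that are group fair without violation.
\<close>

definition dc_approximation ::
  "(dc_instance \<Rightarrow> clustering \<Rightarrow> real) \<Rightarrow> rat \<Rightarrow> real \<Rightarrow> com \<Rightarrow> bool" where
  "dc_approximation cost \<rho> \<beta> B \<longleftrightarrow>
    poly_time_solves B {I. valid_dc_instance I \<and> dc_solutions 0 I \<noteq> {}} enc_dc_instance
      (\<lambda>I out. \<exists>S\<in>dc_solutions \<rho> I. out = enc_clustering I S \<and>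
         cost I S \<le> \<beta> * Min (cost I ` dc_solutions 0 I))"

end

theory Submission
  imports Defs
begin

text \<open>
  Sending every optimal center to the nearest center chosen
      by the given algorithm merges fair clusters,
  hence gives an exactly fair assignment \<open>x\<close> to the chosen centers,
      in which the distance of a point is at
  most twice its optimal distance plus its distance in the given solution. It remains to find an
  assignment with violation at most 2 that is almost as cheap as \<open>x\<close>. No linear program is solved:
      over
  \<open>T\<close> rounds, queues accumulate the violations of the fairness constraints, and
      in each round every point
  chooses the center that minimizes its cost plus its contribution to the violations, weighted
      by the
  queues. Comparing with \<open>x\<close> shows that the average of the \<open>T\<close> rounds is almost fair and almost as
  cheap as \<open>x\<close>. For \<open>T\<close> a power of two, the average is rounded bit by bit. The pairs of a point
      and a
  center of odd multiplicity carry two perfect matchings, one inside the points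
      and one that first pairs up
  inside each color of a cluster, then inside each cluster. The union of two perfect matchings is
  bipartite; rounding up one side and rounding down the other halves all multiplicities
      and moves the count of
  every cluster, and of every color in a cluster, to an adjacent integer. The cheaper of the two
  choices does not increase the cost. In total the size of a cluster
      and each of its color counts change
  by less than 1, which yields violation 2.
\<close>

section \<open>Polynomial-time computable functions\<close>

text \<open>The target factors exceed what merging alone yields, \<open>\<alpha> + 2\<close> for
  medians and \<open>(sqrt \<alpha> + 2)^2\<close> for means, and the gap absorbs a relative error
  \<open>1 / \<zeta>\<close> with a constant \<open>\<zeta>\<close>; hence an approximate fractional
  solution suffices. Two obstacles remain. Costs may be exponentially large, whereas the number of
  rounds must be polynomial: the largest cost \<open>D\<close> of an item of the comparison
  assignment is guessed and the queues are weighted by it, which makes the round count depend only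
  on \<open>\<zeta>\<close> and on the numbers of points and cells. Moreover, the rounds leave a
  residual violation, up to \<open>1 / n\<close> after averaging, on top of the rounding error,
  which for a bound \<open>u\<close> is \<open>1 + u\<close>. This stays within 2 as long as
  \<open>u \<le> 1 - 1 / n\<close>. An upper bound above \<open>1 - 1 / n\<close> is violated by
  less than 1 in any assignment, since clusters have at most \<open>n\<close> points; a lower bound
  above \<open>1 - 1 / n\<close> is feasible only if all points have the same color.\<close>

lemma poly_nat_mono: "a \<le> b \<Longrightarrow> poly p a \<le> poly p b" for p :: "nat poly"
  by (induction p) (auto intro!: add_mono mult_mono)

section \<open>Program variables and the part of the store that a program cannot see\<close>

primrec expr_vars :: "expr \<Rightarrow> nat set" where
  "expr_vars (Var x) = {x}"
| "expr_vars NilE = {}"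
| "expr_vars (ConsE e f) = expr_vars e \<union> expr_vars f"
| "expr_vars (HdE e) = expr_vars e"
| "expr_vars (TlE e) = expr_vars e"

primrec com_vars :: "com \<Rightarrow> nat set" where
  "com_vars Skip = {}"
| "com_vars (Assign x e) = insert x (expr_vars e)"
| "com_vars (Seq c d) = com_vars c \<union> com_vars d"
| "com_vars (If e c d) = expr_vars e \<union> com_vars c \<union> com_vars d"
| "com_vars (While e c) = expr_vars e \<union> com_vars c"

lemma finite_com_vars: "finite (com_vars c)"
proof -
  have "finite (expr_vars e)" for e
    by (induction e) auto
  then show ?thesis
    by (induction c) auto
qed

lemma expr_val_cong: "(\<And>v. v \<in> expr_vars e \<Longrightarrow> s v = u v) \<Longrightarrow> expr_val e s = expr_val e u"
  by (induction e) auto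

lemma exec_frame: "exec c s t s' \<Longrightarrow> v \<notin> com_vars c \<Longrightarrow> s' v = s v"
  by (induction rule: exec.induct) auto

text \<open>Time and result depend only on the variables of the program. This transfers a run of the
  given algorithm, specified only for stores that are empty outside variable \<open>0\<close>, to a
  store in which another variable keeps a copy of the input.\<close>

lemma exec_cong:
  "exec c s t s' \<Longrightarrow> com_vars c \<subseteq> V \<Longrightarrow> (\<And>v. v \<in> V \<Longrightarrow> s v = u v) \<Longrightarrow>
    exec c u t (\<lambda>v. if v \<in> V then s' v else u v)"
proof (induction arbitrary: u rule: exec.induct)
  case (Skip s)
  then have "(\<lambda>v. if v \<in> V then s v else u v) = u" by auto
  then show ?case using exec.Skip[of u] by simp
next
  case (Assign x e s)
  then have "expr_val e s = expr_val e u" by (intro expr_val_cong) auto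
  moreover have "(\<lambda>v. if v \<in> V then (s(x := expr_val e u)) v else u v) = u(x := expr_val e u)"
    using Assign by auto
  ultimately show ?case using exec.Assign[of x e u] by metis
next
  case (Seq c s t s' d t' s'')
  let ?u = "\<lambda>v. if v \<in> V then s' v else u v"
  have "exec c u t ?u" using Seq by auto
  moreover have "exec d ?u t' (\<lambda>v. if v \<in> V then s'' v else ?u v)"
    using Seq.prems by (intro Seq.IH(2)) auto
  moreover have "(\<lambda>v. if v \<in> V then s'' v else ?u v) = (\<lambda>v. if v \<in> V then s'' v else u v)" by auto
  ultimately show ?case by (simp only: exec.Seq)
next
  case (IfTrue e s c t s' d)
  then have e: "expr_val e s = expr_val e u" by (intro expr_val_cong) auto
  have "exec c u t (\<lambda>v. if v \<in> V then s' v else u v)" using IfTrue by auto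
  moreover have "expr_val e u \<noteq> Leaf" using IfTrue.hyps(1) e by simp
  ultimately show ?case by (simp only: exec.IfTrue not_False_eq_True)
next
  case (IfFalse e s d t s' c)
  then have e: "expr_val e s = expr_val e u" by (intro expr_val_cong) auto
  have "exec d u t (\<lambda>v. if v \<in> V then s' v else u v)" using IfFalse by auto
  moreover have "expr_val e u = Leaf" using IfFalse.hyps(1) e by simp
  ultimately show ?case by (simp only: exec.IfFalse)
next
  case (WhileFalse e s c)
  then have "expr_val e s = expr_val e u" by (intro expr_val_cong) auto
  moreover have "(\<lambda>v. if v \<in> V then s v else u v) = u" using WhileFalse by auto
  ultimately show ?case using exec.WhileFalse[of e u c] WhileFalse.hyps(1) by simp
next
  case (WhileTrue e s c t s' t' s'')
  let ?u = "\<lambda>v. if v \<in> V then s' v else u v"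
  have e: "expr_val e s = expr_val e u" using WhileTrue by (intro expr_val_cong) auto
  have "exec c u t ?u" using WhileTrue by auto
  moreover have "exec (While e c) ?u t' (\<lambda>v. if v \<in> V then s'' v else ?u v)"
    using WhileTrue.prems by (intro WhileTrue.IH(2)) auto
  moreover have "(\<lambda>v. if v \<in> V then s'' v else ?u v) = (\<lambda>v. if v \<in> V then s'' v else u v)" by auto
  moreover have "expr_val e u \<noteq> Leaf" using e WhileTrue.hyps(1) by simp
  ultimately show ?case by (metis (no_types, lifting) exec.WhileTrue)
qed

text \<open>A type class makes polynomial-time computability a predicate on HOL functions, the types
  of which determine the encoding. The instances reproduce the prescribed encodings, so input and
  output need no conversion.\<close>

class encodable =
  fixes encode :: "'a \<Rightarrow> tree"

abbreviation csize :: "'a::encodable \<Rightarrow> nat" where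
  "csize x \<equiv> size (encode x)"

instantiation nat :: encodable
begin
definition encode_nat_def: "encode = enc_nat"
instance ..
end

instantiation bool :: encodable
begin
definition encode_bool_def: "encode = enc_bool"
instance ..
end

instantiation int :: encodable
begin
definition encode_int_def: "encode = enc_int"
instance ..
end

instantiation unit :: encodable
begin
definition encode_unit_def: "encode (x :: unit) = Leaf"
instance ..
end

instantiation prod :: (encodable, encodable) encodable
begin
definition encode_prod_def: "encode x = Node (encode (fst x)) (encode (snd x))"
instance ..
end

instantiation list :: (encodable) encodable
begin
definition encode_list_def: "encode = enc_list encode"
instance ..
end

lemma encode_simps [simp]:
  "encode (a, b) = Node (encode a) (encode b)"
  "encode [] = Leaf"
  "encode (x # xs) = Node (encode x) (encode xs)"
  "encode True = Node Leaf Leaf"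
  "encode False = Leaf"
  "encode () = Leaf"
  by (simp_all add: encode_prod_def encode_list_def enc_list_def encode_bool_def enc_bool_def
      encode_unit_def)

section \<open>Polynomial bounds and polynomial-time functions\<close>

definition pbound :: "('a::encodable \<Rightarrow> nat) \<Rightarrow> bool" where
  "pbound f \<longleftrightarrow> (\<exists>p. \<forall>x. f x \<le> poly p (csize x))"

lemma pbound_const: "pbound (\<lambda>x. k)"
  unfolding pbound_def by (rule exI[of _ "[:k:]"]) simp

lemma pbound_csize: "pbound csize"
  unfolding pbound_def by (rule exI[of _ "[:0, 1:]"]) simp

lemma pbound_mono: "pbound g \<Longrightarrow> (\<And>x. f x \<le> g x) \<Longrightarrow> pbound f"
  unfolding pbound_def by (meson le_trans)

lemma pbound_poly: "pbound f \<Longrightarrow> pbound (\<lambda>x. poly p (f x))"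
proof -
  assume "pbound f"
  then obtain q where "\<And>x. f x \<le> poly q (csize x)" unfolding pbound_def by auto
  then have "poly p (f x) \<le> poly (pcompose p q) (csize x)" for x
    by (simp add: poly_pcompose poly_nat_mono)
  then show ?thesis unfolding pbound_def by blast
qed

lemma pbound_add:
  assumes "pbound f" "pbound g" shows "pbound (\<lambda>x. f x + g x)"
proof -
  obtain p q where "\<And>x. f x \<le> poly p (csize x)" "\<And>x. g x \<le> poly q (csize x)"
    using assms unfolding pbound_def by auto
  then have "f x + g x \<le> poly (p + q) (csize x)" for x
    by (simp add: add_mono)
  then show ?thesis unfolding pbound_def by blast
qed

lemma pbound_mult:
  assumes "pbound f" "pbound g" shows "pbound (\<lambda>x. f x * g x)"
proof -
  obtain p q where "\<And>x. f x \<le> poly p (csize x)" "\<And>x. g x \<le> poly q (csize x)"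
    using assms unfolding pbound_def by auto
  then have "f x * g x \<le> poly (p * q) (csize x)" for x
    by (simp add: mult_mono)
  then show ?thesis unfolding pbound_def by blast
qed

lemma pbound_Suc: "pbound f \<Longrightarrow> pbound (\<lambda>x. Suc (f x))"
  using pbound_add[of f "\<lambda>_. 1", OF _ pbound_const] by simp

lemmas pbound_arith = pbound_const pbound_csize pbound_add pbound_mult pbound_Suc pbound_poly

text \<open>The bound on the output is a separate conjunct: subtrees are shared, so trees of
  exponential size arise in polynomial time by repeated \<open>ConsE\<close> of a variable with
  itself. The program must work from every store whose variable \<open>0\<close> holds the input;
  such programs can be run one after another without cleaning up.\<close>

definition ptime :: "('a::encodable \<Rightarrow> 'b::encodable) \<Rightarrow> bool" where
  "ptime f \<longleftrightarrow> pbound (\<lambda>x. csize (f x)) \<and>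
    (\<exists>c T. pbound T \<and> (\<forall>x s. s 0 = encode x \<longrightarrow>
      (\<exists>t s'. exec c s t s' \<and> s' 0 = encode (f x) \<and> t \<le> T x)))"

lemma ptimeI:
  assumes "pbound (\<lambda>x. csize (f x))" "pbound T"
    "\<And>x s. s 0 = encode x \<Longrightarrow> \<exists>t s'. exec c s t s' \<and> s' 0 = encode (f x) \<and> t \<le> T x"
  shows "ptime f"
  using assms unfolding ptime_def by blast

lemma ptime_csize: "ptime f \<Longrightarrow> pbound (\<lambda>x. csize (f x))"
  by (simp add: ptime_def)

text \<open>Variables from \<open>N\<close> on survive a run and serve as storage for values needed
  later.\<close>

definition computes :: "nat \<Rightarrow> com \<Rightarrow> ('a::encodable \<Rightarrow> 'b::encodable) \<Rightarrow> ('a \<Rightarrow> nat) \<Rightarrow> bool" where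
  "computes N c f T \<longleftrightarrow> pbound T \<and> 0 < N \<and> (\<forall>s x. s 0 = encode x \<longrightarrow>
    (\<exists>t s'. exec c s t s' \<and> s' 0 = encode (f x) \<and> t \<le> T x \<and> (\<forall>v\<ge>N. s' v = s v)))"

lemma computesD:
  assumes "computes N c f T"
  shows "pbound T" "0 < N" "s 0 = encode x \<Longrightarrow>
    \<exists>t s'. exec c s t s' \<and> s' 0 = encode (f x) \<and> t \<le> T x \<and> (\<forall>v\<ge>N. s' v = s v)"
  using assms unfolding computes_def by blast+

lemma ptimeE:
  assumes "ptime f"
  obtains c T N where "computes N c f T"
proof -
  obtain c T where cT: "pbound T" "\<And>x s. s 0 = encode x \<Longrightarrow>
      \<exists>t s'. exec c s t s' \<and> s' 0 = encode (f x) \<and> t \<le> T x"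
    using assms unfolding ptime_def by blast
  define N where "N = Suc (Max (insert 0 (com_vars c)))"
  have "v \<notin> com_vars c" if "v \<ge> N" for v
    using that finite_com_vars[of c] Max_ge[of "insert 0 (com_vars c)" v]
    unfolding N_def by (metis Suc_n_not_le_n finite_insert insertI2 le_trans)
  then have "\<exists>t s'. exec c s t s' \<and> s' 0 = encode (f x) \<and> t \<le> T x \<and> (\<forall>v\<ge>N. s' v = s v)"
    if "s 0 = encode x" for x s
    using cT(2)[of s x, OF that] exec_frame[of c s] by blast
  with cT(1) have "computes N c f T" by (simp add: computes_def N_def)
  then show ?thesis by (rule that)
qed

section \<open>Closure under composition, branching and loops\<close>

lemma pbound_comp:
  assumes "pbound f" "pbound (\<lambda>x. csize (g x))"
  shows "pbound (\<lambda>x. f (g x))"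
proof -
  obtain p where "\<And>x. f x \<le> poly p (csize x)" using assms unfolding pbound_def by auto
  then show ?thesis using pbound_mono[OF pbound_poly[OF assms(2), of p]] by auto
qed

lemma ptime_comp:
  fixes g :: "'a::encodable \<Rightarrow> 'b::encodable"
  assumes "ptime f" "ptime g"
  shows "ptime (\<lambda>x. f (g x))"
proof -
  obtain c T N where "computes N c f T"
    by (rule ptimeE[OF assms(1)]) (rule that)
  note c = computesD[OF this]
  obtain d U M where "computes M d g U"
    by (rule ptimeE[OF assms(2)]) (rule that)
  note d = computesD[OF this]
  show ?thesis
  proof (rule ptimeI[where c = "Seq d c"])
    show "pbound (\<lambda>x. csize (f (g x)))"
      by (rule pbound_comp[OF ptime_csize[OF assms(1)] ptime_csize[OF assms(2)]])
    show "pbound (\<lambda>x. U x + T (g x) + 1)"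
      using pbound_comp[OF c(1) ptime_csize[OF assms(2)]] d(1) by (intro pbound_arith)
    fix x :: 'a and s :: store assume "s 0 = encode x"
    then obtain t s1 where 1: "exec d s t s1" "s1 0 = encode (g x)" "t \<le> U x"
      using d(3) by blast
    then obtain t' s2 where 2: "exec c s1 t' s2" "s2 0 = encode (f (g x))" "t' \<le> T (g x)"
      using c(3) by blast
    show "\<exists>t s'. exec (Seq d c) s t s' \<and> s' 0 = encode (f (g x)) \<and> t \<le> U x + T (g x) + 1"
      using exec.Seq[OF 1(1) 2(1)] 1(3) 2(2,3)
      by (intro exI[of _ "t + t' + 1"] exI[of _ s2]) simp
  qed
qed

lemma ptime_assign:
  fixes f :: "'a::encodable \<Rightarrow> 'b::encodable"
  assumes "\<And>x s. s 0 = encode x \<Longrightarrow> expr_val e s = encode (f x)"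
    and "pbound (\<lambda>x. csize (f x))"
  shows "ptime f"
proof (rule ptimeI[where c = "Assign 0 e" and T = "\<lambda>_. expr_time e + 1"])
  fix x :: 'a and s :: store assume "s 0 = encode x"
  then show "\<exists>t s'. exec (Assign 0 e) s t s' \<and> s' 0 = encode (f x) \<and> t \<le> expr_time e + 1"
    using exec.Assign[of 0 e s] assms(1)
    by (intro exI[of _ "expr_time e + 1"] exI[of _ "s(0 := expr_val e s)"]) simp
qed (auto intro: assms pbound_const)

lemma ptime_id: "ptime (\<lambda>x. x)"
  by (rule ptime_assign[where e = "Var 0"]) (auto intro: pbound_csize)

lemma ptime_const: "ptime (\<lambda>x. k)"
proof -
  obtain e where e: "\<And>s. expr_val e s = encode k"
  proof -
    have "\<exists>e. \<forall>s. expr_val e s = t" for t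
    proof (induction t)
      case Leaf
      then show ?case by (rule exI[of _ NilE]) simp
    next
      case (Node a b)
      then obtain e f where "\<forall>s. expr_val e s = a" "\<forall>s. expr_val f s = b" by auto
      then show ?case by (intro exI[of _ "ConsE e f"]) simp
    qed
    then obtain e where "\<forall>s. expr_val e s = encode k" by blast
    then show ?thesis by (intro that[of e]) simp
  qed
  then show ?thesis by (intro ptime_assign[where e = e] pbound_const)
qed

text \<open>Functions into different types may produce the same trees, and then one program computes
  both. Numbers are thus treated as bit lists, booleans as lists of units and pairs as nonempty
  lists without conversion.\<close>

lemma ptime_reencode:
  assumes "ptime f" "\<And>x. encode (g x) = encode (f x)"
  shows "ptime g"
  using assms unfolding ptime_def by simp

lemma ptime_fst: "ptime f \<Longrightarrow> ptime (\<lambda>x. fst (f x))"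
  by (rule ptime_comp, rule ptime_assign[where e = "HdE (Var 0)"])
     (auto simp: encode_prod_def intro: pbound_mono[OF pbound_csize])

lemma ptime_snd: "ptime f \<Longrightarrow> ptime (\<lambda>x. snd (f x))"
  by (rule ptime_comp, rule ptime_assign[where e = "TlE (Var 0)"])
     (auto simp: encode_prod_def intro: pbound_mono[OF pbound_csize])

lemma ptime_tl: "ptime f \<Longrightarrow> ptime (\<lambda>x. tl (f x))"
proof (erule ptime_comp[where f = tl, rotated], rule ptime_assign[where e = "TlE (Var 0)"])
  fix s :: store and x :: "'b list"
  assume "s 0 = encode x"
  then show "expr_val (TlE (Var 0)) s = encode (tl x)" by (cases x) auto
next
  have "csize (tl x) \<le> csize x" for x :: "'b list" by (cases x) auto
  then show "pbound (\<lambda>x :: 'b list. csize (tl x))" by (rule pbound_mono[OF pbound_csize])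
qed

text \<open>The input is parked in variable \<open>K\<close> while \<open>f\<close> is computed, and
  the value of \<open>f\<close> in \<open>Suc K\<close> while \<open>g\<close> is computed; neither
  program changes variables from \<open>K\<close> on. The constant 20 covers the assignments and the
  sequencing.\<close>

lemma ptime_pair:
  fixes f :: "'a::encodable \<Rightarrow> 'b::encodable" and g :: "'a \<Rightarrow> 'c::encodable"
  assumes "ptime f" "ptime g"
  shows "ptime (\<lambda>x. (f x, g x))"
proof -
  obtain c T N where "computes N c f T"
    by (rule ptimeE[OF assms(1)]) (rule that)
  note c = computesD[OF this]
  obtain d U M where "computes M d g U"
    by (rule ptimeE[OF assms(2)]) (rule that)
  note d = computesD[OF this]
  define K where "K = max N M"
  let ?c = "Seq (Assign K (Var 0)) (Seq c (Seq (Assign (Suc K) (Var 0)) (Seq (Assign 0 (Var K))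
              (Seq d (Assign 0 (ConsE (Var (Suc K)) (Var 0)))))))"
  show ?thesis
  proof (rule ptimeI[where c = ?c])
    show "pbound (\<lambda>x. csize (f x, g x))"
      using ptime_csize[OF assms(1)] ptime_csize[OF assms(2)] by (auto intro!: pbound_arith)
    show "pbound (\<lambda>x. T x + U x + 20)" using c d by (intro pbound_arith)
    fix x :: 'a and s :: store assume s: "s 0 = encode x"
    let ?s1 = "s(K := s 0)"
    have "?s1 0 = encode x" using s by simp
    then obtain t s2 where 2: "exec c ?s1 t s2" "s2 0 = encode (f x)" "t \<le> T x" "s2 K = encode x"
      using c(3)[of ?s1 x] s by (auto simp: K_def)
    let ?s3 = "s2(Suc K := s2 0, 0 := s2 K)"
    have "?s3 0 = encode x" using 2 by simp
    then obtain t' s4 where 4: "exec d ?s3 t' s4" "s4 0 = encode (g x)" "t' \<le> U x"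
      "s4 (Suc K) = encode (f x)"
      using d(3)[of ?s3 x] 2(2) by (auto simp: K_def)
    have a: "exec (Assign K (Var 0)) s 2 ?s1"
      using exec.Assign[of K "Var 0" s] by (simp add: numeral_2_eq_2)
    have b: "exec (Assign (Suc K) (Var 0)) s2 2 (s2(Suc K := s2 0))"
      using exec.Assign[of "Suc K" "Var 0" s2] by (simp add: numeral_2_eq_2)
    have c: "exec (Assign 0 (Var K)) (s2(Suc K := s2 0)) 2 ?s3"
      using exec.Assign[of 0 "Var K" "s2(Suc K := s2 0)"] by (simp add: numeral_2_eq_2)
    have d: "exec (Assign 0 (ConsE (Var (Suc K)) (Var 0))) s4 4 (s4(0 := encode (f x, g x)))"
      using exec.Assign[of 0 "ConsE (Var (Suc K)) (Var 0)" s4] 4 by (simp add: eval_nat_numeral)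
    note exec.Seq[OF a exec.Seq[OF 2(1) exec.Seq[OF b exec.Seq[OF c exec.Seq[OF 4(1) d]]]]]
    moreover have "2 + (t + (2 + (2 + (t' + 4 + 1) + 1) + 1) + 1) + 1 \<le> T x + U x + 20"
      using 2(3) 4(3) by simp
    ultimately show "\<exists>t s'. exec ?c s t s' \<and> s' 0 = encode (f x, g x) \<and> t \<le> T x + U x + 20"
      by (intro exI[of _ "2 + (t + (2 + (2 + (t' + 4 + 1) + 1) + 1) + 1) + 1"]
          exI[of _ "s4(0 := encode (f x, g x))"]) simp
  qed
qed

lemma ptime_Cons: "ptime f \<Longrightarrow> ptime g \<Longrightarrow> ptime (\<lambda>x. f x # g x)"
  by (rule ptime_reencode[OF ptime_pair]) auto

text \<open>\<open>L x\<close> is tested in place, since exactly the empty list is encoded by a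
  leaf. The environment and the two parts of the list reach the second branch as one tuple
  \<open>((x, y), ys)\<close>, the same shape as in the rule for loops.\<close>

lemma ptime_case_list:
  fixes L :: "'a::encodable \<Rightarrow> 'b::encodable list"
  assumes "ptime L" "ptime f" "ptime (\<lambda>z. g (fst (fst z)) (snd (fst z)) (snd z))"
  shows "ptime (\<lambda>x. case L x of [] \<Rightarrow> f x | y # ys \<Rightarrow> g x y ys)"
proof -
  let ?g = "\<lambda>z. g (fst (fst z)) (snd (fst z)) (snd z)"
  obtain e S M' where "computes M' e (\<lambda>x. (x, L x)) S"
    by (rule ptimeE[OF ptime_pair[OF ptime_id assms(1)]]) (rule that)
  note e = computesD[OF this]
  obtain c T N where "computes N c f T"
    by (rule ptimeE[OF assms(2)]) (rule that)
  note c = computesD[OF this]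
  obtain d U M where "computes M d ?g U"
    by (rule ptimeE[OF assms(3)]) (rule that)
  note d = computesD[OF this]
  obtain pU where pU: "\<And>z. U z \<le> poly pU (csize z)" using d(1) unfolding pbound_def by blast
  obtain pg where pg: "\<And>z. csize (?g z) \<le> poly pg (csize z)"
    using ptime_csize[OF assms(3)] unfolding pbound_def by blast
  let ?b = "\<lambda>x. csize x + csize (L x) + 2"
  have b: "pbound ?b" using ptime_csize[OF assms(1)] by (intro pbound_arith)
  let ?a1 = "Assign 0 (ConsE (ConsE (HdE (Var 0)) (HdE (TlE (Var 0)))) (TlE (TlE (Var 0))))"
  let ?a2 = "Assign 0 (HdE (Var 0))"
  let ?if = "If (TlE (Var 0)) (Seq ?a1 d) (Seq ?a2 c)"
  let ?c = "Seq e ?if"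
  show ?thesis
  proof (rule ptimeI[where c = ?c])
    show "pbound (\<lambda>x. csize (case L x of [] \<Rightarrow> f x | y # ys \<Rightarrow> g x y ys))"
    proof (rule pbound_mono[OF pbound_add[OF ptime_csize[OF assms(2)] pbound_poly[OF b, of pg]]])
      fix x
      show "csize (case L x of [] \<Rightarrow> f x | y # ys \<Rightarrow> g x y ys) \<le> csize (f x) + poly pg (?b x)"
        using order_trans[OF pg[of "((x, hd (L x)), tl (L x))"] poly_nat_mono[of _ "?b x"]]
        by (cases "L x") (auto intro: trans_le_add2)
    qed
    show "pbound (\<lambda>x. S x + T x + poly pU (?b x) + 30)"
      by (rule pbound_add[OF pbound_add[OF pbound_add[OF e(1) c(1)] pbound_poly[OF b]]
          pbound_const])
    fix x :: 'a and s :: store assume s: "s 0 = encode x"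
    obtain t s1 where 1: "exec e s t s1" "s1 0 = encode (x, L x)" "t \<le> S x"
      using e(3)[of s x] s by auto
    show "\<exists>t s'. exec ?c s t s' \<and> s' 0 = encode (case L x of [] \<Rightarrow> f x | y # ys \<Rightarrow> g x y ys) \<and>
        t \<le> S x + T x + poly pU (?b x) + 30"
    proof (cases "L x")
      case Nil
      let ?s = "s1(0 := encode x)"
      have A: "exec ?a2 s1 3 ?s" using exec.Assign[of 0 "HdE (Var 0)" s1] 1(2)
        by (simp add: eval_nat_numeral)
      have "?s 0 = encode x" by simp
      then obtain t' s2 where 2: "exec c ?s t' s2" "s2 0 = encode (f x)" "t' \<le> T x"
        using c(3) by blast
      have "exec ?if s1 (expr_time (TlE (Var 0)) + (3 + t' + 1) + 1) s2"
        using 1 Nil by (intro exec.IfFalse exec.Seq[OF A 2(1)]) simp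
      from exec.Seq[OF 1(1) this] show ?thesis using 1(3) 2(2,3) Nil
        by (intro exI[of _ "t + (expr_time (TlE (Var 0)) + (3 + t' + 1) + 1)
            + 1"] exI[of _ s2]) simp
    next
      case (Cons y ys)
      let ?s = "s1(0 := encode ((x, y), ys))"
      have A: "exec ?a1 s1 11 ?s"
        using exec.Assign[of 0 "ConsE (ConsE (HdE (Var 0)) (HdE (TlE (Var 0)))) (TlE (TlE (Var 0)))"
            s1]
          1(2) Cons by (simp add: eval_nat_numeral)
      have "?s 0 = encode ((x, y), ys)" by simp
      then obtain t' s2 where 2: "exec d ?s t' s2" "s2 0 = encode (g x y ys)" "t' \<le> U ((x, y), ys)"
        using d(3) by fastforce
      have "U ((x, y), ys) \<le> poly pU (?b x)"
        by (rule order_trans[OF pU poly_nat_mono]) (simp add: Cons)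
      moreover have "exec ?if s1 (expr_time (TlE (Var 0)) + (11 + t' + 1) + 1) s2"
        using 1 Cons by (intro exec.IfTrue exec.Seq[OF A 2(1)]) simp
      from exec.Seq[OF 1(1) this]
        have "exec ?c s (t + (expr_time (TlE (Var 0)) + (11 + t' + 1) + 1) + 1) s2" .
      ultimately show ?thesis using 1(3) 2(2,3) Cons
        by (intro exI[of _ "t + (expr_time (TlE (Var 0)) + (11 + t' + 1) + 1)
            + 1"] exI[of _ s2]) simp
    qed
  qed
qed

text \<open>\<open>True\<close> and \<open>[()]\<close> have the same encoding, and so have
  \<open>False\<close> and \<open>[]\<close>; branching is therefore an instance of case distinction
  on lists.\<close>

lemma ptime_if:
  fixes f :: "'a::encodable \<Rightarrow> 'b::encodable"
  assumes "ptime b" "ptime f" "ptime g"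
  shows "ptime (\<lambda>x. if b x then f x else g x)"
proof -
  have "ptime (\<lambda>x. if b x then [()] else [])"
    by (rule ptime_reencode[OF assms(1)]) simp
  then have "ptime (\<lambda>x. case if b x then [()] else [] of [] \<Rightarrow> g x | y # ys \<Rightarrow> f x)"
    by (rule ptime_case_list[OF _ assms(3)])
        (rule ptime_comp[OF assms(2) ptime_fst[OF ptime_fst[OF ptime_id]]])
  moreover have "(case if c then [()] else [] of [] \<Rightarrow> v | y # ys \<Rightarrow> u) = (if c then u else v)"
    for c and u v :: 'b by simp
  ultimately show ?thesis by simp
qed

lemma csize_list: "csize (xs :: 'a::encodable list) = (\<Sum>x\<leftarrow>xs. csize x + 1)"
  by (induction xs) auto

lemma length_le_csize: "length xs \<le> csize (xs :: 'a::encodable list)"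
  by (induction xs) auto

lemma csize_member: "x \<in> set xs \<Longrightarrow> csize x < csize xs"
  by (induction xs) auto

text \<open>Every loop of the reassignment comes from this rule. The last premise bounds all
  intermediate accumulators, because polynomial growth in each round may compound to exponential
  growth. Variables \<open>M\<close>, \<open>Suc M\<close> and \<open>Suc (Suc M)\<close> hold the
  environment, the remaining list and the accumulator, out of reach of the program for
  \<open>F\<close>.\<close>

lemma ptime_fold:
  fixes F :: "'a::encodable \<Rightarrow> 'y::encodable \<Rightarrow> 'b::encodable \<Rightarrow> 'b"
  assumes F: "ptime (\<lambda>z. F (fst (fst z)) (snd (fst z)) (snd z))" and "ptime L" "ptime A"
    and B: "pbound B"
    and le: "\<And>x ys zs. L x = ys @ zs \<Longrightarrow> csize (fold (F x) ys (A x)) \<le> B x"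
  shows "ptime (\<lambda>x. fold (F x) (L x) (A x))"
proof -
  let ?F = "\<lambda>z. F (fst (fst z)) (snd (fst z)) (snd z)"
  obtain e S M' where "computes M' e (\<lambda>x. (x, (L x, A x))) S"
    by (rule ptimeE[OF ptime_pair[OF ptime_id ptime_pair[OF assms(2,3)]]]) (rule that)
  note e = computesD[OF this]
  obtain d U M where "computes M d ?F U"
    by (rule ptimeE[OF F]) (rule that)
  note d = computesD[OF this]
  obtain pU where pU: "\<And>z. U z \<le> poly pU (csize z)" using d(1) unfolding pbound_def by blast
  let ?K = "\<lambda>x. poly pU (csize x + csize (L x) + B x + 2) + 30"
  have K: "pbound ?K" using ptime_csize[OF assms(2)] B by (intro pbound_arith)
  let ?L = "Suc M"
  let ?ac = "Suc (Suc M)"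
  let ?body = "Seq (Assign 0 (ConsE (ConsE (Var M) (HdE (Var ?L))) (Var ?ac)))
      (Seq d (Seq (Assign ?ac (Var 0)) (Assign ?L (TlE (Var ?L)))))"
  let ?while = "While (Var ?L) ?body"
  \<comment> \<open>\<open>k\<close> bounds the cost of each round uniformly; the accumulators that
    occur are the folds over the prefixes \<open>us\<close>.\<close>
  have loop: "\<exists>t s'. exec ?while s t s' \<and> s' ?ac = encode (fold (F x) zs a) \<and> t \<le> length zs * k + 2"
    if "s M = encode x" "s ?L = encode zs" "s ?ac = encode a"
      "\<And>us y vs. zs = us @ y # vs \<Longrightarrow> U ((x, y), fold (F x) us a) + 30 \<le> k" for x zs a k s
    using that
  proof (induction zs arbitrary: a s)
    case Nil
    then have "exec ?while s 2 s" using exec.WhileFalse[of "Var ?L" s ?body]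
      by (simp add: eval_nat_numeral)
    then show ?case using Nil by force
  next
    case (Cons y zs)
    let ?s1 = "s(0 := encode ((x, y), a))"
    have 1: "exec (Assign 0 (ConsE (ConsE (Var M) (HdE (Var ?L))) (Var ?ac))) s 7 ?s1"
      using exec.Assign[of 0 "ConsE (ConsE (Var M) (HdE (Var ?L))) (Var ?ac)" s] Cons.prems
      by (simp add: eval_nat_numeral)
    have "?s1 0 = encode ((x, y), a)" by simp
    then obtain t2 s2 where 2: "exec d ?s1 t2 s2" "s2 0 = encode (F x y a)" "t2 \<le> U ((x, y), a)"
      and fr: "\<forall>v\<ge>M. s2 v = ?s1 v" using d(3)[of ?s1 "((x, y), a)"] by auto
    let ?s3 = "s2(?ac := encode (F x y a), ?L := encode zs)"
    have 3: "exec (Assign ?ac (Var 0)) s2 2 (s2(?ac := encode (F x y a)))"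
      using exec.Assign[of ?ac "Var 0" s2] 2 by (simp add: eval_nat_numeral)
    have 4: "exec (Assign ?L (TlE (Var ?L))) (s2(?ac := encode (F x y a))) 3 ?s3"
      using exec.Assign[of ?L "TlE (Var ?L)" "s2(?ac := encode (F x y a))"] fr Cons.prems d(2)
      by (simp add: eval_nat_numeral)
    have "exec ?body s (7 + (t2 + (2 + 3 + 1) + 1) + 1) ?s3"
      by (rule exec.Seq[OF 1 exec.Seq[OF 2(1) exec.Seq[OF 3 4]]])
    moreover have "\<exists>t s'. exec ?while ?s3 t s' \<and> s' ?ac = encode (fold (F x) zs (F x y a)) \<and>
        t \<le> length zs * k + 2"
    proof (rule Cons.IH)
      show "?s3 M = encode x" using fr Cons.prems(1) d(2) by simp
      show "U ((x, y'), fold (F x) us (F x y a)) + 30 \<le> k" if "zs = us @ y' # vs" for us y' vs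
        using Cons.prems(4)[of "y # us" y' vs] that by simp
    qed auto
    then obtain t s' where 5: "exec ?while ?s3 t s'" "s' ?ac = encode (fold (F x) zs (F x y a))"
      "t \<le> length zs * k + 2" by blast
    moreover have "expr_val (Var ?L) s \<noteq> Leaf" using Cons.prems by simp
    ultimately have "exec ?while s (expr_time (Var ?L) + (7 + (t2 + (2 + 3 + 1) + 1) + 1) + t
        + 1) s'"
      by (simp only: exec.WhileTrue not_False_eq_True)
    moreover have "U ((x, y), a) + 30 \<le> k" using Cons.prems(4)[of "[]" y zs] by simp
    ultimately show ?case using 5 2
      by (intro exI[of _ "expr_time (Var ?L) + (7 + (t2 + (2 + 3 + 1) + 1) + 1) + t
          + 1"] exI[of _ s']) simp
  qed
  let ?i1 = "Assign M (HdE (Var 0))" and ?i2 = "Assign ?L (HdE (TlE (Var 0)))"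
    and ?i3 = "Assign ?ac (TlE (TlE (Var 0)))"
  let ?c = "Seq e (Seq ?i1 (Seq ?i2 (Seq ?i3 (Seq ?while (Assign 0 (Var ?ac))))))"
  show ?thesis
  proof (rule ptimeI[where c = ?c])
    show "pbound (\<lambda>x. csize (fold (F x) (L x) (A x)))"
      using le[of _ _ "[]"] by (intro pbound_mono[OF B]) auto
    show "pbound (\<lambda>x. S x + csize (L x) * ?K x + 40)"
      by (rule pbound_add[OF pbound_add[OF e(1) pbound_mult[OF ptime_csize[OF assms(2)] K]]
          pbound_const])
    fix x :: 'a and s :: store assume s: "s 0 = encode x"
    obtain t1 s1 where 1: "exec e s t1 s1" "s1 0 = encode (x, (L x, A x))" "t1 \<le> S x"
      using e(3)[of s x] s by auto
    let ?s2 = "s1(M := encode x)" let ?s3 = "?s2(?L := encode (L x))"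
    let ?s4 = "?s3(?ac := encode (A x))"
    have 2: "exec ?i1 s1 3 ?s2"
      using exec.Assign[of M "HdE (Var 0)" s1] 1 by (simp add: eval_nat_numeral)
    have 3: "exec ?i2 ?s2 4 ?s3"
      using exec.Assign[of ?L "HdE (TlE (Var 0))" ?s2] 1 d(2) by (simp add: eval_nat_numeral)
    have 4: "exec ?i3 ?s3 4 ?s4"
      using exec.Assign[of ?ac "TlE (TlE (Var 0))" ?s3] 1 d(2) by (simp add: eval_nat_numeral)
    have "\<exists>t s'. exec ?while ?s4 t s' \<and> s' ?ac = encode (fold (F x) (L x) (A x)) \<and>
        t \<le> length (L x) * ?K x + 2"
    proof (rule loop)
      fix us y vs assume eq: "L x = us @ y # vs"
      have "U ((x, y), fold (F x) us (A x)) \<le> poly pU (csize ((x, y), fold (F x) us (A x)))"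
        using pU by blast
      also have "\<dots> \<le> poly pU (csize x + csize (L x) + B x + 2)"
      proof (rule poly_nat_mono)
        have "csize y < csize (L x)" using eq by (intro csize_member) auto
        then show "csize ((x, y), fold (F x) us (A x)) \<le> csize x + csize (L x) + B x + 2"
          using le[OF eq] by simp
      qed
      finally show "U ((x, y), fold (F x) us (A x)) + 30 \<le> ?K x" by simp
    qed auto
    then obtain t5 s5 where 5: "exec ?while ?s4 t5 s5" "s5 ?ac = encode (fold (F x) (L x) (A x))"
        "t5 \<le> length (L x) * ?K x + 2" by blast
    have 6: "exec (Assign 0 (Var ?ac)) s5 2 (s5(0 := s5 ?ac))"
      using exec.Assign[of 0 "Var ?ac" s5] by (simp add: eval_nat_numeral)
    have "exec ?c s (t1 + (3 + (4 + (4 + (t5 + 2 + 1) + 1) + 1) + 1) + 1) (s5(0 := s5 ?ac))"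
      by (rule exec.Seq[OF 1(1) exec.Seq[OF 2 exec.Seq[OF 3 exec.Seq[OF 4 exec.Seq[OF 5(1) 6]]]]])
    moreover have "length (L x) * ?K x \<le> csize (L x) * ?K x"
      by (intro mult_right_mono length_le_csize) auto
    then have "t1 + (3 + (4 + (4 + (t5 + 2 + 1) + 1) + 1) + 1) + 1 \<le> S x + csize (L x) * ?K x + 40"
      using 1(3) 5(3) by linarith
    ultimately show "\<exists>t s'. exec ?c s t s' \<and> s' 0 = encode (fold (F x) (L x) (A x)) \<and>
        t \<le> S x + csize (L x) * ?K x + 40"
      using 5(2)
      by (intro exI[of _ "t1 + (3 + (4 + (4 + (t5 + 2 + 1) + 1) + 1) + 1) + 1"]
          exI[of _ "s5(0 := s5 ?ac)"]) simp
  qed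
qed

lemma ptime_cong: "ptime f \<Longrightarrow> (\<And>x. g x = f x) \<Longrightarrow> ptime g"
  by (drule ext) simp

text \<open>The bound value is appended to the environment, so the body is again a function of a
  single argument.\<close>

lemma ptime_let:
  "ptime f \<Longrightarrow> ptime (\<lambda>z. g (fst z) (snd z)) \<Longrightarrow> ptime (\<lambda>x. let y = f x in g x y)"
  using ptime_comp[of "\<lambda>z. g (fst z) (snd z)" "\<lambda>x. (x, f x)"] ptime_pair[OF ptime_id, of f]
  by (simp add: Let_def)

lemma ptime_not: "ptime b \<Longrightarrow> ptime (\<lambda>x. \<not> b x)"
  by (rule ptime_cong, rule ptime_if[OF _ ptime_const[of False] ptime_const[of True]]) auto

lemma ptime_conj: "ptime b \<Longrightarrow> ptime c \<Longrightarrow> ptime (\<lambda>x. b x \<and> c x)"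
  by (rule ptime_cong, rule ptime_if[of b c "\<lambda>_. False"]) (auto intro: ptime_const)

lemma ptime_disj: "ptime b \<Longrightarrow> ptime c \<Longrightarrow> ptime (\<lambda>x. b x \<or> c x)"
  by (rule ptime_cong, rule ptime_if[of b "\<lambda>_. True" c]) (auto intro: ptime_const)

lemma ptime_iff: "ptime b \<Longrightarrow> ptime c \<Longrightarrow> ptime (\<lambda>x. b x = (c x :: bool))"
  by (rule ptime_cong, rule ptime_if[of b c "\<lambda>x. \<not> c x"]) (auto intro: ptime_not)

lemma ptime_Nil_eq: "ptime L \<Longrightarrow> ptime (\<lambda>x. L x = [])"
proof -
  assume "ptime L"
  then have "ptime (\<lambda>x. case L x of [] \<Rightarrow> True | y # ys \<Rightarrow> False)"
    by (intro ptime_case_list ptime_const)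
  moreover have "(case xs of [] \<Rightarrow> True | y # ys \<Rightarrow> False) = (xs = [])" for xs :: "'b list"
    by (cases xs) auto
  ultimately show ?thesis by simp
qed

section \<open>List functions\<close>

lemma csize_prod: "csize z = csize (fst z) + csize (snd z) + 1"
  by (simp add: encode_prod_def)

lemma csize_append: "csize (xs @ ys) = csize xs + csize (ys :: 'a::encodable list)"
  by (simp add: csize_list)

lemma csize_rev: "csize (rev xs) = csize (xs :: 'a::encodable list)"
  by (induction xs) (auto simp: csize_append)

lemma ptime_rev_append: "ptime f \<Longrightarrow> ptime g \<Longrightarrow> ptime (\<lambda>x. rev (f x) @ g x)"
proof -
  assume f: "ptime f" and g: "ptime g"
  have "ptime (\<lambda>x. fold (\<lambda>y ys. y # ys) (f x) (g x))"
  proof (rule ptime_fold[OF _ f g])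
    show "pbound (\<lambda>x. csize (f x) + csize (g x))"
      using f g by (intro pbound_add ptime_csize)
    show "csize (fold (\<lambda>y ys. y # ys) ys (g x)) \<le> csize (f x) + csize (g x)"
      if "f x = ys @ zs" for x ys zs
      using that by (simp add: fold_Cons_rev csize_append csize_rev)
  qed (intro ptime_Cons ptime_fst ptime_snd ptime_id)
  then show ?thesis by (simp add: fold_Cons_rev)
qed

lemma ptime_rev: "ptime f \<Longrightarrow> ptime (\<lambda>x. rev (f x))"
  using ptime_rev_append[of f "\<lambda>_. []", OF _ ptime_const] by simp

lemma ptime_append: "ptime f \<Longrightarrow> ptime g \<Longrightarrow> ptime (\<lambda>x. f x @ g x)"
  using ptime_rev_append[of "\<lambda>x. rev (f x)" g] ptime_rev[of f] by simp

text \<open>Maps, filters and bounded quantifiers are special cases. The result is accumulated in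
  reverse, and its size is controlled by the number of entries times a bound on the size of a single
  block.\<close>

lemma ptime_concat_map:
  fixes F :: "'a::encodable \<Rightarrow> 'y::encodable \<Rightarrow> 'b::encodable list"
  assumes F: "ptime (\<lambda>z. F (fst z) (snd z))" and L: "ptime L"
  shows "ptime (\<lambda>x. concat (map (F x) (L x)))"
proof -
  let ?G = "\<lambda>x y ys. rev (F x y) @ ys"
  have G: "fold (?G x) ys [] = rev (concat (map (F x) ys))" for x ys
    by (induction ys rule: rev_induct) auto
  obtain p where p: "\<And>z. csize (F (fst z) (snd z)) \<le> poly p (csize z)"
    using ptime_csize[OF F] unfolding pbound_def by blast
  let ?b = "\<lambda>x. csize x + csize (L x) + 1"
  have "ptime (\<lambda>x. fold (?G x) (L x) [])"
  proof (rule ptime_fold[OF _ L ptime_const])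
    have "ptime (\<lambda>z :: ('a \<times> 'y) \<times> 'b list. F (fst (fst z)) (snd (fst z)))"
      using ptime_comp[OF F ptime_fst[OF ptime_id]] .
    then show "ptime (\<lambda>z. ?G (fst (fst z)) (snd (fst z)) (snd z))"
      by (intro ptime_rev_append ptime_snd ptime_id)
    have "pbound ?b" using ptime_csize[OF L] by (intro pbound_arith)
    then show "pbound (\<lambda>x. csize (L x) * poly p (?b x))"
      using ptime_csize[OF L] by (intro pbound_mult pbound_poly)
    fix x ys zs assume "L x = ys @ zs"
    then have "csize (F x y) \<le> poly p (?b x)" if "y \<in> set ys" for y
      using that csize_member[of y "L x"]
          by (intro order_trans[OF p[of "(x, y)", simplified] poly_nat_mono]) auto
    then have "csize (concat (map (F x) ys)) \<le> length ys * poly p (?b x)"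
      by (induction ys) (auto simp: csize_append intro!: add_mono)
    also have "\<dots> \<le> csize (L x) * poly p (?b x)"
      using length_le_csize[of "L x"] \<open>L x = ys @ zs\<close> by (intro mult_right_mono) auto
    finally show "csize (fold (?G x) ys []) \<le> csize (L x) * poly p (?b x)"
      by (simp add: G csize_rev)
  qed
  from ptime_rev[OF this] show ?thesis by (simp add: G)
qed

lemma ptime_map:
  assumes "ptime (\<lambda>z. F (fst z) (snd z))" "ptime L"
  shows "ptime (\<lambda>x. map (F x) (L x))"
proof -
  have "ptime (\<lambda>x. concat (map (\<lambda>y. [F x y]) (L x)))"
    by (rule ptime_concat_map[OF _ assms(2)]) (intro ptime_Cons assms ptime_const)
  moreover have "concat (map (\<lambda>y. [F x y]) ys) = map (F x) ys" for x ys
    by (induction ys) auto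
  ultimately show ?thesis by simp
qed

lemma ptime_filter:
  assumes "ptime (\<lambda>z. P (fst z) (snd z))" "ptime L"
  shows "ptime (\<lambda>x. filter (P x) (L x))"
proof -
  have "ptime (\<lambda>x. concat (map (\<lambda>y. if P x y then [y] else []) (L x)))"
    by (rule ptime_concat_map[OF _ assms(2)])
       (intro ptime_if ptime_Cons assms ptime_const ptime_snd ptime_id)
  moreover have "concat (map (\<lambda>y. if P x y then [y] else []) ys) = filter (P x) ys" for x ys
    by (induction ys) auto
  ultimately show ?thesis by simp
qed

lemma ptime_Bex:
  assumes "ptime (\<lambda>z. P (fst z) (snd z))" "ptime L"
  shows "ptime (\<lambda>x. \<exists>y\<in>set (L x). P x y)"
  using ptime_not[OF ptime_Nil_eq[OF ptime_filter[of P L, OF assms]]]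
      by (simp add: filter_empty_conv)

lemma ptime_Ball:
  assumes "ptime (\<lambda>z. P (fst z) (snd z))" "ptime L"
  shows "ptime (\<lambda>x. \<forall>y\<in>set (L x). P x y)"
  using ptime_not[OF ptime_Bex[of "\<lambda>x y. \<not> P x y" L, OF ptime_not[OF assms(1)] assms(2)]] by simp

lemma ptime_eq_prod:
  assumes "ptime (\<lambda>x. fst (f x) = fst (g x))" "ptime (\<lambda>x. snd (f x) = snd (g x))"
  shows "ptime (\<lambda>x. f x = g x)"
  using ptime_conj[OF assms] by (simp add: prod_eq_iff)

section \<open>Binary arithmetic\<close>

fun bits :: "nat \<Rightarrow> bool list" where
  "bits n = (if n = 0 then [] else odd n # bits (n div 2))"

declare bits.simps [simp del]

abbreviation blen :: "nat \<Rightarrow> nat" where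
  "blen n \<equiv> length (bits n)"

primrec unbits :: "bool list \<Rightarrow> nat" where
  "unbits [] = 0"
| "unbits (b # bs) = of_bool b + 2 * unbits bs"

lemma encode_bits: "encode (bits n) = encode n"
proof (induction n rule: bits.induct)
  case (1 n)
  then show ?case
    by (subst bits.simps, subst encode_nat_def, subst enc_nat.simps)
       (auto simp: encode_nat_def enc_bool_def)
qed

lemma unbits_bits [simp]: "unbits (bits n) = n"
proof (induction n rule: bits.induct)
  case (1 n)
  then show ?case by (subst bits.simps) (auto simp: odd_two_times_div_two_nat)
qed

lemma unbits_append: "unbits (xs @ ys) = unbits xs + 2 ^ length xs * unbits ys"
  by (induction xs) auto

lemma unbits_less: "unbits xs < 2 ^ length xs"
  by (induction xs) auto

lemma less_exp_blen: "n < 2 ^ blen n"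
  using unbits_less[of "bits n"] by simp

lemma bits_0 [simp]: "bits 0 = []"
  by (simp add: bits.simps)

lemma bits_eq_Nil: "bits n = [] \<longleftrightarrow> n = 0"
  by (metis bits_0 unbits.simps(1) unbits_bits)

lemma blen_le: "(n :: nat) < 2 ^ k \<Longrightarrow> blen n \<le> k"
proof (induction k arbitrary: n)
  case (Suc k)
  then have "n div 2 < 2 ^ k" by auto
  from Suc.IH[OF this] show ?case by (subst bits.simps) auto
qed simp

lemma blen_mono: "m \<le> n \<Longrightarrow> blen m \<le> blen n"
  using blen_le less_exp_blen le_less_trans by blast

lemma blen_le_self: "blen n \<le> n"
  by (rule blen_le) simp

lemma blen_le_csize: "blen n \<le> csize n"
  using length_le_csize[of "bits n"] by (simp add: encode_bits)

lemma csize_bools: "csize (bs :: bool list) \<le> 2 * length bs"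
proof (induction bs)
  case (Cons b bs)
  then show ?case by (cases b) auto
qed simp

lemma csize_nat_le_blen: "csize n \<le> 2 * blen n"
  using csize_bools[of "bits n"] by (simp add: encode_bits)

lemma csize_nat_le: "csize n \<le> 2 * (n :: nat)"
  using csize_nat_le_blen[of n] blen_le_self[of n] by simp

lemma csize_le_exp: "(n :: nat) < 2 ^ k \<Longrightarrow> csize n \<le> 2 * k"
  using csize_nat_le_blen[of n] blen_le[of n k] by simp

lemma blen_mult: "blen (m * n) \<le> blen m + blen n"
  by (rule blen_le) (simp add: power_add less_exp_blen mult_strict_mono)

lemma blen_add: "blen (m + n) \<le> blen m + blen n + 1"
proof (rule blen_le)
  have "(2::nat) ^ blen m + 2 ^ blen n \<le> 2 * 2 ^ (blen m + blen n)"
    by (simp add: add_mono mult_2 power_increasing)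
  then show "m + n < 2 ^ (blen m + blen n + 1)"
    using less_exp_blen[of m] less_exp_blen[of n] by (simp add: power_add)
qed

lemma ptime_bits: "ptime f \<Longrightarrow> ptime (\<lambda>x. bits (f x))"
  by (erule ptime_reencode) (rule encode_bits)

text \<open>A bit list may end in zeros, whereas \<open>bits\<close> never does. Folding from the
  most significant bit and skipping \<open>False\<close> while the accumulator is empty restores the
  canonical form.\<close>

lemma ptime_unbits:
  assumes f: "ptime f"
  shows "ptime (\<lambda>x. unbits (f x))"
proof -
  let ?F = "\<lambda>b bs. if b then b # bs else if bs = [] then bs else b # bs"
  have F: "fold ?F (rev bs) [] = bits (unbits bs)" for bs
  proof (induction bs)
    case (Cons b bs)
    have step: "bits (unbits (b # bs)) = (if unbits (b # bs) = 0 then [] else b # bits (unbits bs))"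
      by (subst bits.simps) simp
    show ?case unfolding step by (cases b) (simp_all add: Cons bits_eq_Nil)
  qed simp
  have len: "length (fold ?F bs []) \<le> length bs" for bs
    by (induction bs rule: rev_induct) auto
  have "ptime (\<lambda>x. fold ?F (rev (f x)) [])"
  proof (rule ptime_fold[OF _ ptime_rev[OF f] ptime_const])
    show "ptime (\<lambda>z :: ('a \<times> bool) \<times> bool list. ?F (snd (fst z)) (snd z))"
      by (intro ptime_if ptime_Cons ptime_Nil_eq ptime_fst ptime_snd ptime_id)
    show "pbound (\<lambda>x. 2 * csize (f x))"
      using f by (intro pbound_mult pbound_const ptime_csize)
    fix x ys zs assume "rev (f x) = ys @ zs"
    from arg_cong[OF this, of length] have "length ys \<le> length (f x)" by simp
    then show "csize (fold ?F ys []) \<le> 2 * csize (f x)"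
      using csize_bools[of "fold ?F ys []"] len[of ys] length_le_csize[of "f x"] by linarith
  qed
  then show ?thesis
    by (rule ptime_reencode) (simp add: F encode_bits)
qed

section \<open>Addition, subtraction and comparison\<close>

definition head_bit :: "bool list \<Rightarrow> bool" where
  "head_bit bs = (case bs of [] \<Rightarrow> False | b # _ \<Rightarrow> b)"

lemma ptime_head_bit: "ptime f \<Longrightarrow> ptime (\<lambda>x. head_bit (f x))"
  unfolding head_bit_def by (intro ptime_case_list ptime_const ptime_snd ptime_fst ptime_id)

lemma unbits_head_tl: "unbits bs = of_bool (head_bit bs) + 2 * unbits (tl bs)"
  by (cases bs) (auto simp: head_bit_def)

lemma ptime_odd: "ptime f \<Longrightarrow> ptime (\<lambda>x. odd (f x :: nat))"
proof -
  have "odd n = head_bit (bits n)" for n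
    by (subst bits.simps) (auto simp: head_bit_def)
  moreover assume "ptime f"
  ultimately show ?thesis using ptime_cong[OF ptime_head_bit[OF ptime_bits[of f]]] by simp
qed

lemma ptime_half: "ptime f \<Longrightarrow> ptime (\<lambda>x. f x div (2 :: nat))"
proof -
  have "bits (n div 2) = tl (bits n)" for n
    by (subst (2) bits.simps) auto
  from arg_cong[OF this, of unbits] have "n div 2 = unbits (tl (bits n))" for n by simp
  moreover assume "ptime f"
  ultimately show ?thesis using ptime_cong[OF ptime_unbits[OF ptime_tl[OF ptime_bits[of f]]]]
      by simp
qed

text \<open>The output bits are in reverse order.\<close>

definition adder_step ::
  "(bool list \<times> bool list) \<times> bool \<times> bool list \<Rightarrow> (bool list \<times> bool list) \<times> bool \<times> bool list" where
  "adder_step z =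
    ((tl (fst (fst z)), tl (snd (fst z))),
     (if head_bit (fst (fst z)) then head_bit (snd (fst z)) \<or> fst (snd z)
      else head_bit (snd (fst z)) \<and> fst (snd z)),
     (head_bit (fst (fst z)) = (head_bit (snd (fst z)) = fst (snd z))) # snd (snd z))"

text \<open>The list \<open>ks\<close> is a clock whose length is the number of positions to
  process; beyond the end of an operand \<open>head_bit\<close> supplies zeros.\<close>

definition adder :: "bool list \<Rightarrow> bool list \<Rightarrow> bool list \<Rightarrow> bool \<Rightarrow> (bool list \<times> bool list) \<times> bool \<times>
    bool list" where
  "adder ks xs ys c = fold (\<lambda>_. adder_step) ks ((xs, ys), c, [])"

text \<open>The last equation is the loop invariant: the value of the input is that of the digits
  produced so far plus the shifted rest of both operands and the carry.\<close>

lemma adder_correct: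
  assumes "adder ks xs ys c = ((xs', ys'), c', out)"
  shows "xs' = drop (length ks) xs" "ys' = drop (length ks) ys" "length out = length ks"
    "unbits xs + unbits ys + of_bool c =
      unbits (rev out) + 2 ^ length ks * (unbits xs' + unbits ys' + of_bool c')"
proof -
  have "xs' = drop (length ks) xs \<and> ys' = drop (length ks) ys \<and> length out = length ks \<and>
    unbits xs + unbits ys + of_bool c =
      unbits (rev out) + 2 ^ length ks * (unbits xs' + unbits ys' + of_bool c')"
    using assms
  proof (induction ks arbitrary: xs' ys' c' out rule: rev_induct)
    case Nil
    then show ?case by (simp add: adder_def)
  next
    case (snoc k ks)
    obtain xs1 ys1 c1 out1 where 1: "adder ks xs ys c = ((xs1, ys1), c1, out1)"
      by (metis prod.exhaust)
    have 2: "xs' = tl xs1" "ys' = tl ys1"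
      "c' = (if head_bit xs1 then head_bit ys1 \<or> c1 else head_bit ys1 \<and> c1)"
      "out = (head_bit xs1 = (head_bit ys1 = c1)) # out1"
      using snoc.prems 1 by (auto simp: adder_def adder_step_def)
    note IH = snoc.IH[OF 1]
    have "unbits xs1 + unbits ys1 + of_bool c1 =
        of_bool (head_bit xs1 = (head_bit ys1 = c1)) + 2 * (unbits xs' + unbits ys' + of_bool c')"
      unfolding 2 by (subst unbits_head_tl[of xs1], subst unbits_head_tl[of ys1]) auto
    then have "unbits xs + unbits ys + of_bool c = unbits (rev out1) + 2 ^ length ks *
        (of_bool (head_bit xs1 = (head_bit ys1 = c1)) + 2 * (unbits xs' + unbits ys' + of_bool c'))"
      using IH by presburger
    then show ?case using IH 2
      by (auto simp: unbits_append drop_Suc tl_drop algebra_simps)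
  qed
  then show "xs' = drop (length ks) xs" "ys' = drop (length ks) ys" "length out = length ks"
    "unbits xs + unbits ys + of_bool c =
      unbits (rev out) + 2 ^ length ks * (unbits xs' + unbits ys' + of_bool c')"
    by auto
qed

lemma csize_drop: "csize (drop k xs) \<le> csize (xs :: 'a::encodable list)"
  using csize_append[of "take k xs" "drop k xs"] by simp

lemma ptime_adder:
  assumes k: "ptime k" and f: "ptime f" and g: "ptime g" and c: "ptime c"
  shows "ptime (\<lambda>x. adder (k x) (f x) (g x) (c x))"
  unfolding adder_def
proof (rule ptime_fold[OF _ k])
  show "ptime (\<lambda>x. ((f x, g x), c x, []) :: (bool list \<times> bool list) \<times> bool \<times> bool list)"
    by (intro ptime_pair f g c ptime_const)
  show "ptime (\<lambda>z :: ('a \<times> bool) \<times> (bool list \<times> bool list) \<times> bool \<times> bool list. adder_step (snd z))"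
    unfolding adder_step_def
    by (intro ptime_pair ptime_if ptime_conj ptime_disj ptime_iff ptime_head_bit ptime_tl ptime_Cons
        ptime_fst ptime_snd ptime_id)
  show "pbound (\<lambda>x. 2 * csize (k x) + csize (f x) + csize (g x) + 4)"
    using k f g by (intro pbound_add pbound_mult pbound_const ptime_csize)
  fix x ys zs assume "k x = ys @ zs"
  then have "length ys \<le> csize (k x)" using length_le_csize[of "k x"] by simp
  moreover obtain xs' ys' c' out where a: "adder ys (f x) (g x) (c x) = ((xs', ys'), c', out)"
    by (metis prod.exhaust)
  moreover have "csize c' \<le> 1" by (cases c') auto
  moreover have "csize xs' \<le> csize (f x)" "csize ys' \<le> csize (g x)" "csize out \<le> 2 * length ys"
    using adder_correct(1-3)[OF a] csize_drop csize_bools[of out] by auto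
  ultimately have "csize (adder ys (f x) (g x) (c x)) \<le> 2 * csize (k x) + csize (f x) + csize (g x)
      + 4"
    by simp
  then show "csize (fold (\<lambda>_. adder_step) ys ((f x, g x), c x, []))
      \<le> 2 * csize (k x) + csize (f x) + csize (g x) + 4"
    by (simp only: adder_def)
qed

lemma ptime_add: "ptime f \<Longrightarrow> ptime g \<Longrightarrow> ptime (\<lambda>x. f x + (g x :: nat))"
proof -
  \<comment> \<open>The length of a sum is at most the sum of the lengths plus one, so no carry is
    left when this clock runs out.\<close>
  have "m + n = unbits (rev (snd (snd (adder (bits m @ bits n @ [True]) (bits m) (bits n) False))))"
    (is "_ = ?r m n") for m n
  proof -
    let ?a = "adder (bits m @ bits n @ [True]) (bits m) (bits n) False"
    let ?k = "Suc (blen m + blen n)"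
    obtain xs' ys' c' out where a: "?a = ((xs', ys'), c', out)" by (metis prod.exhaust)
    have *: "m + n = unbits (rev out) + 2 ^ ?k * of_bool c'"
      using adder_correct[OF a] by auto
    have "m + n < 2 ^ ?k"
      using blen_add[of m n] less_exp_blen[of "m + n"]
      by (smt (verit) Suc_eq_plus1 less_le_trans one_le_numeral power_increasing)
    with * have "\<not> c'" by (cases c') auto
    with * a show ?thesis by simp
  qed
  moreover assume f: "ptime f" and g: "ptime g"
  have "ptime (\<lambda>x. ?r (f x) (g x))"
    by (intro ptime_unbits ptime_rev ptime_snd ptime_adder ptime_append ptime_bits ptime_const f g)
  ultimately show ?thesis by simp
qed

text \<open>Subtraction adds the two's complement; the final carry is absent iff the difference is
    negative.\<close>

lemma ptime_diff: "ptime f \<Longrightarrow> ptime g \<Longrightarrow> ptime (\<lambda>x. f x - (g x :: nat))"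
proof -
  have compl: "unbits (map Not xs) + unbits xs + 1 = 2 ^ length xs" for xs
    by (induction xs) auto
  have "m - n = (let ks = bits n @ map (\<lambda>_. False) (bits m);
      z = snd (adder ks (bits m) (map Not ks) True)
      in if fst z then unbits (rev (snd z)) else 0)" (is "_ = ?r m n") for m n
  proof -
    \<comment> \<open>Padding with zeros on the high side makes the clock outlast both operands
      without changing the value.\<close>
    define ks where "ks = bits n @ map (\<lambda>_. False) (bits m)"
    have "unbits (map (\<lambda>_. False) xs) = 0" for xs :: "bool list" by (induction xs) auto
    then have n: "unbits ks = n" by (simp add: ks_def unbits_append)
    obtain xs' ys' c' out where a: "adder ks (bits m) (map Not ks) True = ((xs', ys'), c', out)"
      by (metis prod.exhaust)
    have *: "m + unbits (map Not ks) + 1 = unbits (rev out) + 2 ^ length ks * of_bool c'"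
      using adder_correct[OF a] by (simp add: ks_def)
    have "unbits (rev out) < 2 ^ length ks"
      using unbits_less[of "rev out"] adder_correct(3)[OF a] by simp
    with * compl[of ks] n have "m - n = (if c' then unbits (rev out) else 0)"
      by (cases c') auto
    with a show ?thesis by (simp add: ks_def Let_def)
  qed
  moreover assume f: "ptime f" and g: "ptime g"
  note f' = ptime_comp[OF f] and g' = ptime_comp[OF g]
  have "ptime (\<lambda>x. ?r (f x) (g x))"
    by (intro ptime_let ptime_if ptime_const ptime_adder ptime_map ptime_not ptime_unbits
      ptime_rev ptime_append ptime_bits ptime_fst ptime_snd ptime_id f' g')
  ultimately show ?thesis by simp
qed

lemma ptime_eq_0: "ptime f \<Longrightarrow> ptime (\<lambda>x. f x = (0 :: nat))"
  using ptime_Nil_eq[OF ptime_bits, of f] by (simp add: bits_eq_Nil)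

lemma ptime_le: "ptime f \<Longrightarrow> ptime g \<Longrightarrow> ptime (\<lambda>x. f x \<le> (g x :: nat))"
  using ptime_eq_0[OF ptime_diff, of f g] by simp

lemma ptime_less: "ptime f \<Longrightarrow> ptime g \<Longrightarrow> ptime (\<lambda>x. f x < (g x :: nat))"
  using ptime_not[OF ptime_le, of g f] by (simp add: not_le)

lemma ptime_eq_nat: "ptime f \<Longrightarrow> ptime g \<Longrightarrow> ptime (\<lambda>x. f x = (g x :: nat))"
  using ptime_conj[OF ptime_le ptime_le, of f g g f] by (simp add: eq_iff)

lemma ptime_Suc: "ptime f \<Longrightarrow> ptime (\<lambda>x. Suc (f x))"
  using ptime_add[of f "\<lambda>_. 1"] by (simp add: ptime_const)

text \<open>Schoolbook multiplication: the state holds the shifted second factor and the partial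
  product. Both stay below \<open>2 ^ (length ys + blen (g x))\<close> after the bits
  \<open>ys\<close>.\<close>

lemma ptime_mult:
  assumes f: "ptime f" and g: "ptime g"
  shows "ptime (\<lambda>x. f x * (g x :: nat))"
proof -
  let ?F = "\<lambda>b z. (fst z + fst z, if b then snd z + fst z else snd z) :: nat \<times> nat"
  have F: "fold ?F bs (n, 0) = (2 ^ length bs * n, unbits bs * n)" for bs n
    by (induction bs rule: rev_induct) (auto simp: unbits_append algebra_simps)
  have "ptime (\<lambda>x. fold ?F (bits (f x)) (g x, 0))"
  proof (rule ptime_fold)
    show "ptime (\<lambda>z :: ('a \<times> bool) \<times> nat \<times> nat. ?F (snd (fst z)) (snd z))"
      by (intro ptime_pair ptime_if ptime_add ptime_fst ptime_snd ptime_id)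
    show "ptime (\<lambda>x. bits (f x))" "ptime (\<lambda>x. (g x, 0 :: nat))"
      by (intro ptime_bits ptime_pair f g ptime_const)+
    show "pbound (\<lambda>x. 4 * (csize (f x) + csize (g x)) + 1)"
      using f g by (intro pbound_add pbound_mult pbound_const ptime_csize)
    fix x ys zs assume yz: "bits (f x) = ys @ zs"
    then have len: "length ys \<le> csize (f x)" using blen_le_csize[of "f x"] by simp
    have "csize (2 ^ length ys * g x) \<le> 2 * (length ys + blen (g x))"
      by (intro csize_le_exp) (simp add: power_add less_exp_blen)
    moreover have "csize (unbits ys * g x) \<le> 2 * (length ys + blen (g x))"
      by (intro csize_le_exp) (simp add: power_add less_exp_blen mult_strict_mono unbits_less)
    ultimately show "csize (fold ?F ys (g x, 0)) \<le> 4 * (csize (f x) + csize (g x)) + 1"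
      using len blen_le_csize[of "g x"] by (simp add: F)
  qed
  from ptime_snd[OF this] show ?thesis by (simp add: F)
qed

lemma ptime_power: "ptime f \<Longrightarrow> ptime (\<lambda>x. f x ^ k :: nat)"
  by (induction k) (auto intro: ptime_const ptime_mult)

text \<open>Long division from the most significant bit, with quotient and remainder as the
  state.\<close>

lemma ptime_div:
  assumes f: "ptime f" and g: "ptime g"
  shows "ptime (\<lambda>x. f x div (g x :: nat))"
proof -
  let ?F = "\<lambda>d b z. let r = 2 * snd z + (if b then 1 else 0) in
    (if d \<le> r then (2 * fst z + 1, r - d) else (2 * fst z, r)) :: nat \<times> nat"
  have *: "fst z * d + snd z = unbits (rev bs) \<and> snd z < d"
    if "z = fold (?F d) bs (0, 0)" "d > 0" for bs d z
    using that
  proof (induction bs arbitrary: z rule: rev_induct)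
    case (snoc b bs)
    then show ?case by (auto simp: Let_def unbits_append algebra_simps)
  qed simp
  have div: "m div d = (if d = 0 then 0 else fst (fold (?F d) (rev (bits m)) (0, 0)))" for m d
  proof (cases "d = 0")
    case False
    define z where "z = fold (?F d) (rev (bits m)) (0, 0)"
    have "m = fst z * d + snd z" "snd z < d" using *[OF z_def] False by auto
    then show ?thesis using False unfolding z_def[symmetric]
      by (metis add.commute div_less div_mult_self1 add.left_neutral)
  qed simp
  \<comment> \<open>Zero divisors are included, since the fold must be of polynomial size on all
    inputs, also where the surrounding conditional discards it.\<close>
  have size: "fst (fold (?F d) bs (0, 0)) < 2 ^ length bs \<and> snd (fold (?F d) bs (0, 0))
      < 2 ^ length bs"
    for d bs
    by (induction bs rule: rev_induct) (auto simp: Let_def)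
  have "ptime (\<lambda>x. fold (?F (g x)) (rev (bits (f x))) (0, 0))"
  proof (rule ptime_fold)
    note g' = ptime_comp[OF g]
    show "ptime (\<lambda>z :: ('a \<times> bool) \<times> nat \<times> nat. ?F (g (fst (fst z))) (snd (fst z)) (snd z))"
      by (intro ptime_let ptime_if ptime_pair ptime_add ptime_mult ptime_diff ptime_le ptime_fst
          ptime_snd ptime_id ptime_const g')
    show "ptime (\<lambda>x. rev (bits (f x)))" "ptime (\<lambda>x :: 'a. (0 :: nat, 0 :: nat))"
      by (intro ptime_rev ptime_bits f ptime_const)+
    show "pbound (\<lambda>x. 4 * csize (f x) + 1)"
      using f by (intro pbound_add pbound_mult pbound_const ptime_csize)
    fix x ys zs assume yz: "rev (bits (f x)) = ys @ zs"
    from arg_cong[OF yz, of length] have len: "length ys \<le> csize (f x)"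
      using blen_le_csize[of "f x"] by simp
    let ?z = "fold (?F (g x)) ys (0, 0)"
    have "csize (fst ?z) \<le> 2 * length ys" "csize (snd ?z) \<le> 2 * length ys"
      using size[of "g x" ys] by (blast intro: csize_le_exp)+
    then show "csize ?z \<le> 4 * csize (f x) + 1" using len csize_prod[of ?z] by linarith
  qed
  then show ?thesis unfolding div
    by (intro ptime_if ptime_const ptime_eq_0 g ptime_fst)
qed

lemma ptime_sum_list:
  assumes f: "ptime f"
  shows "ptime (\<lambda>x. sum_list (f x :: nat list))"
proof -
  have blen: "blen (sum_list ns) \<le> csize ns" for ns
  proof (induction ns)
    case (Cons n ns)
    then show ?case using blen_add[of n "sum_list ns"] blen_le_csize[of n] by simp
  qed simp
  have "fold (+) ns a = a + sum_list ns" for ns and a :: nat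
    by (induction ns arbitrary: a) auto
  then have F: "fold (+) ns 0 = sum_list ns" for ns :: "nat list" by simp
  have "ptime (\<lambda>x. fold (+) (f x) 0)"
  proof (rule ptime_fold[OF _ f ptime_const])
    show "ptime (\<lambda>z :: ('a \<times> nat) \<times> nat. snd (fst z) + snd z)"
      by (intro ptime_add ptime_fst ptime_snd ptime_id)
    show "pbound (\<lambda>x. 2 * csize (f x))"
      using f by (intro pbound_mult pbound_const ptime_csize)
    fix x ys zs assume "f x = ys @ zs"
    then have "csize ys \<le> csize (f x)" by (simp add: csize_append)
    then show "csize (fold (+) ys 0) \<le> 2 * csize (f x)"
      using blen[of ys] csize_nat_le_blen[of "sum_list ys"] unfolding F by linarith
  qed
  then show ?thesis by (simp add: F)
qed

text \<open>Bit lengths at most add up under multiplication. So the product of all denominators,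
  used as a common denominator, has polynomial length.\<close>

lemma ptime_prod_list:
  assumes f: "ptime f"
  shows "ptime (\<lambda>x. prod_list (f x :: nat list))"
proof -
  have blen: "blen (prod_list ns) \<le> csize ns + 1" for ns
  proof (induction ns)
    case (Cons n ns)
    then show ?case using blen_mult[of n "prod_list ns"] blen_le_csize[of n] by simp
  qed (simp add: bits.simps)
  have "fold (*) ns a = a * prod_list ns" for ns and a :: nat
    by (induction ns arbitrary: a) auto
  then have F: "fold (*) ns 1 = prod_list ns" for ns :: "nat list" by simp
  have "ptime (\<lambda>x. fold (*) (f x) 1)"
  proof (rule ptime_fold[OF _ f ptime_const])
    show "ptime (\<lambda>z :: ('a \<times> nat) \<times> nat. snd (fst z) * snd z)"
      by (intro ptime_mult ptime_fst ptime_snd ptime_id)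
    show "pbound (\<lambda>x. 2 * csize (f x) + 2)"
      using f by (intro pbound_add pbound_mult pbound_const ptime_csize)
    fix x ys zs assume "f x = ys @ zs"
    then have "csize ys \<le> csize (f x)" by (simp add: csize_append)
    then show "csize (fold (*) ys 1) \<le> 2 * csize (f x) + 2"
      using blen[of ys] csize_nat_le_blen[of "prod_list ys"] unfolding F by linarith
  qed
  then show ?thesis by (simp only: F)
qed

lemma ptime_length:
  assumes "ptime f"
  shows "ptime (\<lambda>x. length (f x))"
proof -
  have "ptime (\<lambda>x. sum_list (map (\<lambda>_. 1 :: nat) (f x)))"
    by (intro ptime_sum_list ptime_map ptime_const assms)
  then show ?thesis by (simp add: sum_list_triv)
qed

lemma csize_nat_list_le:
  "(\<And>i. i \<in> set is \<Longrightarrow> i \<le> k) \<Longrightarrow> csize is \<le> length is * (2 * k + 1)" for k :: nat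
proof (induction "is")
  case (Cons i "is")
  then show ?case using csize_nat_le[of i] by force
qed simp

text \<open>The upper end is the length of a list at hand and hence polynomial; a range up to a
  number given in binary could be exponentially long.\<close>

lemma ptime_upt_length:
  assumes f: "ptime f"
  shows "ptime (\<lambda>x. [0..<length (f x)])"
proof -
  let ?F = "\<lambda>is. (case is of [] \<Rightarrow> 0 | i # _ \<Rightarrow> Suc i) # is"
  have F: "fold (\<lambda>_. ?F) xs [] = rev [0..<length xs]" for xs :: "'b list"
  proof (induction xs rule: rev_induct)
    case (snoc x xs)
    show ?case by (cases "length xs") (simp_all add: snoc.IH)
  qed simp
  have "ptime (\<lambda>x. fold (\<lambda>_. ?F) (f x) [])"
  proof (rule ptime_fold[OF _ f ptime_const])
    show "ptime (\<lambda>z :: ('a \<times> 'b) \<times> nat list. ?F (snd z))"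
      by (intro ptime_Cons ptime_case_list ptime_Suc ptime_const ptime_fst ptime_snd ptime_id)
    show "pbound (\<lambda>x. csize (f x) * (2 * csize (f x) + 1))"
      using f by (intro pbound_add pbound_mult pbound_const ptime_csize)
    fix x ys zs assume "f x = ys @ zs"
    then have len: "length ys \<le> csize (f x)" using length_le_csize[of "f x"] by simp
    from csize_nat_list_le[of "[0..<length ys]" "csize (f x)"]
    have "csize [0..<length ys] \<le> length ys * (2 * csize (f x) + 1)" using len by simp
    also have "\<dots> \<le> csize (f x) * (2 * csize (f x) + 1)"
      by (intro mult_right_mono len) simp
    finally show "csize (fold (\<lambda>_. ?F) ys []) \<le> csize (f x) * (2 * csize (f x) + 1)"
      by (simp add: F csize_rev)
  qed
  from ptime_rev[OF this] show ?thesis by (simp add: F)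
qed

lemma ptime_zip:
  assumes f: "ptime f" and g: "ptime g"
  shows "ptime (\<lambda>x. zip (f x) (g x))"
proof -
  let ?F = "\<lambda>y z. case fst z of [] \<Rightarrow> z | w # ws \<Rightarrow> (ws, (y, w) # snd z)"
  have "fold ?F ys (ws, out) = (drop (length ys) ws, rev (zip ys ws) @ out)"
    for ys :: "'b list" and ws :: "'c list" and out
  proof (induction ys arbitrary: ws out)
    case (Cons y ys)
    then show ?case by (cases ws) auto
  qed simp
  then have F: "fold ?F ys (ws, []) = (drop (length ys) ws, rev (zip ys ws))"
    for ys :: "'b list" and ws :: "'c list" by simp
  have zip: "csize (zip ys ws) \<le> csize ys + csize ws" for ys :: "'b list" and ws :: "'c list"
  proof (induction ys arbitrary: ws)
    case (Cons y ys)
    then show ?case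
    proof (cases ws)
      case (Cons w ws')
      then show ?thesis using Cons.IH[of ws'] by simp
    qed simp
  qed simp
  have "ptime (\<lambda>x. fold ?F (f x) (g x, []))"
  proof (rule ptime_fold[OF _ f])
    show "ptime (\<lambda>x. (g x, [] :: ('b \<times> 'c) list))" by (intro ptime_pair g ptime_const)
    show "ptime (\<lambda>z :: ('a \<times> 'b) \<times> 'c list \<times> ('b \<times> 'c) list. ?F (snd (fst z)) (snd z))"
      by (intro ptime_case_list ptime_pair ptime_Cons ptime_fst ptime_snd ptime_id)
    show "pbound (\<lambda>x. csize (f x) + 2 * csize (g x) + 1)"
      using f g by (intro pbound_add pbound_mult pbound_const ptime_csize)
    fix x ys zs assume "f x = ys @ zs"
    then show "csize (fold ?F ys (g x, [])) \<le> csize (f x) + 2 * csize (g x) + 1"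
      using zip[of ys "g x"] csize_drop[of "length ys" "g x"]
          by (simp add: F csize_rev csize_append)
  qed
  from ptime_rev[OF ptime_snd[OF this]] show ?thesis by (simp add: F)
qed

lemmas ptime_rules =
  ptime_id ptime_const ptime_fst ptime_snd ptime_pair ptime_Cons ptime_tl ptime_if ptime_let
  ptime_case_list ptime_not ptime_conj ptime_disj ptime_Nil_eq ptime_rev ptime_append
  ptime_concat_map ptime_map ptime_filter ptime_Bex ptime_Ball ptime_odd ptime_half ptime_add
  ptime_diff ptime_le ptime_less ptime_eq_nat ptime_Suc ptime_mult ptime_power ptime_div
  ptime_sum_list ptime_prod_list ptime_length ptime_upt_length ptime_zip ptime_eq_prod

lemma csize_map_le:
  assumes "\<And>y. y \<in> set ys \<Longrightarrow> csize (f y) \<le> c * csize y + d"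
  shows "csize (map f ys) \<le> (c + d + 1) * csize (ys :: 'a::encodable list)"
  using assms
proof (induction ys)
  case (Cons y ys)
  have "csize (map f ys) \<le> (c + d + 1) * csize ys" using Cons by auto
  moreover have "csize (f y) \<le> c * csize y + d" using Cons by auto
  ultimately show ?case by (simp add: algebra_simps)
qed simp

text \<open>The premise bounds the value of \<open>f\<close>, not its bit length. Doubling once per
  bit gives a unary counter whose length is a power of two, greater than \<open>f x\<close> and at
  most \<open>2 * f x + 1\<close>.\<close>

lemma ptime_replicate:
  assumes f: "ptime f" and le: "pbound f"
  shows "ptime (\<lambda>x. replicate (2 ^ blen (f x)) ())"
proof -
  have csize: "csize (replicate k ()) = k" for k by (induction k) auto
  have F: "fold (\<lambda>_ us. us @ us) bs [()] = replicate (2 ^ length bs) ()" for bs :: "bool list"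
    by (induction bs rule: rev_induct) (auto simp: replicate_add mult_2)
  have "n > 0 \<Longrightarrow> 2 ^ blen n \<le> 2 * n" for n
  proof (induction n rule: bits.induct)
    case (1 n)
    then show ?case by (subst bits.simps) (cases "n div 2 = 0", auto)
  qed
  then have pow: "2 ^ blen n \<le> 2 * n + 1" for n
    by (cases "n = 0") (auto simp: le_SucI)
  have "ptime (\<lambda>x. fold (\<lambda>_ us. us @ us) (bits (f x)) [()])"
  proof (rule ptime_fold[OF _ ptime_bits[OF f] ptime_const])
    show "ptime (\<lambda>z :: ('a \<times> bool) \<times> unit list. snd z @ snd z)"
      by (intro ptime_rules)
    show "pbound (\<lambda>x. 2 * f x + 1)" by (intro pbound_add pbound_mult pbound_const le)
    fix x ys zs assume "bits (f x) = ys @ zs"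
    from arg_cong[OF this, of length] have "length ys \<le> blen (f x)" by simp
    from power_increasing[OF this, of "2 :: nat"]
    have "(2 :: nat) ^ length ys \<le> 2 * f x + 1" using pow[of "f x"] by linarith
    then show "csize (fold (\<lambda>_ us. us @ us) ys [()]) \<le> 2 * f x + 1"
      by (simp only: F csize)
  qed
  then show ?thesis by (simp add: F)
qed

text \<open>A key \<open>(a, b)\<close> stands for the integer \<open>a - b\<close>; comparing cross
  sums avoids signed arithmetic. The scores of the queue iteration have this form.\<close>

definition least_by :: "('a \<Rightarrow> nat \<times> nat) \<Rightarrow> 'a \<Rightarrow> 'a list \<Rightarrow> 'a" where
  "least_by f e es =
    fold (\<lambda>e b. if fst (f e) + snd (f b) < fst (f b) + snd (f e) then e else b) es e"

lemma least_by_in: "least_by f e es \<in> set (e # es)"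
  unfolding least_by_def by (induction es rule: rev_induct) auto

lemma least_by_le:
  "x \<in> set (e # es) \<Longrightarrow>
    int (fst (f (least_by f e es))) - int (snd (f (least_by f e es))) \<le> int (fst (f x))
        - int (snd (f x))"
  unfolding least_by_def by (induction es arbitrary: x rule: rev_induct) force+

lemma ptime_least_by:
  assumes f: "ptime (\<lambda>z. f (fst z) (snd z))" and e: "ptime e" and es: "ptime es"
  shows "ptime (\<lambda>x. least_by (f x) (e x) (es x))"
  unfolding least_by_def
proof (rule ptime_fold[OF _ es e])
  note f' = ptime_comp[OF f, of "\<lambda>z. (g z, h z)" for g h, unfolded fst_conv snd_conv]
  show "ptime (\<lambda>z. if fst (f (fst (fst z)) (snd (fst z))) + snd (f (fst (fst z)) (snd z))
      < fst (f (fst (fst z)) (snd z)) + snd (f (fst (fst z)) (snd (fst z))) then snd (fst z)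
          else snd z)"
    by (intro ptime_rules f')
  show "pbound (\<lambda>x. csize (e x) + csize (es x))"
    using e es by (intro pbound_add ptime_csize)
  fix x ys zs assume "es x = ys @ zs"
  moreover have "least_by (f x) (e x) ys \<in> set (e x # ys)" by (rule least_by_in)
  ultimately have "least_by (f x) (e x) ys = e x \<or> least_by (f x) (e x) ys \<in> set (es x)" by auto
  then have "csize (least_by (f x) (e x) ys) \<le> csize (e x) + csize (es x)"
    using csize_member[of "least_by (f x) (e x) ys" "es x"] by fastforce
  then show "csize (fold (\<lambda>ea b. if fst (f x ea) + snd (f x b) < fst (f x b) + snd (f x ea) then ea
      else b)
      ys (e x)) \<le> csize (e x) + csize (es x)"
    by (simp only: least_by_def)
qed

section \<open>The algorithm\<close>

text \<open>
  An item \<open>(p, h, c, w)\<close> stands for the assignment, at cost \<open>w\<close>, of the point \<open>p\<close> of color \<open>h\<close>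
  to the center \<open>c\<close>. A row is the list of the items of one point.
\<close>

type_synonym item = "nat \<times> nat \<times> nat \<times> nat"

abbreviation item_point :: "item \<Rightarrow> nat" where "item_point e \<equiv> fst e"
abbreviation item_color :: "item \<Rightarrow> nat" where "item_color e \<equiv> fst (snd e)"
abbreviation item_center :: "item \<Rightarrow> nat" where "item_center e \<equiv> fst (snd (snd e))"
abbreviation item_cost :: "item \<Rightarrow> nat" where "item_cost e \<equiv> snd (snd (snd e))"

lemma ptime_in_set_item: "ptime f \<Longrightarrow> ptime L \<Longrightarrow> ptime (\<lambda>x. f x \<in> set (L x :: item list))"
proof -
  assume f: "ptime f" and L: "ptime L"
  note f' = ptime_comp[OF f]
  have "ptime (\<lambda>x. \<exists>e\<in>set (L x). e = f x)"
    by (intro ptime_rules L f')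
  then show ?thesis by (simp add: Bex_def)
qed

section \<open>Greedy matchings and the two sides of their alternating cycles\<close>

definition match_step :: "(item \<Rightarrow> 'k) \<Rightarrow> item \<Rightarrow> (item \<times> item) list \<times> item list \<Rightarrow>
    (item \<times> item) list \<times> item list" where
  "match_step key e z = (case filter (\<lambda>d. key d = key e) (snd z) of
      [] \<Rightarrow> (fst z, e # snd z)
    | d # _ \<Rightarrow> ((d, e) # fst z, filter (\<lambda>d. \<not> key d = key e) (snd z)))"

text \<open>The second component collects the unmatched items. Their keys remain pairwise different,
  so at most one of them can match the next item.\<close>

definition match :: "(item \<Rightarrow> 'k) \<Rightarrow> item list \<Rightarrow> (item \<times> item) list \<times> item list" where
  "match key es = fold (match_step key) es ([], [])"

lemma csize_filter_partition: "csize (filter P xs) + csize (filter (\<lambda>x. \<not> P x) xs)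
    = csize (xs :: 'a::encodable list)"
  by (induction xs) auto

lemma ptime_match:
  assumes key: "ptime (\<lambda>z :: item \<times> item. key (fst z) = key (snd z))"
    and L: "ptime (L :: 'a::encodable \<Rightarrow> item list)"
  shows "ptime (\<lambda>x. match key (L x))"
  unfolding match_def
proof (rule ptime_fold[OF _ L ptime_const])
  note k = ptime_comp[OF key, of "\<lambda>z. (g z, h z)" for g h, unfolded fst_conv snd_conv]
  show "ptime (\<lambda>z :: ('a \<times> item) \<times> (item \<times> item) list \<times> item list. match_step key (snd (fst z))
      (snd z))"
    unfolding match_step_def by (intro ptime_rules k)
  have step: "csize (fst (match_step key e z)) + csize (snd (match_step key e z))
      \<le> csize (fst z) + csize (snd z) + csize e + 1" for e z
  proof (cases "filter (\<lambda>d. key d = key e) (snd z)")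
    case (Cons d ds)
    then show ?thesis
      using csize_filter_partition[of "\<lambda>d. key d = key e" "snd z"]
      by (simp add: match_step_def)
  qed (simp add: match_step_def)
  have "csize (fst (fold (match_step key) es ([], [])))
      + csize (snd (fold (match_step key) es ([], [])))
      \<le> csize es" for es
  proof (induction es rule: rev_induct)
    case (snoc e es)
    then show ?case using step[of e "fold (match_step key) es ([], [])"] by (simp add: csize_append)
  qed simp
  then have fold: "csize (fold (match_step key) es ([], [])) \<le> csize es + 1" for es
    by (subst csize_prod) simp
  show "pbound (\<lambda>x. csize (L x) + 1)" by (intro pbound_add pbound_const ptime_csize L)
  show "csize (fold (match_step key) ys ([], [])) \<le> csize (L x) + 1" if "L x = ys @ zs" for x ys zs
    using fold[of ys] that by (simp add: csize_append)
qed

definition partner :: "(item \<times> item) list \<Rightarrow> item \<Rightarrow> item" where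
  "partner ps e = (case filter (\<lambda>z. fst z = e \<or> snd z = e) ps of
      [] \<Rightarrow> e
    | z # _ \<Rightarrow> if fst z = e then snd z else fst z)"

lemma ptime_partner:
  assumes ps: "ptime ps" and e: "ptime e"
  shows "ptime (\<lambda>x. partner (ps x) (e x))"
  unfolding partner_def
proof -
  note e' = ptime_comp[OF e]
  show "ptime (\<lambda>x. case filter (\<lambda>z. fst z = e x \<or> snd z = e x) (ps x) of
      [] \<Rightarrow> e x | z # _ \<Rightarrow> if fst z = e x then snd z else fst z)"
    by (intro ptime_rules ps e e')
qed

lemma csize_partner: "csize (partner ps e) \<le> max (csize e) (csize ps)"
proof (cases "filter (\<lambda>z. fst z = e \<or> snd z = e) ps")
  case (Cons z zs)
  then have "z \<in> set (filter (\<lambda>z. fst z = e \<or> snd z = e) ps)" by simp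
  then have "csize z < csize ps" by (intro csize_member) simp
  moreover have "partner ps e = fst z \<or> partner ps e = snd z" using Cons by (simp add: partner_def)
  ultimately show ?thesis using csize_prod[of z] by (auto simp: max_def)
qed (simp add: partner_def)

text \<open>\<open>ks\<close> is a clock. It is instantiated with the list of all items, long enough
  to run through the whole orbit because periods are at most the number of items.\<close>

definition orbit_list :: "(item \<times> item) list \<Rightarrow> (item \<times> item) list \<Rightarrow> item list \<Rightarrow> item \<Rightarrow> item list"
    where
  "orbit_list ps qs ks e =
    snd (fold (\<lambda>_ z. (partner qs (partner ps (fst z)), fst z # snd z)) ks (e, []))"

lemma ptime_orbit_list:
  assumes ps: "ptime ps" and qs: "ptime qs" and ks: "ptime ks" and e: "ptime e"
  shows "ptime (\<lambda>x. orbit_list (ps x) (qs x) (ks x) (e x))"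
  unfolding orbit_list_def
proof (rule ptime_snd, rule ptime_fold[OF _ ks])
  let ?F = "\<lambda>x z. (partner (qs x) (partner (ps x) (fst z)), fst z # snd z)"
  note ps' = ptime_comp[OF ps] and qs' = ptime_comp[OF qs]
  show "ptime (\<lambda>x. (e x, [] :: item list))" by (intro ptime_rules e)
  show "ptime (\<lambda>z :: ('a \<times> item) \<times> item \<times> item list. ?F (fst (fst z)) (snd z))"
    by (intro ptime_rules ptime_partner ps' qs')
  let ?b = "\<lambda>x. csize (e x) + csize (ps x) + csize (qs x)"
  let ?B = "\<lambda>x. ?b x + csize (ks x) * (?b x + 1) + 1"
  show "pbound ?B" by (intro pbound_add pbound_mult pbound_const ptime_csize ps qs ks e)
  have step: "csize (partner (qs x) (partner (ps x) f)) \<le> ?b x" if "csize f \<le> ?b x" for x f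
    using that csize_partner[of "ps x" f] csize_partner[of "qs x" "partner (ps x) f"] by linarith
  have *: "csize (fst (fold (\<lambda>_. ?F x) ys (e x, []))) \<le> ?b x \<and>
      csize (snd (fold (\<lambda>_. ?F x) ys (e x, [])))
          \<le> length ys * (?b x + 1)" for x and ys :: "item list"
    by (induction ys rule: rev_induct) (use step in auto)
  then show "csize (fold (\<lambda>_. ?F x) ys (e x, [])) \<le> ?B x" if "ks x = ys @ zs" for x ys zs
  proof -
    have "length ys * (?b x + 1) \<le> csize (ks x) * (?b x + 1)"
      using length_le_csize[of "ks x"] that by (intro mult_right_mono) auto
    then show ?thesis
      using *[of x ys] csize_prod[of "fold (\<lambda>_. ?F x) ys (e x, [])"] by linarith
  qed
qed

text \<open>
  The permutation \<open>partner qs \<circ> partner ps\<close> has two orbits on each cycle of the union of the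
  matchings \<open>ps\<close> and \<open>qs\<close>, and both matchings exchange them.
\<close>

definition positive :: "(item \<times> item) list \<Rightarrow> (item \<times> item) list \<Rightarrow> item list \<Rightarrow> item \<Rightarrow> bool" where
  "positive ps qs es e =
    (case filter (\<lambda>d. d \<in> set (orbit_list ps qs es e)
        \<or> d \<in> set (orbit_list ps qs es (partner ps e))) es of
      [] \<Rightarrow> False
    | d # _ \<Rightarrow> d \<in> set (orbit_list ps qs es e))"

lemma ptime_positive:
  assumes ps: "ptime ps" and qs: "ptime qs" and es: "ptime es" and e: "ptime e"
  shows "ptime (\<lambda>x. positive (ps x) (qs x) (es x) (e x))"
  unfolding positive_def
proof -
  note * = ptime_comp[OF e] ptime_comp[OF ps] ptime_comp[OF qs] ptime_comp[OF es]
  show "ptime (\<lambda>x. case filter (\<lambda>d. d \<in> set (orbit_list (ps x) (qs x) (es x) (e x)) \<or>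
          d \<in> set (orbit_list (ps x) (qs x) (es x) (partner (ps x) (e x)))) (es x) of
      [] \<Rightarrow> False | d # _ \<Rightarrow> d \<in> set (orbit_list (ps x) (qs x) (es x) (e x)))"
    by (intro ptime_rules ptime_in_set_item ptime_orbit_list ptime_partner * e ps qs es)
qed

definition total_cost :: "item list \<Rightarrow> nat" where
  "total_cost es = sum_list (map item_cost es)"

lemma ptime_total_cost: "ptime f \<Longrightarrow> ptime (\<lambda>x. total_cost (f x))"
  unfolding total_cost_def by (intro ptime_rules)

definition cell_key :: "item \<Rightarrow> nat \<times> nat" where
  "cell_key e = (item_color e, item_center e)"

definition row_matching :: "item list \<Rightarrow> (item \<times> item) list" where
  "row_matching es = fst (match item_point es)"

text \<open>Each level pairs the leftovers of the one before. The third, which ignores all keys,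
  completes the matching across clusters; at that point at most one item per cluster is left, which
  limits the change of cluster sizes.\<close>

definition cell_matching :: "item list \<Rightarrow> (item \<times> item) list" where
  "cell_matching es =
    (let a = match cell_key es; b = match item_center (snd a); c = match (\<lambda>_. ()) (snd b)
     in fst a @ fst b @ fst c)"

definition rounded_up :: "item list \<Rightarrow> item list" where
  "rounded_up es =
    (let ps = row_matching es; qs = cell_matching es;
         as = filter (\<lambda>e. positive ps qs es e) es; bs = filter (\<lambda>e. \<not> positive ps qs es e) es
     in if total_cost as \<le> total_cost bs then as else bs)"

definition halve :: "(item \<times> nat) list \<Rightarrow> (item \<times> nat) list" where
  "halve xs =
    (let up = rounded_up (map fst (filter (\<lambda>z. odd (snd z)) xs))
     in map (\<lambda>z. (fst z, snd z div 2 + (if fst z \<in> set up then 1 else 0))) xs)"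

lemma ptime_row_matching: "ptime f \<Longrightarrow> ptime (\<lambda>x. row_matching (f x))"
  unfolding row_matching_def by (intro ptime_rules ptime_match)

lemma ptime_cell_matching: "ptime f \<Longrightarrow> ptime (\<lambda>x. cell_matching (f x))"
  unfolding cell_matching_def cell_key_def by (intro ptime_rules ptime_match)

lemma ptime_rounded_up: "ptime f \<Longrightarrow> ptime (\<lambda>x. rounded_up (f x))"
proof -
  assume f: "ptime f"
  note f' = ptime_comp[OF f]
  show ?thesis unfolding rounded_up_def
    by (intro ptime_rules ptime_row_matching ptime_cell_matching ptime_positive ptime_total_cost f
        f')
qed

lemma ptime_halve: "ptime f \<Longrightarrow> ptime (\<lambda>x. halve (f x))"
proof -
  assume f: "ptime f"
  note f' = ptime_comp[OF f]
  show ?thesis unfolding halve_def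
    by (intro ptime_rules ptime_rounded_up ptime_in_set_item f f')
qed

text \<open>
  A cell \<open>(((h, c), (L, U)), (a, b))\<close> carries the fairness bounds \<open>L / Q\<close> and \<open>U / Q\<close> for the points
  of color \<open>h\<close> in the cluster of \<open>c\<close>,
      where \<open>Q\<close> is a common denominator, together with the queues \<open>a\<close>
  and \<open>b\<close> that accumulate the violations of the upper and of the lower bound. Truncated subtraction
  in \<open>update\<close> keeps the queues nonnegative.
\<close>

type_synonym cell = "((nat \<times> nat) \<times> (nat \<times> nat)) \<times> (nat \<times> nat)"

abbreviation cell_color :: "cell \<Rightarrow> nat" where "cell_color K \<equiv> fst (fst (fst K))"
abbreviation cell_center :: "cell \<Rightarrow> nat" where "cell_center K \<equiv> snd (fst (fst K))"
abbreviation cell_lower :: "cell \<Rightarrow> nat" where "cell_lower K \<equiv> fst (snd (fst K))"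
abbreviation cell_upper :: "cell \<Rightarrow> nat" where "cell_upper K \<equiv> snd (snd (fst K))"
abbreviation upper_queue :: "cell \<Rightarrow> nat" where "upper_queue K \<equiv> fst (snd K)"
abbreviation lower_queue :: "cell \<Rightarrow> nat" where "lower_queue K \<equiv> snd (snd K)"

definition cell_count :: "cell \<Rightarrow> item list \<Rightarrow> nat" where
  "cell_count K s =
    length (filter (\<lambda>e. item_color e = cell_color K \<and> item_center e = cell_center K) s)"

definition center_count :: "cell \<Rightarrow> item list \<Rightarrow> nat" where
  "center_count K s = length (filter (\<lambda>e. item_center e = cell_center K) s)"

text \<open>The difference of the two components of \<open>score\<close> is the drift-plus-penalty objective.\<close>

definition score :: "nat \<times> nat \<times> nat \<Rightarrow> cell list \<Rightarrow> item \<Rightarrow> nat \<times> nat" where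
  "score P st e =
    (fst (snd P) * item_cost e + snd (snd P) *
       sum_list (map (\<lambda>K. (if cell_color K = item_color e then fst P * upper_queue K else 0) +
                          cell_lower K * lower_queue K)
         (filter (\<lambda>K. cell_center K = item_center e) st)),
     snd (snd P) *
       sum_list (map (\<lambda>K. (if cell_color K = item_color e then fst P * lower_queue K else 0) +
                          cell_upper K * upper_queue K)
         (filter (\<lambda>K. cell_center K = item_center e) st)))"

definition select :: "nat \<times> nat \<times> nat \<Rightarrow> cell list \<Rightarrow> item list \<Rightarrow> item" where
  "select P st rw = (case rw of [] \<Rightarrow> (0, 0, 0, 0) | e # es \<Rightarrow> least_by (score P st) e es)"

definition update :: "nat \<Rightarrow> item list \<Rightarrow> cell \<Rightarrow> cell" where
  "update Q s K = (fst K,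
    (upper_queue K + Q * cell_count K s - cell_upper K * center_count K s,
     lower_queue K + cell_lower K * center_count K s - Q * cell_count K s))"

definition tick :: "nat \<times> nat \<times> nat \<Rightarrow> item list list \<Rightarrow> cell list \<times> item list \<Rightarrow> cell list \<times> item
    list" where
  "tick P tab z = (let s = map (select P (fst z)) tab
      in (map (update (fst P) s) (fst z), s @ snd z))"

definition run :: "nat \<times> nat \<times> nat \<Rightarrow> item list list \<Rightarrow> cell list \<Rightarrow> unit list \<Rightarrow> cell list \<times> item list"
    where
  "run P tab st ks = fold (\<lambda>_. tick P tab) ks (st, [])"

lemma ptime_cell_count: "ptime f \<Longrightarrow> ptime g \<Longrightarrow> ptime (\<lambda>x. cell_count (f x) (g x))"
proof -
  assume f: "ptime f" and g: "ptime g"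
  note * = ptime_comp[OF f] ptime_comp[OF g]
  show ?thesis unfolding cell_count_def by (intro ptime_rules f g *)
qed

lemma ptime_center_count: "ptime f \<Longrightarrow> ptime g \<Longrightarrow> ptime (\<lambda>x. center_count (f x) (g x))"
proof -
  assume f: "ptime f" and g: "ptime g"
  note * = ptime_comp[OF f] ptime_comp[OF g]
  show ?thesis unfolding center_count_def by (intro ptime_rules f g *)
qed

lemma ptime_score:
  assumes P: "ptime P" and st: "ptime st" and e: "ptime e"
  shows "ptime (\<lambda>x. score (P x) (st x) (e x))"
proof -
  note * = ptime_comp[OF P] ptime_comp[OF st] ptime_comp[OF e]
  show ?thesis unfolding score_def by (intro ptime_rules P st e *)
qed

lemma ptime_select:
  assumes P: "ptime P" and st: "ptime st" and rw: "ptime rw"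
  shows "ptime (\<lambda>x. select (P x) (st x) (rw x))"
proof -
  note * = ptime_comp[OF P] ptime_comp[OF st] ptime_comp[OF rw]
  show ?thesis unfolding select_def by (intro ptime_rules ptime_least_by ptime_score P st rw *)
qed

lemma ptime_update:
  assumes Q: "ptime Q" and s: "ptime s" and K: "ptime K"
  shows "ptime (\<lambda>x. update (Q x) (s x) (K x))"
proof -
  note * = ptime_comp[OF Q] ptime_comp[OF s] ptime_comp[OF K]
  show ?thesis unfolding update_def
    by (intro ptime_rules ptime_cell_count ptime_center_count Q s K *)
qed

lemma ptime_tick:
  assumes P: "ptime P" and tab: "ptime tab" and z: "ptime z"
  shows "ptime (\<lambda>x. tick (P x) (tab x) (z x))"
proof -
  note * = ptime_comp[OF P] ptime_comp[OF tab] ptime_comp[OF z]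
  show ?thesis unfolding tick_def
    by (intro ptime_rules ptime_select ptime_update P tab z *)
qed

lemma select_in: "rw \<noteq> [] \<Longrightarrow> select P st rw \<in> set rw"
  using least_by_in[of "score P st"]
      by (auto simp: select_def simp del: set_simps split: list.split)

lemma length_filter_le_rows: "cell_count K (map f tab) \<le> length tab" "center_count K (map f tab)
    \<le> length tab"
  unfolding cell_count_def center_count_def using length_filter_le[of _ "map f tab"] by auto

text \<open>Each round adds at most a fixed amount to a queue, so queues grow linearly in the number
  of rounds and their bit lengths stay small. Exhibiting the state as \<open>map f st\<close> lets
  the size estimate proceed cell by cell.\<close>

lemma run_state:
  "\<exists>f. fst (run P tab st ks) = map f st \<and> (\<forall>K. fst (f K) = fst K \<and>
    upper_queue (f K) \<le> upper_queue K + length ks * (fst P * length tab) \<and>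
    lower_queue (f K) \<le> lower_queue K + length ks * (cell_lower K * length tab))"
proof (induction ks rule: rev_induct)
  case Nil
  then show ?case by (intro exI[of _ id]) (simp add: run_def)
next
  case (snoc k ks)
  then obtain f where f: "fst (run P tab st ks) = map f st" "\<And>K. fst (f K) = fst K"
    "\<And>K. upper_queue (f K) \<le> upper_queue K + length ks * (fst P * length tab)"
    "\<And>K. lower_queue (f K) \<le> lower_queue K + length ks * (cell_lower K * length tab)" by blast
  define s where "s = map (select P (fst (run P tab st ks))) tab"
  have "fst (run P tab st (ks @ [k])) = map (update (fst P) s \<circ> f) st"
    using f(1) by (simp add: run_def tick_def Let_def s_def)
  moreover have "upper_queue (update (fst P) s (f K)) \<le>
      upper_queue K + length (ks @ [k]) * (fst P * length tab)" for K
  proof -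
    have "fst P * cell_count (f K) s \<le> fst P * length tab"
      unfolding s_def by (intro mult_left_mono length_filter_le_rows) simp
    moreover have "upper_queue (update (fst P) s (f K)) \<le> upper_queue (f K)
        + fst P * cell_count (f K) s"
      by (simp add: update_def)
    moreover have "length (ks @ [k]) * (fst P * length tab)
        = length ks * (fst P * length tab) + fst P * length tab" by simp
    ultimately show ?thesis using f(3)[of K] by linarith
  qed
  moreover have "lower_queue (update (fst P) s (f K)) \<le>
      lower_queue K + length (ks @ [k]) * (cell_lower K * length tab)" for K
  proof -
    have "cell_lower K * center_count (f K) s \<le> cell_lower K * length tab"
      unfolding s_def by (intro mult_left_mono length_filter_le_rows) simp
    moreover have "lower_queue (update (fst P) s (f K))
        \<le> lower_queue (f K) + cell_lower K * center_count (f K) s"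
      using f(2)[of K] by (simp add: update_def)
    moreover have "length (ks @ [k]) * (cell_lower K * length tab)
        = length ks * (cell_lower K * length tab) + cell_lower K * length tab" by simp
    ultimately show ?thesis using f(4)[of K] by linarith
  qed
  ultimately show ?case using f(2)
    by (intro exI[of _ "update (fst P) s \<circ> f"]) (simp add: update_def)
qed

lemma csize_queue_le: "a' \<le> a + t * (q * n) \<Longrightarrow> csize (a' :: nat)
    \<le> 2 * (csize a + t + csize q + n + 1)"
proof -
  assume "a' \<le> a + t * (q * n)"
  then have "blen a' \<le> blen (a + t * (q * n))" by (rule blen_mono)
  moreover have "blen (a + t * (q * n)) \<le> blen a + blen (t * (q * n)) + 1" by (rule blen_add)
  moreover have "blen (t * (q * n)) \<le> blen t + (blen q + blen n)"
    using blen_mult[of t "q * n"] blen_mult[of q n] by linarith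
  ultimately show ?thesis
    using csize_nat_le_blen[of a'] blen_le_self[of t] blen_le_self[of n] blen_le_csize[of a]
        blen_le_csize[of q]
    by simp
qed

lemma csize_run_state:
  "csize (fst (run P tab st ks))
      \<le> (6 + 4 * (length ks + length tab + csize (fst P) + 2)) * csize st"
proof -
  obtain f where f: "fst (run P tab st ks) = map f st" "\<And>K. fst (f K) = fst K"
    "\<And>K. upper_queue (f K) \<le> upper_queue K + length ks * (fst P * length tab)"
    "\<And>K. lower_queue (f K) \<le> lower_queue K + length ks * (cell_lower K * length tab)"
    using run_state by blast
  have "csize (f K) \<le> 5 * csize K + 4 * (length ks + length tab + csize (fst P) + 2)" for K
  proof -
    have "csize (f K) = csize (fst K) + (csize (upper_queue (f K)) + csize (lower_queue (f K)) + 1)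
        + 1"
      by (subst csize_prod, subst csize_prod[of "snd (f K)"]) (simp add: f(2))
    moreover have "csize K = csize (fst (fst K)) + (csize (cell_lower K) + csize (cell_upper K) + 1)
        + 1
        + (csize (upper_queue K) + csize (lower_queue K) + 1) + 1"
      by (subst csize_prod, subst csize_prod[of "snd K"], subst csize_prod[of "fst K"],
          subst csize_prod[of "snd (fst K)"]) simp
    moreover have "csize K = csize (fst K) + (csize (upper_queue K) + csize (lower_queue K) + 1)
        + 1"
      by (subst csize_prod, subst csize_prod[of "snd K"]) simp
    ultimately show ?thesis
      using csize_queue_le[OF f(3)[of K]] csize_queue_le[OF f(4)[of K]] by (simp add: algebra_simps)
  qed
  then have "csize (map f st) \<le> (5 + 4 * (length ks + length tab + csize (fst P) + 2)
      + 1) * csize st"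
    by (intro csize_map_le)
  then show ?thesis by (simp add: f(1) add.assoc)
qed

lemma csize_run_history: "csize (snd (run P tab st ks)) \<le> length ks * (5 * csize tab)"
proof (induction ks rule: rev_induct)
  case (snoc k ks)
  have "csize (select P st rw) \<le> 1 * csize rw + 3" for st and rw :: "item list"
  proof (cases "rw = []")
    case True
    then show ?thesis
      by (simp add: select_def encode_nat_def enc_nat.simps)
  next
    case False
    then show ?thesis using csize_member[OF select_in[of rw P st]] by simp
  qed
  then have "csize (map (select P st) tab) \<le> (1 + 3 + 1) * csize tab" for st
    by (intro csize_map_le)
  then have "csize (map (select P (fst (run P tab st ks))) tab) \<le> 5 * csize tab" by simp
  then show ?case using snoc
    by (simp add: run_def tick_def Let_def csize_append)
qed (simp add: run_def)

lemma ptime_run: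
  assumes P: "ptime P" and tab: "ptime tab" and st: "ptime st" and ks: "ptime ks"
  shows "ptime (\<lambda>x. run (P x) (tab x) (st x) (ks x))"
  unfolding run_def
proof (rule ptime_fold[OF _ ks])
  note * = ptime_comp[OF P] ptime_comp[OF tab]
  show "ptime (\<lambda>x. (st x, [] :: item list))" by (intro ptime_rules st)
  show "ptime (\<lambda>z :: ('a \<times> unit) \<times> cell list \<times> item list. tick (P (fst (fst z))) (tab (fst (fst z)))
      (snd z))"
    by (intro ptime_tick ptime_rules *)
  let ?B = "\<lambda>x. (6 + 4 * (csize (ks x) + csize (tab x) + csize (fst (P x)) + 2)) * csize (st x)
      + csize (ks x) * (5 * csize (tab x)) + 1"
  show "pbound ?B"
    by (intro pbound_add pbound_mult pbound_const ptime_csize ks tab st ptime_fst P)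
  fix x ys zs assume eq: "ks x = ys @ zs"
  then have len: "length ys \<le> csize (ks x)" using length_le_csize[of "ks x"] by simp
  have "csize (fst (run (P x) (tab x) (st x) ys)) \<le>
      (6 + 4 * (length ys + length (tab x) + csize (fst (P x)) + 2)) * csize (st x)"
    by (rule csize_run_state)
  also have "\<dots> \<le> (6 + 4 * (csize (ks x) + csize (tab x) + csize (fst (P x)) + 2)) * csize (st x)"
    using len length_le_csize[of "tab x"] by (intro mult_right_mono add_mono mult_left_mono) auto
  finally have "csize (fst (run (P x) (tab x) (st x) ys)) \<le> \<dots>" .
  moreover have "csize (snd (run (P x) (tab x) (st x) ys)) \<le> length ys * (5 * csize (tab x))"
    by (rule csize_run_history)
  moreover have "length ys * (5 * csize (tab x)) \<le> csize (ks x) * (5 * csize (tab x))"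
    using len by (intro mult_right_mono) auto
  ultimately have "csize (run (P x) (tab x) (st x) ys) \<le> ?B x"
    using csize_prod[of "run (P x) (tab x) (st x) ys"] by linarith
  then show "csize (fold (\<lambda>_. tick (P x) (tab x)) ys (st x, [])) \<le> ?B x"
    by (simp only: run_def)
qed

text \<open>Running times are needed on arbitrary inputs, including multiplicities for which no
  perfect matchings exist. The estimate therefore uses only that \<open>a \<le> b + 1\<close>
  implies \<open>a div 2 + 1 \<le> b + 1\<close>.\<close>

lemma ptime_fold_halve:
  assumes js: "ptime (js :: _ \<Rightarrow> bool list)" and xs: "ptime xs"
  shows "ptime (\<lambda>x. fold (\<lambda>_. halve) (js x) (xs x))"
proof (rule ptime_fold[OF _ js xs])
  show "ptime (\<lambda>z :: ('a \<times> bool) \<times> (item \<times> nat) list. halve (snd z))"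
    by (intro ptime_halve ptime_rules)
  have "\<exists>f. fold (\<lambda>_. halve) ys xs = map f xs \<and> (\<forall>z. fst (f z) = fst z \<and> snd (f z) \<le> snd z + 1)"
    for xs and ys :: "bool list"
  proof (induction ys rule: rev_induct)
    case Nil
    then show ?case by (intro exI[of _ id]) simp
  next
    case (snoc y ys)
    then obtain f where f: "fold (\<lambda>_. halve) ys xs = map f xs" "\<And>z. fst (f z) = fst z"
      "\<And>z. snd (f z) \<le> snd z + 1" by blast
    let ?up = "rounded_up (map fst (filter (\<lambda>z. odd (snd z)) (map f xs)))"
    let ?g = "\<lambda>z. (fst z, snd (f z) div 2 + (if fst z \<in> set ?up then 1 else 0))"
    have "fold (\<lambda>_. halve) (ys @ [y]) xs = map ?g xs"
      using f by (simp add: halve_def Let_def)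
    moreover have "snd (f z) div 2 + (if fst z \<in> set ?up then 1 else 0) \<le> snd z + 1" for z
      using f(3)[of z] by auto
    ultimately show ?case by (intro exI[of _ ?g]) simp
  qed
  note fold = this
  have le: "csize (fold (\<lambda>_. halve) ys us) \<le> (2 + 4 + 1) * csize us" for us and ys :: "bool list"
  proof -
    obtain f where f: "fold (\<lambda>_. halve) ys us = map f us" "\<And>z. fst (f z) = fst z"
      "\<And>z. snd (f z) \<le> snd z + 1" using fold[of ys us] by blast
    have "csize (f z) \<le> 2 * csize z + 4" for z
    proof -
      have "blen (snd (f z)) \<le> blen (snd z) + 2"
        using blen_mono[OF f(3)[of z]] blen_add[of "snd z" 1] blen_le_self[of 1] by simp
      then show ?thesis
        using csize_nat_le_blen[of "snd (f z)"] blen_le_csize[of "snd z"]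
          csize_prod[of z] csize_prod[of "f z"] f(2)[of z] by simp
    qed
    then show ?thesis unfolding f(1) by (intro csize_map_le)
  qed
  show "pbound (\<lambda>x. (2 + 4 + 1) * csize (xs x))"
    by (intro pbound_mult pbound_const ptime_csize xs)
  show "csize (fold (\<lambda>_. halve) ys (xs x)) \<le> (2 + 4 + 1) * csize (xs x)" for x and ys :: "bool list"
    by (rule le)
qed

section \<open>From instance data to the reassigned clustering\<close>

definition solve ::
  "nat \<times> nat \<times> nat \<Rightarrow> item list list \<Rightarrow> cell list \<Rightarrow> unit list \<Rightarrow> bool list \<Rightarrow> item list" where
  "solve P tab st ks js =
    (let hist = snd (run P tab st ks);
         xs = fold (\<lambda>_. halve) js (map (\<lambda>e. (e, length (filter (\<lambda>d. d = e) hist))) (concat tab))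
     in map (\<lambda>rw. case filter (\<lambda>e. \<exists>z\<in>set xs. fst z = e \<and> 0 < snd z) rw of
          [] \<Rightarrow> (0, 0, 0, 0) | e # _ \<Rightarrow> e) tab)"

lemma ptime_concat: "ptime f \<Longrightarrow> ptime (\<lambda>x. concat (f x))"
  using ptime_concat_map[of "\<lambda>_ y. y" f] by (simp add: ptime_snd ptime_id)

lemma ptime_solve:
  assumes P: "ptime P" and tab: "ptime tab" and st: "ptime st" and ks: "ptime ks" and js: "ptime js"
  shows "ptime (\<lambda>x. solve (P x) (tab x) (st x) (ks x) (js x))"
proof -
  note * = ptime_comp[OF P] ptime_comp[OF tab] ptime_comp[OF st] ptime_comp[OF ks] ptime_comp[OF js]
  show ?thesis unfolding solve_def
    by (intro ptime_rules ptime_run ptime_fold_halve ptime_concat P tab st ks js *)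
qed

text \<open>
  Rationals are passed as pairs of numerator and denominator; \<open>scale ds\<close> multiplies
      by the product of \<open>ds\<close>.
\<close>

definition denom :: "int \<times> int \<Rightarrow> nat" where
  "denom r = nat \<bar>snd r\<bar>"

definition scale :: "nat list \<Rightarrow> int \<times> int \<Rightarrow> nat" where
  "scale ds r = nat \<bar>fst r\<bar> * prod_list ds div denom r"

text \<open>The exponent \<open>q\<close> is 1 for medians and 2 for means. Distances are multiplied
  by the common denominator before the power is taken, so all costs are natural numbers scaled by
  the same factor.\<close>

definition all_rows :: "nat \<Rightarrow> (int \<times> int) list list \<Rightarrow> nat list \<Rightarrow> nat list \<Rightarrow> item list list" where
  "all_rows q dm cols cents =
    (let ds = map denom (concat dm)
     in map (\<lambda>t. map (\<lambda>u. (fst t, (fst (snd t), (fst u, scale ds (snd u) ^ q))))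
          (filter (\<lambda>u. \<exists>c\<in>set cents. c = fst u) (zip [0..<length cols] (snd (snd t)))))
        (zip [0..<length cols] (zip cols dm)))"

definition fair_denoms :: "((int \<times> int) \<times> (int \<times> int)) list \<Rightarrow> nat list" where
  "fair_denoms fair = concat (map (\<lambda>b. [denom (fst b), denom (snd b)]) fair)"

definition all_cells :: "((int \<times> int) \<times> (int \<times> int)) list \<Rightarrow> nat list \<Rightarrow> cell list" where
  "all_cells fair cents =
    (let ds = fair_denoms fair
     in concat (map (\<lambda>t. map (\<lambda>c. (((fst t, c), (scale ds (fst (snd t)), scale ds (snd (snd t)))),
         (0, 0))) cents)
          (zip [0..<length fair] fair)))"

text \<open>
  The bound \<open>D\<close> ranges over the possible costs of the most expensive item of the reference
      assignment;
  for the right guess the optimum is at least \<open>D\<close>, so an additive error of \<open>D / \<zeta>\<close> is affordable.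
\<close>

definition allowed :: "nat \<Rightarrow> item list \<Rightarrow> item list" where
  "allowed D rw = (case filter (\<lambda>e. item_cost e \<le> D) rw of [] \<Rightarrow> rw | e # es \<Rightarrow> e # es)"

definition nearly_fair :: "nat \<Rightarrow> cell list \<Rightarrow> item list \<Rightarrow> bool" where
  "nearly_fair Q cells s \<longleftrightarrow> (\<forall>K\<in>set cells.
     Q * cell_count K s \<le> cell_upper K * center_count K s + 2 * Q \<and>
     cell_lower K * center_count K s \<le> Q * cell_count K s + 2 * Q)"

text \<open>With \<open>T\<close> rounds, \<open>k\<close> cells and common denominator
  \<open>Q\<close>, the final potential is at most
  \<open>T * k * (Q * n)^2 * (2 + 2 * \<zeta> * n)\<close>. This number of rounds makes
  \<open>n^2\<close> times that at most \<open>(T * Q)^2\<close>, so each queue, averaged over the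
  rounds, is at most \<open>Q / n\<close>, a violation of \<open>1 / n\<close>.\<close>

definition iterations :: "nat \<Rightarrow> nat \<Rightarrow> nat \<Rightarrow> nat" where
  "iterations \<zeta> k n = k * n ^ 4 * (2 + 2 * \<zeta> * n)"

text \<open>With \<open>k\<close> cells, one round adds at most \<open>2 * k * (Q * n)^2\<close> to
  the potential beyond the linear term. \<open>V\<close> is chosen so that, with the potential
  weighted by the guess \<open>D\<close>, this term raises the average cost by at most
  \<open>D / \<zeta>\<close>. The guess 0 is replaced by 1 to keep the queues in the
  objective.\<close>

definition candidates :: "nat \<Rightarrow> nat \<Rightarrow> item list list \<Rightarrow> cell list \<Rightarrow> item list list" where
  "candidates \<zeta> Q tab cells =
    (let N = iterations \<zeta> (length cells) (length tab);
         V = \<zeta> * length cells * (Q * length tab) ^ 2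
     in map (\<lambda>D. solve (Q, (V, if D = 0 then 1 else D)) (map (allowed D) tab) cells
                  (replicate (2 ^ blen N) ()) (bits N))
          (map item_cost (concat tab)))"

text \<open>Near-fairness and cost of a candidate can be checked directly, so the right guess need
  not be recognized and wrong ones do no harm.\<close>

definition best_candidate :: "nat \<Rightarrow> nat \<Rightarrow> item list list \<Rightarrow> cell list \<Rightarrow> item list" where
  "best_candidate \<zeta> Q tab cells =
    (case filter (nearly_fair Q cells) (candidates \<zeta> Q tab cells) of
       [] \<Rightarrow> []
     | s # ss \<Rightarrow> least_by (\<lambda>s. (total_cost s, 0)) s ss)"

type_synonym raw_instance =
  "((int \<times> int) list list \<times> nat \<times> nat list \<times> (int \<times> int) list) \<times> ((int \<times> int) \<times> (int \<times> int)) list"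

definition reassign :: "nat \<Rightarrow> nat \<Rightarrow> raw_instance \<times> nat list \<times> nat list \<Rightarrow> nat list \<times> nat list" where
  "reassign q \<zeta> z =
    (fst (snd z), map item_center (best_candidate \<zeta> (prod_list (fair_denoms (snd (fst z))))
       (all_rows q (fst (fst (fst z))) (fst (snd (snd (fst (fst z))))) (fst (snd z)))
       (all_cells (snd (fst z)) (fst (snd z)))))"

text \<open>Integers are encoded as sign and magnitude, so the absolute value is the right
  subtree.\<close>

lemma ptime_nat_abs: "ptime f \<Longrightarrow> ptime (\<lambda>x. nat \<bar>f x\<bar>)"
  by (rule ptime_comp[of "\<lambda>i. nat \<bar>i\<bar>"], rule ptime_assign[where e = "TlE (Var 0)"])
     (auto simp: encode_int_def enc_int_def encode_nat_def intro: pbound_mono[OF pbound_csize])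

lemma ptime_scale:
  assumes "ptime f" "ptime g"
  shows "ptime (\<lambda>x. scale (f x) (g x))"
  unfolding scale_def denom_def by (intro ptime_rules ptime_nat_abs assms)

lemma ptime_all_rows:
  assumes f: "ptime f" and g: "ptime g" and h: "ptime h"
  shows "ptime (\<lambda>x. all_rows q (f x) (g x) (h x))"
proof -
  note * = ptime_comp[OF f] ptime_comp[OF g] ptime_comp[OF h]
  show ?thesis unfolding all_rows_def denom_def
    by (intro ptime_rules ptime_concat ptime_scale ptime_nat_abs f g h *)
qed

lemma ptime_fair_denoms: "ptime f \<Longrightarrow> ptime (\<lambda>x. fair_denoms (f x))"
  unfolding fair_denoms_def denom_def by (intro ptime_rules ptime_nat_abs)

lemma ptime_all_cells:
  assumes f: "ptime f" and g: "ptime g"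
  shows "ptime (\<lambda>x. all_cells (f x) (g x))"
proof -
  note * = ptime_comp[OF f] ptime_comp[OF g]
  show ?thesis unfolding all_cells_def
    by (intro ptime_rules ptime_scale ptime_fair_denoms f g *)
qed

lemma ptime_allowed:
  assumes f: "ptime f" and g: "ptime g"
  shows "ptime (\<lambda>x. allowed (f x) (g x))"
proof -
  note * = ptime_comp[OF f] ptime_comp[OF g]
  show ?thesis unfolding allowed_def by (intro ptime_rules f g *)
qed

lemma ptime_nearly_fair:
  assumes f: "ptime f" and g: "ptime g" and h: "ptime h"
  shows "ptime (\<lambda>x. nearly_fair (f x) (g x) (h x))"
proof -
  note * = ptime_comp[OF f] ptime_comp[OF g] ptime_comp[OF h]
  show ?thesis unfolding nearly_fair_def
    by (intro ptime_rules ptime_cell_count ptime_center_count f g h *)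
qed

lemma ptime_candidates:
  assumes Q: "ptime Q" and tab: "ptime tab" and cells: "ptime cells"
  shows "ptime (\<lambda>x. candidates \<zeta> (Q x) (tab x) (cells x))"
proof -
  note * = ptime_comp[OF Q] ptime_comp[OF tab] ptime_comp[OF cells]
  let ?N = "\<lambda>x. iterations \<zeta> (length (cells x)) (length (tab x))"
  have N: "ptime ?N" unfolding iterations_def by (intro ptime_rules tab cells)
  \<comment> \<open>The round count is polynomial because it is computed from lengths of lists only;
    costs and denominators do not enter.\<close>
  have "pbound (\<lambda>x. csize (cells x) *
      (csize (tab x) * (csize (tab x) * (csize (tab x) * csize (tab x))))
      * (2 + 2 * \<zeta> * csize (tab x)))"
    by (intro pbound_mult pbound_add pbound_const ptime_csize tab cells)
  then have "pbound ?N"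
    by (rule pbound_mono) (auto simp: iterations_def numeral_eq_Suc intro!: mult_mono add_mono
        length_le_csize)
  from ptime_replicate[OF N this] have R: "ptime (\<lambda>x. replicate (2 ^ blen (?N x)) ())" .
  note ** = ptime_comp[OF R] ptime_comp[OF ptime_bits[OF N]]
  show ?thesis unfolding candidates_def Let_def
    by (intro ptime_map ptime_solve ptime_rules ptime_concat ptime_allowed tab cells Q * **)
qed

lemma ptime_best_candidate:
  assumes Q: "ptime Q" and tab: "ptime tab" and cells: "ptime cells"
  shows "ptime (\<lambda>x. best_candidate \<zeta> (Q x) (tab x) (cells x))"
proof -
  note * = ptime_comp[OF Q] ptime_comp[OF tab] ptime_comp[OF cells]
  show ?thesis unfolding best_candidate_def
    by (intro ptime_rules ptime_nearly_fair ptime_candidates ptime_least_by ptime_total_cost tab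
        cells Q *)
qed

lemma ptime_reassign: "ptime (reassign q \<zeta>)"
  unfolding reassign_def
  by (intro ptime_rules ptime_best_candidate ptime_all_rows ptime_all_cells ptime_fair_denoms)

section \<open>Rounding\<close>

lemma match_correct:
  shows "mset es = mset (snd (match key es)) + mset (map fst (fst (match key es))) +
      mset (map snd (fst (match key es)))" (is "?mset es")
    and "p \<in> set (fst (match key es)) \<Longrightarrow> key (fst p) = key (snd p)" (is "_ \<Longrightarrow> ?key p")
    and "distinct (map key (snd (match key es)))" (is "?dist es")
proof -
  have "?mset es \<and> (\<forall>p\<in>set (fst (match key es)). ?key p) \<and> ?dist es"
  proof (induction es rule: rev_induct)
    case Nil
    then show ?case by (simp add: match_def)
  next
    case (snoc e es)
    obtain ps pe where z: "match key es = (ps, pe)" by (metis prod.exhaust)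
    then have m: "match key (es @ [e]) = match_step key e (ps, pe)" by (simp add: match_def)
    have IH: "mset es = mset pe + mset (map fst ps) + mset (map snd ps)"
      "\<forall>p\<in>set ps. key (fst p) = key (snd p)" "distinct (map key pe)" using snoc z by auto
    show ?case
    proof (cases "filter (\<lambda>d. key d = key e) pe")
      case Nil
      then have "match key (es @ [e]) = (ps, e # pe)" by (simp add: m match_step_def)
      moreover have "key e \<notin> key ` set pe" using Nil by (auto simp: filter_empty_conv)
      ultimately show ?thesis using IH by simp
    next
      case (Cons d ds)
      have "d \<in> set (filter (\<lambda>d. key d = key e) pe)" using Cons by simp
      then have d: "d \<in> set pe" "key d = key e" by auto
      have "distinct (map key (d # ds))"
        unfolding Cons[symmetric] by (rule distinct_map_filter[OF IH(3)])
      moreover have "key x = key e" if "x \<in> set ds" for x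
      proof -
        have "x \<in> set (filter (\<lambda>d. key d = key e) pe)" using that Cons by simp
        then show ?thesis by simp
      qed
      \<comment> \<open>The unmatched keys are distinct, so discarding every item with the key of
        \<open>e\<close> discards exactly the partner \<open>d\<close>.\<close>
      ultimately have "ds = []" using d(2) by (cases ds) auto
      then have "filter (\<lambda>d. key d = key e) pe = [d]" using Cons by simp
      then have "filter_mset (\<lambda>d. key d = key e) (mset pe) = {#d#}" by (simp flip: mset_filter)
      moreover define r where "r = filter (\<lambda>d. \<not> key d = key e) pe"
      ultimately have pe: "mset pe = add_mset d (mset r)"
        using multiset_partition[of "mset pe" "\<lambda>d. key d = key e"] by (simp only: mset_filter) simp
      have r: "distinct (map key r)" unfolding r_def by (rule distinct_map_filter[OF IH(3)])
      have "match key (es @ [e]) = ((d, e) # ps, r)"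
        using Cons by (simp add: m match_step_def r_def)
      then show ?thesis using IH(1,2) pe d(2) r by simp
    qed
  qed
  then show "?mset es" "p \<in> set (fst (match key es)) \<Longrightarrow> ?key p" "?dist es" by blast+
qed

text \<open>Matched pairs cancel, so only unmatched items contribute. With opposite signs on each
  pair this bounds the effect of rounding.\<close>

lemma sum_match:
  fixes f :: "item \<Rightarrow> int"
  assumes "\<And>p. p \<in> set (fst (match key es)) \<Longrightarrow> f (fst p) + f (snd p) = 0"
  shows "sum_list (map f es) = sum_list (map f (snd (match key es)))"
proof -
  have "sum_list (map f es) = sum_mset (image_mset f (mset es))"
    by (metis mset_map sum_mset_sum_list)
  also have "\<dots> = sum_list (map f (snd (match key es)))
      + (\<Sum>p\<leftarrow>fst (match key es). f (fst p) + f (snd p))"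
    by (subst match_correct(1)[of es key])
       (simp add: sum_mset_sum_list sum_list_addf flip: mset_map, simp add: comp_def)
  also have "(\<Sum>p\<leftarrow>fst (match key es). f (fst p) + f (snd p)) = (\<Sum>p\<leftarrow>fst (match key es). 0)"
    using assms by (intro arg_cong[of _ _ sum_list] map_cong) auto
  finally show ?thesis by simp
qed

lemma length_match: "length es = length (snd (match key es)) + 2 * length (fst (match key es))"
  using arg_cong[OF match_correct(1)[of es key], of size] by simp

lemma even_match:
  "even (length (filter (\<lambda>e. key e = k) es))
      \<longleftrightarrow> even (length (filter (\<lambda>e. key e = k) (snd (match key es))))"
proof -
  have l: "length (filter P xs) = size (filter_mset P (mset xs))" for P and xs :: "item list"
    by (simp flip: mset_filter)
  have eq: "length (filter (\<lambda>e. key e = k) (map fst ps))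
      = length (filter (\<lambda>e. key e = k) (map snd ps))"
    if "\<And>p. p \<in> set ps \<Longrightarrow> key (fst p) = key (snd p)" for ps :: "(item \<times> item) list"
    using that by (induction ps) auto
  have "length (filter (\<lambda>e. key e = k) es) = length (filter (\<lambda>e. key e = k) (snd (match key es)))
      + 2 * length (filter (\<lambda>e. key e = k) (map fst (fst (match key es))))"
    using eq[of "fst (match key es)"] match_correct(2)[of _ key es]
    by (subst l, subst match_correct(1)[of es key]) (simp add: l)
  then show ?thesis by simp
qed

text \<open>At most one item has key \<open>k\<close>, so at most one summand is nonzero.\<close>

lemma sum_distinct_keys:
  fixes s :: "'a \<Rightarrow> int"
  assumes "distinct (map key es)" "\<And>e. \<bar>s e\<bar> \<le> 1"
  shows "\<bar>\<Sum>e\<leftarrow>es. if key e = k then s e else 0\<bar> \<le> 1"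
  using assms(1)
proof (induction es)
  case (Cons e es)
  show ?case
  proof (cases "key e = k")
    case True
    have "key e \<notin> key ` set es" using Cons.prems by simp
    then have "\<forall>x\<in>set es. key x \<noteq> k" using True by (metis image_eqI)
    then have "(\<Sum>e\<leftarrow>es. if key e = k then s e else 0) = (\<Sum>e\<leftarrow>es. 0)"
      by (intro arg_cong[of _ _ sum_list] map_cong) auto
    then show ?thesis using True assms(2)[of e] by simp
  qed (use Cons in simp)
qed simp

text \<open>At most one item of each key is left over, and matching removes the items of a key two
  at a time; an even number therefore leaves none.\<close>

lemma match_all:
  assumes "\<And>k. even (length (filter (\<lambda>e. key e = k) es))"
  shows "snd (match key es) = []"
proof (rule ccontr)
  assume "snd (match key es) \<noteq> []"
  then obtain e pe where pe: "snd (match key es) = e # pe" by (cases "snd (match key es)") auto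
  then have "key e \<notin> key ` set pe" using match_correct(3)[of key es] by simp
  then have "\<forall>d\<in>set pe. key d \<noteq> key e" by (metis image_eqI)
  then have "filter (\<lambda>d. key d = key e) pe = []" by (simp add: filter_empty_conv)
  then show False using assms[of "key e"] even_match[of key "key e" es] pe by simp
qed

lemma partner_correct:
  assumes "distinct (map fst ps @ map snd ps)" "p \<in> set ps"
  shows "partner ps (fst p) = snd p" "partner ps (snd p) = fst p"
proof -
  have uniq: "z = p" if z: "z \<in> set ps" "fst z = e \<or> snd z = e" "e = fst p \<or> e = snd p" for z e
  proof -
    have inj: "inj_on fst (set ps)" "inj_on snd (set ps)"
        and disj: "fst ` set ps \<inter> snd ` set ps = {}"
      using assms(1) by (auto simp: distinct_map)
    have in_img: "fst z \<in> fst ` set ps" "snd z \<in> snd ` set ps" "fst p \<in> fst ` set ps"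
        "snd p \<in> snd ` set ps"
      using z(1) assms(2) by simp_all
    consider "fst z = fst p" | "snd z = snd p" | "fst z = snd p" | "snd z = fst p"
      using z(2,3) by metis
    then show ?thesis
    proof cases
      case 1
      then show ?thesis using inj_onD[OF inj(1) _ z(1) assms(2)] by simp
    next
      case 2
      then show ?thesis using inj_onD[OF inj(2) _ z(1) assms(2)] by simp
    next
      case 3
      then have "fst z \<in> fst ` set ps \<inter> snd ` set ps" using in_img by simp
      then show ?thesis unfolding disj by simp
    next
      case 4
      then have "snd z \<in> fst ` set ps \<inter> snd ` set ps" using in_img by simp
      then show ?thesis unfolding disj by simp
    qed
  qed
  have "fst ` set ps \<inter> snd ` set ps = {}" using assms(1) by auto
  then have ne: "fst p \<noteq> snd p" using assms(2) by (metis disjoint_iff imageI)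
  have "partner ps e = (if fst p = e then snd p else fst p)" if e: "e = fst p \<or> e = snd p" for e
  proof (cases "filter (\<lambda>z. fst z = e \<or> snd z = e) ps")
    case Nil
    then show ?thesis using assms(2) e by (auto simp: filter_empty_conv)
  next
    case (Cons z zs)
    have "z \<in> set (filter (\<lambda>z. fst z = e \<or> snd z = e) ps)" using Cons by simp
    then have "z = p" using uniq[of z e] e by auto
    then show ?thesis using Cons by (simp add: partner_def)
  qed
  then show "partner ps (fst p) = snd p" "partner ps (snd p) = fst p" using ne by auto
qed

section \<open>Alternating cycles of two perfect matchings\<close>

definition perfect :: "(item \<times> item) list \<Rightarrow> item list \<Rightarrow> bool" where
  "perfect ps es \<longleftrightarrow> mset es = mset (map fst ps) + mset (map snd ps)"

lemma perfect_partner: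
  assumes "perfect ps es" "distinct es"
  shows "e \<in> set es \<Longrightarrow> partner ps e \<in> set es" "e \<in> set es \<Longrightarrow> partner ps (partner ps e) = e"
    "e \<in> set es \<Longrightarrow> partner ps e \<noteq> e"
    "p \<in> set ps \<Longrightarrow> fst p \<in> set es \<and> partner ps (fst p) = snd p"
proof -
  have m: "mset es = mset (map fst ps @ map snd ps)" using assms(1) by (simp add: perfect_def)
  then have d: "distinct (map fst ps @ map snd ps)" using assms(2)
      by (metis mset_eq_imp_distinct_iff)
  have s: "set es = fst ` set ps \<union> snd ` set ps" using mset_eq_setD[OF m] by simp
  have "fst ` set ps \<inter> snd ` set ps = {}" using d by auto
  then have ne: "fst p \<noteq> snd p" if "p \<in> set ps" for p using that by (metis disjoint_iff imageI)
  have *: "partner ps e \<in> set es \<and> partner ps (partner ps e) = e \<and> partner ps e \<noteq> e"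
      if e: "e \<in> set es"
  proof -
    from e s obtain p where "p \<in> set ps" "e = fst p \<or> e = snd p" by auto
    then show ?thesis using partner_correct[OF d, of p] ne[of p] s by auto
  qed
  then show "e \<in> set es \<Longrightarrow> partner ps e \<in> set es" "e \<in> set es \<Longrightarrow> partner ps (partner ps e) = e"
    "e \<in> set es \<Longrightarrow> partner ps e \<noteq> e" by blast+
  show "p \<in> set ps \<Longrightarrow> fst p \<in> set es \<and> partner ps (fst p) = snd p"
    using partner_correct[OF d] s by auto
qed

lemma orbit_list_set:
  "set (orbit_list ps qs ks e) = (\<lambda>i. ((\<lambda>e. partner qs (partner ps e)) ^^ i) e) ` {..<length ks}"
proof -
  let ?f = "\<lambda>e. partner qs (partner ps e)"
  have "fst (fold (\<lambda>_ z. (?f (fst z), fst z # snd z)) ks (e, [])) = (?f ^^ length ks) e \<and>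
    set (snd (fold (\<lambda>_ z. (?f (fst z), fst z # snd z)) ks (e, [])))
        = (\<lambda>i. (?f ^^ i) e) ` {..<length ks}"
    by (induction ks rule: rev_induct) (auto simp: lessThan_Suc)
  then show ?thesis by (simp add: orbit_list_def)
qed

text \<open>A perfect matching is a fixed-point-free involution. Walking along a cycle of the union
  of two matchings two edges at a time is the permutation \<open>\<nu> (\<mu> x)\<close>, which
  splits the cycle into two sides.\<close>

locale two_involutions =
  fixes A :: "'a set" and \<mu> \<nu> :: "'a \<Rightarrow> 'a"
  assumes finite: "finite A"
    and mu: "x \<in> A \<Longrightarrow> \<mu> x \<in> A" "x \<in> A \<Longrightarrow> \<mu> (\<mu> x) = x" "x \<in> A \<Longrightarrow> \<mu> x \<noteq> x"
    and nu: "x \<in> A \<Longrightarrow> \<nu> x \<in> A" "x \<in> A \<Longrightarrow> \<nu> (\<nu> x) = x" "x \<in> A \<Longrightarrow> \<nu> x \<noteq> x"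
begin

abbreviation \<pi> :: "'a \<Rightarrow> 'a" where "\<pi> \<equiv> \<lambda>x. \<nu> (\<mu> x)"

definition orb :: "'a \<Rightarrow> 'a set" where
  "orb x = range (\<lambda>i. (\<pi> ^^ i) x)"

lemma pi_in: "x \<in> A \<Longrightarrow> (\<pi> ^^ i) x \<in> A"
  by (induction i) (auto intro: mu nu)

text \<open>This is bipartiteness of an alternating cycle. An equation
  \<open>(\<pi> ^^ i) x = \<mu> x\<close> can be shortened at both ends to the same equation for
  \<open>i - 2\<close> and \<open>\<pi> x\<close>; the remaining cases \<open>i = 0\<close> and
  \<open>i = 1\<close> would give a fixed point of \<open>\<mu>\<close> or of
  \<open>\<nu>\<close>.\<close>

lemma pi_ne_mu: "x \<in> A \<Longrightarrow> (\<pi> ^^ i) x \<noteq> \<mu> x"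
proof (induction i arbitrary: x rule: less_induct)
  case (less i)
  consider "i = 0" | "i = 1" | j where "i = Suc (Suc j)"
    by (metis One_nat_def not0_implies_Suc)
  then show ?case
  proof cases
    case 1
    then show ?thesis using less.prems mu(3)[of x] by auto
  next
    case 2
    then show ?thesis using nu(3)[OF mu(1)[OF less.prems]] by simp
  next
    case 3
    let ?y = "(\<pi> ^^ j) (\<pi> x)"
    have y: "\<pi> x \<in> A" "?y \<in> A" using less.prems pi_in mu nu by auto
    have "?y \<noteq> \<mu> (\<pi> x)" using less.IH[of j "\<pi> x"] 3 y by simp
    moreover have "(\<pi> ^^ i) x = \<pi> ?y" using funpow_swap1[of \<pi> j x] by (simp add: 3)
    moreover have "\<mu> (\<nu> (\<pi> ?y)) = ?y" using y mu nu by simp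
    ultimately show ?thesis by metis
  qed
qed

text \<open>Two of the iterates from 0 to \<open>card A\<close> coincide, and injectivity of
  \<open>\<pi>\<close> on \<open>A\<close> moves the coincidence back to the start. The bound on
  \<open>d\<close> is what makes the finite clock of \<open>orbit_list\<close> sufficient.\<close>

lemma pi_period:
  assumes "x \<in> A"
  obtains d where "0 < d" "d \<le> card A" "(\<pi> ^^ d) x = x"
proof -
  have "\<not> inj_on (\<lambda>i. (\<pi> ^^ i) x) {..card A}"
  proof
    assume "inj_on (\<lambda>i. (\<pi> ^^ i) x) {..card A}"
    moreover have "(\<lambda>i. (\<pi> ^^ i) x) ` {..card A} \<subseteq> A" using pi_in[OF assms] by auto
    ultimately have "card {..card A} \<le> card A" using card_inj_on_le finite by blast
    then show False by simp
  qed
  then obtain i j where "i < j" "j \<le> card A" "(\<pi> ^^ i) x = (\<pi> ^^ j) x"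
    unfolding inj_on_def by (metis atMost_iff linorder_neqE_nat)
  moreover have "(\<pi> ^^ i) y = (\<pi> ^^ i) z \<Longrightarrow> y \<in> A \<Longrightarrow> z \<in> A \<Longrightarrow> y = z" for y z
  proof (induction i)
    case (Suc i)
    then have "\<mu> (\<nu> (\<pi> ((\<pi> ^^ i) y))) = \<mu> (\<nu> (\<pi> ((\<pi> ^^ i) z)))" by simp
    then show ?case using Suc pi_in[of y i] pi_in[of z i] mu nu by simp
  qed simp
  moreover have "(\<pi> ^^ j) x = (\<pi> ^^ i) ((\<pi> ^^ (j - i)) x)"
    using \<open>i < j\<close> by (simp flip: funpow_add[THEN fun_cong, unfolded comp_def])
  ultimately show ?thesis
    using that[of "j - i"] pi_in[OF assms] assms by auto
qed

lemma orb_bounded: "x \<in> A \<Longrightarrow> orb x = (\<lambda>i. (\<pi> ^^ i) x) ` {..<card A}"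
proof -
  assume "x \<in> A"
  then obtain d where d: "0 < d" "d \<le> card A" "(\<pi> ^^ d) x = x" using pi_period by blast
  have "(\<pi> ^^ i) x = (\<pi> ^^ (i mod d)) x" "i mod d < card A" for i
    using funpow_mod_eq[OF d(3), of i] d mod_less_divisor[OF d(1), of i] by auto
  then show ?thesis unfolding orb_def by blast
qed

lemma orb_pi: "x \<in> A \<Longrightarrow> orb (\<pi> x) = orb x"
proof -
  assume "x \<in> A"
  then obtain d where d: "0 < d" "(\<pi> ^^ d) x = x" using pi_period by blast
  have a: "(\<pi> ^^ i) (\<pi> x) = (\<pi> ^^ Suc i) x" for i using funpow_swap1[of \<pi> i x] by simp
  \<comment> \<open>The step back from \<open>\<pi> x\<close> to \<open>x\<close> is made by
    \<open>d - 1\<close> steps forward, \<open>d\<close> being a period.\<close>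
  have b: "(\<pi> ^^ i) x = (\<pi> ^^ (i + (d - 1))) (\<pi> x)" for i
  proof -
    have "(\<pi> ^^ (i + (d - 1))) (\<pi> x) = (\<pi> ^^ Suc (i + (d - 1))) x"
      using funpow_swap1[of \<pi> "i + (d - 1)" x] by simp
    also have "Suc (i + (d - 1)) = i + d" using d(1) by simp
    finally show ?thesis using d(2) by (simp add: funpow_add)
  qed
  show ?thesis unfolding orb_def
  proof (intro equalityI subsetI)
    fix y assume "y \<in> range (\<lambda>i. (\<pi> ^^ i) (\<pi> x))"
    then obtain i where "y = (\<pi> ^^ Suc i) x" using a by blast
    then show "y \<in> range (\<lambda>i. (\<pi> ^^ i) x)" by (rule range_eqI)
  next
    fix y assume "y \<in> range (\<lambda>i. (\<pi> ^^ i) x)"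
    then obtain i where "y = (\<pi> ^^ (i + (d - 1))) (\<pi> x)" using b by blast
    then show "y \<in> range (\<lambda>i. (\<pi> ^^ i) (\<pi> x))" by (rule range_eqI)
  qed
qed

lemma orb_in: "y \<in> orb x \<Longrightarrow> x \<in> A \<Longrightarrow> orb y = orb x"
proof -
  assume "y \<in> orb x" "x \<in> A"
  then obtain i where "y = (\<pi> ^^ i) x" unfolding orb_def by blast
  moreover have "orb ((\<pi> ^^ i) x) = orb x" for i
  proof (induction i)
    case (Suc i)
    then show ?case using orb_pi[OF pi_in[OF \<open>x \<in> A\<close>, of i]] by simp
  qed simp
  ultimately show ?thesis by simp
qed

lemma orb_mu_disjoint: "x \<in> A \<Longrightarrow> orb x \<inter> orb (\<mu> x) = {}"
proof (rule ccontr)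
  assume x: "x \<in> A" and "orb x \<inter> orb (\<mu> x) \<noteq> {}"
  then obtain y where "y \<in> orb x" "y \<in> orb (\<mu> x)" by blast
  then have "orb x = orb (\<mu> x)" using orb_in[of y x] orb_in[of y "\<mu> x"] x mu(1)[OF x] by simp
  moreover have "\<mu> x \<in> orb (\<mu> x)" unfolding orb_def by (rule range_eqI[of _ _ 0]) simp
  ultimately have "\<mu> x \<in> orb x" by simp
  then obtain i where "\<mu> x = (\<pi> ^^ i) x" unfolding orb_def by blast
  then show False using pi_ne_mu[OF x, of i] by simp
qed

text \<open>\<open>\<nu> x\<close> is \<open>\<pi> (\<mu> x)\<close>, so either matching leads from
  \<open>x\<close> to the same opposite side.\<close>

lemma orb_nu: "x \<in> A \<Longrightarrow> orb (\<nu> x) = orb (\<mu> x)" "x \<in> A \<Longrightarrow> orb (\<mu> (\<nu> x)) = orb x"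
proof -
  assume x: "x \<in> A"
  show "orb (\<nu> x) = orb (\<mu> x)" using orb_pi[OF mu(1)[OF x]] mu(2)[OF x] by simp
  show "orb (\<mu> (\<nu> x)) = orb x"
    using orb_pi[OF mu(1)[OF nu(1)[OF x]]] mu(2)[OF nu(1)[OF x]] nu(2)[OF x] by simp
qed

end

text \<open>The item of a cycle that comes earliest in \<open>es\<close> depends on the cycle only.
  Positive are the items on the side of this representative, and either partner of an item lies on
  the other side.\<close>

lemma positive_alternates:
  assumes "perfect ps es" "perfect qs es" "distinct es" "e \<in> set es"
  shows "positive ps qs es (partner ps e) \<longleftrightarrow> \<not> positive ps qs es e"
    "positive ps qs es (partner qs e) \<longleftrightarrow> \<not> positive ps qs es e"
proof -
  interpret two_involutions "set es" "partner ps" "partner qs"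
    by unfold_locales (use perfect_partner[OF assms(1,3)] perfect_partner[OF assms(2,3)] in auto)
  let ?u = "\<lambda>x. filter (\<lambda>d. d \<in> orb x \<or> d \<in> orb (partner ps x)) es"
  have orb: "set (orbit_list ps qs es x) = orb x" if "x \<in> set es" for x
    using orb_bounded[OF that] distinct_card[OF assms(3)] by (simp add: orbit_list_set)
  have pos: "positive ps qs es x \<longleftrightarrow> hd (?u x) \<in> orb x" and ne: "?u x \<noteq> []" if "x \<in> set es" for x
  proof -
    have "x \<in> orb x" unfolding orb_def by (rule range_eqI[of _ _ 0]) simp
    then show "?u x \<noteq> []" using that by (auto simp: filter_empty_conv)
    then show "positive ps qs es x \<longleftrightarrow> hd (?u x) \<in> orb x"
      using that mu(1)[OF that] by (simp add: positive_def orb split: list.split)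
  qed
  have hd: "hd (?u e) \<in> orb e \<union> orb (partner ps e)"
    using hd_in_set[OF ne[OF assms(4)]] by auto
  have "?u (partner ps e) = ?u e" by (rule filter_cong) (auto simp: mu(2)[OF assms(4)])
  then show "positive ps qs es (partner ps e) \<longleftrightarrow> \<not> positive ps qs es e"
    using pos[OF assms(4)] pos[OF mu(1)[OF assms(4)]] hd orb_mu_disjoint[OF assms(4)] by auto
  have "?u (partner qs e) = ?u e" by (rule filter_cong) (auto simp: orb_nu[OF assms(4)])
  then show "positive ps qs es (partner qs e) \<longleftrightarrow> \<not> positive ps qs es e"
    using pos[OF assms(4)] pos[OF nu(1)[OF assms(4)]] hd orb_mu_disjoint[OF assms(4)]
      orb_nu[OF assms(4)] by auto
qed

section \<open>Rounding away one bit\<close>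

definition weight :: "(item \<Rightarrow> bool) \<Rightarrow> (item \<Rightarrow> nat) \<Rightarrow> item list \<Rightarrow> nat" where
  "weight K X es = (\<Sum>e\<leftarrow>es. if K e then X e else 0)"

abbreviation point_weight :: "nat \<Rightarrow> (item \<Rightarrow> nat) \<Rightarrow> item list \<Rightarrow> nat" where
  "point_weight p \<equiv> weight (\<lambda>e. item_point e = p)"

abbreviation cell_weight :: "nat \<times> nat \<Rightarrow> (item \<Rightarrow> nat) \<Rightarrow> item list \<Rightarrow> nat" where
  "cell_weight k \<equiv> weight (\<lambda>e. cell_key e = k)"

abbreviation center_weight :: "nat \<Rightarrow> (item \<Rightarrow> nat) \<Rightarrow> item list \<Rightarrow> nat" where
  "center_weight c \<equiv> weight (\<lambda>e. item_center e = c)"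

definition weighted_cost :: "(item \<Rightarrow> nat) \<Rightarrow> item list \<Rightarrow> nat" where
  "weighted_cost X es = (\<Sum>e\<leftarrow>es. X e * item_cost e)"

text \<open>The signs cancel on the pairs of both matchings. The row matching leaves no item over,
  the first level of the cell matching at most one item per cell, and the first two levels together
  at most one per center; the signed sums are therefore 0, respectively at most 1 in absolute value.
  Exchanging the two sides negates the cost difference, so one of the two choices is not
  dearer.\<close>

lemma rounded_up_correct:
  assumes es: "distinct es" and ev: "\<And>p. even (length (filter (\<lambda>e. item_point e = p) es))"
  defines "s \<equiv> \<lambda>e. if e \<in> set (rounded_up es) then 1 else -1 :: int"
  shows "(\<Sum>e\<leftarrow>es. if item_point e = p then s e else 0) = 0"
    "\<bar>\<Sum>e\<leftarrow>es. if cell_key e = k then s e else 0\<bar> \<le> 1"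
    "\<bar>\<Sum>e\<leftarrow>es. if item_center e = c then s e else 0\<bar> \<le> 1"
    "(\<Sum>e\<leftarrow>es. s e * int (item_cost e)) \<le> 0"
proof -
  let ?ps = "row_matching es" and ?qs = "cell_matching es"
  let ?a = "match cell_key es" let ?b = "match item_center (snd ?a)"
  let ?c = "match (\<lambda>_. ()) (snd ?b)"
  have r: "snd (match item_point es) = []" using ev by (rule match_all)
  then have ps: "perfect ?ps es"
    using match_correct(1)[of es item_point] by (simp add: perfect_def row_matching_def)
  \<comment> \<open>Pairing preserves the parity of the number of unmatched items, so the third
    level, where all keys agree, leaves nothing over.\<close>
  have "even (length es)" using length_match[of es item_point] r by simp
  then have "even (length (snd ?a))" using length_match[of es cell_key] by simp
  then have "even (length (snd ?b))" using length_match[of "snd ?a" item_center] by simp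
  then have "snd ?c = []" by (intro match_all) simp
  then have qs: "perfect ?qs es"
    using match_correct(1)[of es cell_key] match_correct(1)[of "snd ?a" item_center]
      match_correct(1)[of "snd ?b" "\<lambda>_. ()"]
    by (simp add: perfect_def cell_matching_def Let_def)
  have up: "set (rounded_up es) = {e\<in>set es. positive ?ps ?qs es e} \<or>
      set (rounded_up es) = {e\<in>set es. \<not> positive ?ps ?qs es e}"
    by (auto simp: rounded_up_def Let_def)
  have opp: "s (fst p) + s (snd p) = 0" if "p \<in> set ?ps \<or> p \<in> set ?qs" for p
  proof -
    have "fst p \<in> set es \<and> snd p \<in> set es \<and>
        (positive ?ps ?qs es (snd p) \<longleftrightarrow> \<not> positive ?ps ?qs es (fst p))"
      using that
    proof
      assume "p \<in> set ?ps"
      then have "fst p \<in> set es" "partner ?ps (fst p) = snd p"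
        using perfect_partner(4)[OF ps es] by auto
      then show ?thesis
        using positive_alternates(1)[OF ps qs es] perfect_partner(1)[OF ps es] by metis
    next
      assume "p \<in> set ?qs"
      then have "fst p \<in> set es" "partner ?qs (fst p) = snd p"
        using perfect_partner(4)[OF qs es] by auto
      then show ?thesis
        using positive_alternates(2)[OF ps qs es] perfect_partner(1)[OF qs es] by metis
    qed
    then show ?thesis using up by (auto simp: s_def)
  qed
  have abs: "\<bar>s e\<bar> \<le> 1" for e by (simp add: s_def)
  have "(\<Sum>e\<leftarrow>es. if item_point e = p then s e else 0)
      = (\<Sum>e\<leftarrow>snd (match item_point es). if item_point e = p then s e else 0)"
    using opp match_correct(2)[of _ item_point es]
        by (intro sum_match) (auto simp: row_matching_def)
  then show "(\<Sum>e\<leftarrow>es. if item_point e = p then s e else 0) = 0" by (simp add: r)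
  have inqs: "z \<in> set (fst ?a) \<or> z \<in> set (fst ?b) \<Longrightarrow> z \<in> set ?qs" for z
    by (auto simp: cell_matching_def Let_def)
  have "(\<Sum>e\<leftarrow>es. if cell_key e = k then s e else 0) = (\<Sum>e\<leftarrow>snd ?a. if cell_key e = k then s e else 0)"
    using opp inqs match_correct(2)[of _ cell_key es] by (intro sum_match) auto
  then show "\<bar>\<Sum>e\<leftarrow>es. if cell_key e = k then s e else 0\<bar> \<le> 1"
    using sum_distinct_keys[of cell_key "snd ?a" s k, OF match_correct(3) abs] by simp
  have "item_center (fst z) = item_center (snd z)" if "z \<in> set (fst ?a)" for z
    using match_correct(2)[OF that] by (simp add: cell_key_def)
  then have "(\<Sum>e\<leftarrow>es. if item_center e = c then s e else 0)
      = (\<Sum>e\<leftarrow>snd ?a. if item_center e = c then s e else 0)"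
    using opp inqs by (intro sum_match) auto
  also have "\<dots> = (\<Sum>e\<leftarrow>snd ?b. if item_center e = c then s e else 0)"
    using opp inqs match_correct(2)[of _ item_center "snd ?a"] by (intro sum_match) auto
  finally show "\<bar>\<Sum>e\<leftarrow>es. if item_center e = c then s e else 0\<bar> \<le> 1"
    using sum_distinct_keys[of item_center "snd ?b" s c, OF match_correct(3) abs] by simp
  have sgn: "(\<Sum>e\<leftarrow>es. (if P e then 1 else -1) * int (item_cost e)) =
      int (total_cost (filter P es)) - int (total_cost (filter (\<lambda>e. \<not> P e) es))" for P
    by (induction es) (auto simp: total_cost_def)
  let ?P = "\<lambda>e. e \<in> set (rounded_up es)"
  have "total_cost (filter ?P es) \<le> total_cost (filter (\<lambda>e. \<not> ?P e) es)"
  proof (cases "total_cost (filter (\<lambda>e. positive ?ps ?qs es e) es)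
      \<le> total_cost (filter (\<lambda>e. \<not> positive ?ps ?qs es e) es)")
    case True
    then have "?P e \<longleftrightarrow> positive ?ps ?qs es e" if "e \<in> set es" for e
      using that by (simp add: rounded_up_def Let_def)
    then have "filter ?P es = filter (\<lambda>e. positive ?ps ?qs es e) es"
      "filter (\<lambda>e. \<not> ?P e) es = filter (\<lambda>e. \<not> positive ?ps ?qs es e) es"
      by (auto intro: filter_cong)
    then show ?thesis using True by simp
  next
    case False
    then have "?P e \<longleftrightarrow> \<not> positive ?ps ?qs es e" if "e \<in> set es" for e
      using that by (simp add: rounded_up_def Let_def)
    then have "filter ?P es = filter (\<lambda>e. \<not> positive ?ps ?qs es e) es"
      "filter (\<lambda>e. \<not> ?P e) es = filter (\<lambda>e. positive ?ps ?qs es e) es"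
      by (auto intro: filter_cong)
    then show ?thesis using False by simp
  qed
  then show "(\<Sum>e\<leftarrow>es. s e * int (item_cost e)) \<le> 0" unfolding s_def by (subst sgn) simp
qed

definition halved :: "item list \<Rightarrow> (item \<Rightarrow> nat) \<Rightarrow> item \<Rightarrow> nat" where
  "halved es X e = X e div 2 + (if e \<in> set (rounded_up (filter (\<lambda>e. odd (X e)) es)) then 1 else 0)"

lemma halve_eq: "halve (map (\<lambda>e. (e, X e)) es) = map (\<lambda>e. (e, halved es X e)) es"
proof -
  have "map fst (filter (\<lambda>z. odd (snd z)) (map (\<lambda>e. (e, X e)) es)) = filter (\<lambda>e. odd (X e)) es"
    by (induction es) auto
  then show ?thesis unfolding halve_def halved_def Let_def by simp
qed

text \<open>Twice the new multiplicity is the old one plus, if that is odd, the sign of the item;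
  each deviation is thus a signed sum over the odd items. Evenness of the point weights makes the
  number of odd items of every point even, as the row matching demands.\<close>

lemma halved_correct:
  assumes es: "distinct es" and ev: "\<And>p. even (point_weight p X es)"
  shows "2 * point_weight p (halved es X) es = point_weight p X es" (is ?point)
    and "\<bar>2 * int (cell_weight k (halved es X) es) - int (cell_weight k X es)\<bar> \<le> 1" (is ?cell)
    and "\<bar>2 * int (center_weight c (halved es X) es) - int (center_weight c X es)\<bar> \<le> 1" (is ?center)
    and "2 * weighted_cost (halved es X) es \<le> weighted_cost X es" (is ?cost)
proof -
  let ?O = "filter (\<lambda>e. odd (X e)) es"
  let ?s = "\<lambda>e. if e \<in> set (rounded_up ?O) then 1 else -1 :: int"
  have "set (rounded_up ?O) \<subseteq> set ?O" by (auto simp: rounded_up_def Let_def)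
  then have h: "2 * int (halved es X e) = int (X e) + (if odd (X e) then ?s e else 0)"
    if "e \<in> set es" for e
  proof (cases "odd (X e)")
    case True
    then have "X e = 2 * (X e div 2) + 1" by simp
    then have "int (X e) = 2 * int (X e div 2) + 1" by linarith
    then show ?thesis using True by (simp add: halved_def)
  next
    case False
    then have "X e = 2 * (X e div 2)" by simp
    then have "int (X e) = 2 * int (X e div 2)" by linarith
    moreover have "e \<notin> set (rounded_up ?O)"
      using False \<open>set (rounded_up ?O) \<subseteq> set ?O\<close> by auto
    ultimately show ?thesis using False by (simp add: halved_def)
  qed
  have "2 * int (\<Sum>e\<leftarrow>fs. if K e then halved es X e else 0) =
      int (\<Sum>e\<leftarrow>fs. if K e then X e else 0) + (\<Sum>e\<leftarrow>filter (\<lambda>e. odd (X e)) fs. if K e then ?s e else 0)"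
    if "set fs \<subseteq> set es" for K fs
    using that
  proof (induction fs)
    case (Cons e fs)
    then have "2 * int (if K e then halved es X e else 0) =
        int (if K e then X e else 0) + (if odd (X e) then if K e then ?s e else 0 else 0)"
      using h[of e] by simp
    moreover have "2 * int (\<Sum>e\<leftarrow>fs. if K e then halved es X e else 0) =
      int (\<Sum>e\<leftarrow>fs. if K e then X e else 0) + (\<Sum>e\<leftarrow>filter (\<lambda>e. odd (X e)) fs. if K e then ?s e else 0)"
      using Cons by simp
    ultimately show ?case by (simp only: list.map sum_list.Cons filter.simps of_nat_add distrib_left
        split: if_split) linarith
  qed simp
  then have w: "2 * int (weight K (halved es X) es) = int (weight K X es)
      + (\<Sum>e\<leftarrow>?O. if K e then ?s e else 0)" for K
    unfolding weight_def by blast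
  have "even (weight K X es) \<longleftrightarrow> even (length (filter K ?O))" for K
    unfolding weight_def by (induction es) auto
  then have "even (length (filter (\<lambda>e. item_point e = p) ?O))" for p using ev by blast
  note R = rounded_up_correct[OF distinct_filter[OF es] this]
  show ?point
    using w[of "\<lambda>e. item_point e = p"] R(1)[of p] by linarith
  show ?cell
    using w[of "\<lambda>e. cell_key e = k"] R(2)[of k] by linarith
  show ?center
    using w[of "\<lambda>e. item_center e = c"] R(3)[of c] by linarith
  have "2 * int (\<Sum>e\<leftarrow>fs. halved es X e * item_cost e) =
      int (\<Sum>e\<leftarrow>fs. X e * item_cost e) + (\<Sum>e\<leftarrow>filter (\<lambda>e. odd (X e)) fs. ?s e * int (item_cost e))"
    if "set fs \<subseteq> set es" for fs
    using that
  proof (induction fs)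
    case (Cons e fs)
    have "e \<in> set es" using Cons.prems by simp
    from arg_cong[OF h[OF this], of "\<lambda>z. z * int (item_cost e)"]
    have "2 * int (halved es X e * item_cost e) =
        int (X e * item_cost e) + (if odd (X e) then ?s e * int (item_cost e) else 0)"
      by (simp only: distrib_right of_nat_mult mult.assoc split: if_split) simp
    moreover have "2 * int (\<Sum>e\<leftarrow>fs. halved es X e * item_cost e) =
      int (\<Sum>e\<leftarrow>fs. X e * item_cost e) + (\<Sum>e\<leftarrow>filter (\<lambda>e. odd (X e)) fs. ?s e * int (item_cost e))"
      using Cons by simp
    ultimately show ?case by (simp only: list.map sum_list.Cons filter.simps of_nat_add distrib_left
        split: if_split) linarith
  qed simp
  from this[OF subset_refl] show ?cost
    using R(4) unfolding weighted_cost_def by linarith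
qed

definition rounding :: "nat \<Rightarrow> item list \<Rightarrow> (item \<Rightarrow> nat) \<Rightarrow> (item \<Rightarrow> nat) \<Rightarrow> bool" where
  "rounding T es X Y \<longleftrightarrow>
    (\<forall>k. \<bar>int T * int (cell_weight k Y es) - int (cell_weight k X es)\<bar> < int T) \<and>
    (\<forall>c. \<bar>int T * int (center_weight c Y es) - int (center_weight c X es)\<bar> < int T) \<and>
    T * weighted_cost Y es \<le> weighted_cost X es"

text \<open>The point weights carry the factor \<open>2 ^ length js\<close>, so they are even before
  each halving.\<close>

lemma fold_halve_correct:
  assumes es: "distinct es" and "\<And>p. point_weight p X es = 2 ^ length js * t p"
  shows "\<exists>Y. fold (\<lambda>_. halve) js (map (\<lambda>e. (e, X e)) es) = map (\<lambda>e. (e, Y e)) es \<and>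
    (\<forall>p. point_weight p Y es = t p) \<and> rounding (2 ^ length js) es X Y"
  using assms(2)
proof (induction js arbitrary: X)
  case Nil
  then show ?case by (intro exI[of _ X]) (simp add: rounding_def)
next
  case (Cons j js)
  have "even (point_weight p X es)" for p
    using Cons.prems by simp
  note H = halved_correct[OF es this]
  have "point_weight p (halved es X) es = 2 ^ length js * t p" for p
    using H(1)[of p] Cons.prems[of p] by simp
  from Cons.IH[OF this] obtain Y where
    Y: "fold (\<lambda>_. halve) js (map (\<lambda>e. (e, halved es X e)) es) = map (\<lambda>e. (e, Y e)) es"
      "\<forall>p. point_weight p Y es = t p" "rounding (2 ^ length js) es (halved es X) Y" by blast
  \<comment> \<open>With \<open>m = 2 ^ length js\<close>, the first error is at most
    \<open>m - 1\<close> by integrality, so the doubled error plus 1 is at most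
    \<open>2 * m - 1\<close>: strictness survives every bit.\<close>
  have arith: "\<bar>int (2 ^ length (j # js)) * a - c\<bar> < int (2 ^ length (j # js))"
    if "\<bar>int (2 ^ length js) * a - b\<bar> < int (2 ^ length js)" "\<bar>2 * b - c\<bar> \<le> 1" for a b c :: int
  proof -
    define m :: int where "m = int (2 ^ length js)"
    define n where "n = m * a"
    have "\<bar>2 * n - c\<bar> < 2 * m" using that unfolding m_def[symmetric] n_def[symmetric] by linarith
    then show ?thesis by (simp add: m_def n_def mult.assoc)
  qed
  note R = Y(3)[unfolded rounding_def]
  have "2 ^ length (j # js) * weighted_cost Y es \<le> weighted_cost X es"
    using R H(4) by simp
  moreover have "\<bar>int (2 ^ length (j # js)) * int (cell_weight k Y es) - int (cell_weight k X es)\<bar>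
      < int (2 ^ length (j # js))" for k
    by (rule arith[OF _ H(2)]) (use R in blast)
  moreover have "\<bar>int (2 ^ length (j # js)) * int (center_weight c Y es)
      - int (center_weight c X es)\<bar>
      < int (2 ^ length (j # js))" for c
    by (rule arith[OF _ H(3)]) (use R in blast)
  ultimately have "rounding (2 ^ length (j # js)) es X Y" unfolding rounding_def by blast
  then show ?case
    using Y(1,2) by (intro exI[of _ Y]) (simp only: fold_simps comp_apply halve_eq, simp)
qed

section \<open>The queue iteration\<close>

lemma sum_list_swap:
  fixes f :: "'a \<Rightarrow> 'b \<Rightarrow> 'c::comm_monoid_add"
  shows "(\<Sum>x\<leftarrow>xs. \<Sum>y\<leftarrow>ys. f x y) = (\<Sum>y\<leftarrow>ys. \<Sum>x\<leftarrow>xs. f x y)"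
  by (induction xs) (simp_all add: sum_list_addf)

definition choice :: "item list \<Rightarrow> item list list \<Rightarrow> bool" where
  "choice s tab \<longleftrightarrow> list_all2 (\<lambda>e rw. e \<in> set rw) s tab"

definition fair :: "nat \<Rightarrow> cell list \<Rightarrow> item list \<Rightarrow> bool" where
  "fair Q st s \<longleftrightarrow> (\<forall>K\<in>set st. Q * cell_count K s \<le> cell_upper K * center_count K s \<and>
     cell_lower K * center_count K s \<le> Q * cell_count K s)"

definition queue_fair :: "nat \<Rightarrow> item list \<Rightarrow> cell \<Rightarrow> bool" where
  "queue_fair Q s K \<longleftrightarrow>
     Q * cell_count K s \<le> cell_upper K * center_count K s + upper_queue K \<and>
     cell_lower K * center_count K s \<le> Q * cell_count K s + lower_queue K"

definition initial :: "nat \<Rightarrow> cell list \<Rightarrow> bool" where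
  "initial Q st \<longleftrightarrow> (\<forall>K\<in>set st. cell_lower K \<le> Q \<and> cell_upper K \<le> Q \<and>
     upper_queue K = 0 \<and> lower_queue K = 0)"

section \<open>The quadratic potential and its drift\<close>

definition penalty :: "nat \<Rightarrow> cell \<Rightarrow> item \<Rightarrow> int" where
  "penalty Q K e = (if cell_center K = item_center e then
      (if cell_color K = item_color e then int Q * (int (upper_queue K) - int (lower_queue K))
          else 0) +
      int (cell_lower K) * int (lower_queue K) - int (cell_upper K) * int (upper_queue K) else 0)"

text \<open>The quadratic Lyapunov function of queueing theory. Its growth in one round is, up to a
  constant, at most twice the sum of the penalties of the chosen items.\<close>

definition potential :: "cell list \<Rightarrow> int" where
  "potential st = (\<Sum>K\<leftarrow>st. (int (upper_queue K))\<^sup>2 + (int (lower_queue K))\<^sup>2)"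

lemma penalty_sum:
  "(\<Sum>e\<leftarrow>s. penalty Q K e) =
    int (upper_queue K) * (int Q * int (cell_count K s)
        - int (cell_upper K) * int (center_count K s)) +
    int (lower_queue K) * (int (cell_lower K) * int (center_count K s)
        - int Q * int (cell_count K s))"
  by (induction s) (auto simp: penalty_def cell_count_def center_count_def algebra_simps)

lemma score_diff:
  "int (fst (score (Q, V, E) st e)) - int (snd (score (Q, V, E) st e)) =
    int V * int (item_cost e) + int E * (\<Sum>K\<leftarrow>st. penalty Q K e)"
proof -
  have "int (\<Sum>K\<leftarrow>filter (\<lambda>K. cell_center K = item_center e) st.
          (if cell_color K = item_color e then Q * upper_queue K else 0)
              + cell_lower K * lower_queue K) -
      int (\<Sum>K\<leftarrow>filter (\<lambda>K. cell_center K = item_center e) st.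
          (if cell_color K = item_color e then Q * lower_queue K else 0)
              + cell_upper K * upper_queue K) =
      (\<Sum>K\<leftarrow>st. penalty Q K e)"
    by (induction st) (auto simp: penalty_def algebra_simps)
  moreover have "int (V * w + E * A) - int (E * B) = int V * int w + int E * (int A - int B)"
      for w A B
    by (simp add: algebra_simps)
  ultimately show ?thesis by (simp only: score_def fst_conv snd_conv)
qed

lemma select_le:
  assumes "e \<in> set rw"
  shows "int V * int (item_cost (select (Q, V, E) st rw))
      + int E * (\<Sum>K\<leftarrow>st. penalty Q K (select (Q, V, E) st rw))
    \<le> int V * int (item_cost e) + int E * (\<Sum>K\<leftarrow>st. penalty Q K e)"
proof (cases rw)
  case (Cons d ds)
  then show ?thesis
    using least_by_le[of e d ds "score (Q, V, E) st"] assms unfolding score_diff[symmetric]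
    by (simp add: select_def)
qed (use assms in simp)

text \<open>The objective is a sum over items, so minimizing it in each row minimizes it over all
  choices.\<close>

lemma select_sum_le:
  fixes Q V E :: nat and st :: "cell list"
  assumes "choice t tab"
  defines "F \<equiv> \<lambda>s. int V * int (total_cost s) + int E * (\<Sum>K\<leftarrow>st. \<Sum>e\<leftarrow>s. penalty Q K e)"
  shows "F (map (select (Q, V, E) st) tab) \<le> F t"
proof -
  have "(\<Sum>e\<leftarrow>map (select (Q, V, E) st) tab. int V * int (item_cost e)
      + int E * (\<Sum>K\<leftarrow>st. penalty Q K e))
      \<le> (\<Sum>e\<leftarrow>t. int V * int (item_cost e) + int E * (\<Sum>K\<leftarrow>st. penalty Q K e))"
    using assms(1) unfolding choice_def
  proof (induction rule: list_all2_induct)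
    case (Cons e es rw rws)
    then show ?case using select_le[of e rw V Q E st] by simp
  qed simp
  moreover have "(\<Sum>e\<leftarrow>s. int V * int (item_cost e) + int E * (\<Sum>K\<leftarrow>st. penalty Q K e)) = F s" for s
  proof -
    have "int (total_cost s) = (\<Sum>e\<leftarrow>s. int (item_cost e))"
      unfolding total_cost_def by (induction s) auto
    then show ?thesis
      unfolding F_def by (simp add: sum_list_addf sum_list_const_mult sum_list_swap[of _ s])
  qed
  ultimately show ?thesis by (simp only:)
qed

lemma potential_update:
  assumes "\<forall>K\<in>set st. cell_lower K \<le> Q \<and> cell_upper K \<le> Q" "length s = n"
  shows "potential (map (update Q s) st) \<le>
    potential st + 2 * (\<Sum>K\<leftarrow>st. \<Sum>e\<leftarrow>s. penalty Q K e) + 2 * int (length st) * (int Q * int n)\<^sup>2"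
proof -
  \<comment> \<open>Truncation at 0 does not increase the square, so the recursion may be expanded
    as if it were untruncated.\<close>
  have sq: "(int (a + b - c))\<^sup>2 \<le> (int a)\<^sup>2 + 2 * int a * (int b - int c) + (int m)\<^sup>2"
    if "b \<le> m" "c \<le> m" for a b c m :: nat
  proof -
    have "(int (a + b - c))\<^sup>2 \<le> (int a + (int b - int c))\<^sup>2"
      by (cases "a + b \<le> c") (simp_all add: of_nat_diff algebra_simps)
    also have "\<dots> = (int a)\<^sup>2 + 2 * int a * (int b - int c) + (int b - int c)\<^sup>2"
      by (simp add: power2_eq_square algebra_simps)
    also have "(int b - int c)\<^sup>2 \<le> (int m)\<^sup>2"
      using that by (intro abs_le_square_iff[THEN iffD1]) linarith
    finally show ?thesis by simp
  qed
  have "(int (upper_queue (update Q s K)))\<^sup>2 + (int (lower_queue (update Q s K)))\<^sup>2 \<le>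
      (int (upper_queue K))\<^sup>2 + (int (lower_queue K))\<^sup>2 + 2 * (\<Sum>e\<leftarrow>s. penalty Q K e)
          + 2 * (int Q * int n)\<^sup>2"
    if K: "K \<in> set st" for K
  proof -
    have y: "cell_count K s \<le> n" "center_count K s \<le> n"
      using assms(2) by (auto simp: cell_count_def center_count_def)
    have b: "Q * cell_count K s \<le> Q * n" "cell_upper K * center_count K s \<le> Q * n"
      "cell_lower K * center_count K s \<le> Q * n"
      using y assms(1) K by (auto intro: mult_mono)
    show ?thesis
      using sq[OF b(1,2), of "upper_queue K"] sq[OF b(3,1), of "lower_queue K"]
      unfolding penalty_sum by (simp add: update_def algebra_simps)
  qed
  then show ?thesis using assms(1)
  proof (induction st)
    case (Cons K st)
    have "potential (map (update Q s) st) \<le>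
      potential st + 2 * (\<Sum>K\<leftarrow>st. \<Sum>e\<leftarrow>s. penalty Q K e) + 2 * int (length st) * (int Q * int n)\<^sup>2"
      using Cons by simp
    moreover note Cons.prems(1)[of K]
    ultimately show ?case by (simp add: potential_def algebra_simps)
  qed (simp add: potential_def)
qed

text \<open>The fair choice \<open>t\<close> has nonpositive total penalty, because queues are
  nonnegative and \<open>t\<close> violates no bound. Since the selected choice minimizes the
  objective, any growth of the potential beyond the constant term is paid for by a lower cost than
  that of \<open>t\<close>.\<close>

lemma drift_plus_penalty:
  fixes Q V E :: nat
  assumes "\<forall>K\<in>set st. cell_lower K \<le> Q \<and> cell_upper K \<le> Q" "choice t tab" "fair Q st t"
  defines "s \<equiv> map (select (Q, V, E) st) tab"
  shows "int E * potential (map (update Q s) st) + 2 * int V * int (total_cost s)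
    \<le> int E * potential st + 2 * int V * int (total_cost t)
        + 2 * int E * int (length st) * (int Q * int (length tab))\<^sup>2"
proof -
  have "(\<Sum>K\<leftarrow>st. \<Sum>e\<leftarrow>t. penalty Q K e) \<le> (\<Sum>K\<leftarrow>st. 0)"
  proof (rule sum_list_mono)
    fix K assume "K \<in> set st"
    then have "int (Q * cell_count K t) \<le> int (cell_upper K * center_count K t)"
      "int (cell_lower K * center_count K t) \<le> int (Q * cell_count K t)"
      using assms(3) unfolding fair_def by (metis of_nat_mono)+
    then show "(\<Sum>e\<leftarrow>t. penalty Q K e) \<le> 0"
      unfolding penalty_sum by (intro add_nonpos_nonpos mult_nonneg_nonpos) auto
  qed
  then have "int E * (\<Sum>K\<leftarrow>st. \<Sum>e\<leftarrow>t. penalty Q K e) \<le> 0"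
    by (intro mult_nonneg_nonpos) auto
  then have "int V * int (total_cost s) + int E * (\<Sum>K\<leftarrow>st. \<Sum>e\<leftarrow>s. penalty Q K e)
      \<le> int V * int (total_cost t)"
    using select_sum_le[OF assms(2), where V = V and E = E and st = st and Q = Q] unfolding s_def
        by linarith
  moreover have "int E * potential (map (update Q s) st) \<le> int E * (potential st +
      2 * (\<Sum>K\<leftarrow>st. \<Sum>e\<leftarrow>s. penalty Q K e) + 2 * int (length st) * (int Q * int (length tab))\<^sup>2)"
    by (intro mult_left_mono potential_update assms(1)) (simp_all add: s_def)
  ultimately show ?thesis by (simp add: distrib_left)
qed

lemma count_update [simp]:
  "cell_count (update q s K) t = cell_count K t" "center_count (update q s K) t = center_count K t"
  by (simp_all add: update_def cell_count_def center_count_def)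

lemma update_fields:
  "fst (update q s K) = fst K"
  "upper_queue (update q s K) = upper_queue K + q * cell_count K s
      - cell_upper K * center_count K s"
  "lower_queue (update q s K) = lower_queue K + cell_lower K * center_count K s
      - q * cell_count K s"
  by (simp_all add: update_def)

lemma count_append [simp]:
  "cell_count K (s @ t) = cell_count K s + cell_count K t"
  "center_count K (s @ t) = center_count K s + center_count K t"
  by (simp_all add: cell_count_def center_count_def)

lemma choice_select: "\<forall>rw\<in>set tab. rw \<noteq> [] \<Longrightarrow> choice (map (select P st) tab) tab"
  unfolding choice_def by (auto simp: list_all2_conv_all_nth select_in)

lemma run_history:
  assumes "\<forall>rw\<in>set tab. rw \<noteq> []"
  shows "\<exists>ss. length ss = length ks \<and> (\<forall>s\<in>set ss. choice s tab) \<and> snd (run P tab st ks) = concat ss"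
proof (induction ks rule: rev_induct)
  case (snoc k ks)
  then obtain ss where ss: "length ss = length ks" "\<forall>s\<in>set ss. choice s tab"
    "snd (run P tab st ks) = concat ss" by blast
  let ?s = "map (select P (fst (run P tab st ks))) tab"
  have "snd (run P tab st (ks @ [k])) = concat (?s # ss)"
    using ss(3) by (simp add: run_def tick_def Let_def)
  moreover have "length (?s # ss) = length (ks @ [k]) \<and> (\<forall>s\<in>set (?s # ss). choice s tab)"
    using ss choice_select[OF assms] by simp
  ultimately show ?case by blast
qed (simp add: run_def)

text \<open>The drift inequalities of all rounds add up, always against the same fair choice
  \<open>t\<close>. The final queues dominate the accumulated violations, as a truncated queue is at
  least its untruncated counterpart.\<close>

lemma run_correct:
  fixes Q V E :: nat
  assumes st: "initial Q st" and t: "choice t tab" "fair Q st t"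
    and run: "run (Q, V, E) tab st ks = (st', h)"
  shows "map fst st' = map fst st"
    and "int E * potential st' + 2 * int V * int (total_cost h) \<le> int (length ks) *
      (2 * int V * int (total_cost t) + 2 * int E * int (length st) * (int Q * int (length tab))\<^sup>2)"
      (is "_ \<le> int (length ks) * ?B")
    and "\<forall>K\<in>set st'. queue_fair Q h K"
proof -
  have "map fst st' = map fst st \<and>
    int E * potential st' + 2 * int V * int (total_cost h) \<le> int (length ks) * ?B \<and>
    (\<forall>K\<in>set st'. queue_fair Q h K)"
    using run
  proof (induction ks arbitrary: st' h rule: rev_induct)
    case Nil
    have "potential st = (\<Sum>K\<leftarrow>st. 0)"
      unfolding potential_def using st
      by (intro arg_cong[of _ _ sum_list] map_cong) (auto simp: initial_def)
    then show ?case
      using Nil by (auto simp: run_def total_cost_def cell_count_def center_count_def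
          queue_fair_def)
  next
    case (snoc k ks)
    obtain st1 h1 where r: "run (Q, V, E) tab st ks = (st1, h1)" by (metis prod.exhaust)
    define s where "s = map (select (Q, V, E) st1) tab"
    have r': "st' = map (update Q s) st1" "h = s @ h1"
      using r snoc.prems by (simp_all add: run_def tick_def Let_def s_def)
    note IH = snoc.IH[OF r]
    have fst: "map fst st1 = map fst st" using IH by blast
    then have len: "length st1 = length st" by (metis length_map)
    have st1: "\<exists>K'\<in>set st. fst K = fst K'" if "K \<in> set st1" for K
    proof -
      have "fst K \<in> fst ` set st" using fst that by (metis image_eqI list.set_map)
      then show ?thesis by blast
    qed
    have bnd: "\<forall>K\<in>set st1. cell_lower K \<le> Q \<and> cell_upper K \<le> Q"
      using st1 st unfolding initial_def by fastforce
    have "fair Q st1 t"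
      unfolding fair_def
    proof
      fix K assume "K \<in> set st1"
      then obtain K' where K': "K' \<in> set st" "fst K = fst K'" using st1 by blast
      then have "cell_count K t = cell_count K' t" "center_count K t = center_count K' t"
        by (simp_all add: cell_count_def center_count_def)
      then show "Q * cell_count K t \<le> cell_upper K * center_count K t \<and>
          cell_lower K * center_count K t \<le> Q * cell_count K t"
        using t(2) K' by (simp add: fair_def)
    qed
    from drift_plus_penalty[OF bnd t(1) this, where V = V and E = E]
    have "int E * potential st' + 2 * int V * int (total_cost s) \<le> int E * potential st1 + ?B"
      by (simp add: s_def len r' add.assoc)
    then have drift: "int E * potential st' + 2 * int V * int (total_cost h)
        \<le> int (length (ks @ [k])) * ?B"
      using IH by (simp add: r' total_cost_def algebra_simps)
    have "queue_fair Q h K" if "K \<in> set st'" for K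
    proof -
      from that obtain K' where K': "K' \<in> set st1" "K = update Q s K'" by (auto simp: r')
      have ar: "x \<le> y + a \<Longrightarrow> p + x \<le> q + y + (a + p - q)" for x y a p q :: nat by linarith
      have "queue_fair Q h1 K'" using IH K'(1) by blast
      then have "Q * cell_count K' h1 \<le> cell_upper K' * center_count K' h1 + upper_queue K'"
        "cell_lower K' * center_count K' h1 \<le> Q * cell_count K' h1 + lower_queue K'"
        by (simp_all add: queue_fair_def)
      from this[THEN ar] show ?thesis
        unfolding K'(2) r'(2) by (simp add: queue_fair_def update_fields distrib_left)
    qed
    moreover have "map fst st' = map fst st"
      unfolding fst[symmetric] r' by (simp add: update_def comp_def)
    ultimately show ?case using drift by blast
  qed
  then show "map fst st' = map fst st"
    "int E * potential st' + 2 * int V * int (total_cost h) \<le> int (length ks) * ?B"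
    "\<forall>K\<in>set st'. queue_fair Q h K" by blast+
qed

section \<open>One assignment from the history of all rounds\<close>

definition item_table :: "item list list \<Rightarrow> bool" where
  "item_table tab \<longleftrightarrow> (\<forall>rw\<in>set tab. rw \<noteq> []) \<and> distinct (concat tab) \<and>
    (\<forall>i<length tab. \<forall>e\<in>set (tab ! i). item_point e = i)"

lemma weight_count:
  assumes "distinct es" "set h \<subseteq> set es"
  shows "(\<Sum>e\<leftarrow>es. length (filter (\<lambda>d. d = e) h) * f e) = sum_list (map f h)"
  using assms(2)
proof (induction h)
  case (Cons d h)
  have "(\<Sum>e\<leftarrow>es. length (filter (\<lambda>x. x = e) (d # h)) * f e) =
      (\<Sum>e\<leftarrow>es. (if d = e then f e else 0) + length (filter (\<lambda>x. x = e) h) * f e)"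
    by (intro arg_cong[of _ _ sum_list] map_cong) (auto simp: algebra_simps)
  also have "\<dots> = (\<Sum>e\<leftarrow>es. if d = e then f e else 0) + sum_list (map f h)"
    using Cons by (simp add: sum_list_addf)
  also have "(\<Sum>e\<leftarrow>es. if d = e then f e else 0) = f d"
    using assms(1) Cons.prems by (simp add: sum_list_distinct_conv_sum_set sum.delta')
  finally show ?case by simp
qed simp

lemma weight_alt: "weight K X es = (\<Sum>e\<leftarrow>es. X e * of_bool (K e))"
  unfolding weight_def by (intro arg_cong[of _ _ sum_list] map_cong) auto

lemma length_filter_sum: "length (filter K h) = (\<Sum>e\<leftarrow>h. of_bool (K e))"
  by (induction h) auto

text \<open>Natural numbers with sum 1 single out one item, so the final multiplicities in a row
  amount to an integral choice.\<close>

lemma sum_unit_row: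
  fixes Y :: "item \<Rightarrow> nat"
  assumes "(\<Sum>e\<leftarrow>rw. Y e) = 1"
  shows "filter (\<lambda>e. 0 < Y e) rw \<noteq> []" "(\<Sum>e\<leftarrow>rw. Y e * f e) = f (hd (filter (\<lambda>e. 0 < Y e) rw))"
proof -
  have "filter (\<lambda>e. 0 < Y e) rw \<noteq> [] \<and> (\<Sum>e\<leftarrow>rw. Y e * f e) = f (hd (filter (\<lambda>e. 0 < Y e) rw))"
    using assms
  proof (induction rw)
    case (Cons e rw)
    show ?case
    proof (cases "Y e")
      case 0
      then show ?thesis using Cons by simp
    next
      case (Suc y)
      then have "\<forall>d\<in>set rw. Y d = 0" using Cons.prems by auto
      then have "(\<Sum>e\<leftarrow>rw. Y e * f e) = (\<Sum>e\<leftarrow>rw. 0)"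
        by (intro arg_cong[of _ _ sum_list] map_cong) auto
      then show ?thesis using Suc Cons.prems by simp
    qed
  qed simp
  then show "filter (\<lambda>e. 0 < Y e) rw \<noteq> []"
    "(\<Sum>e\<leftarrow>rw. Y e * f e) = f (hd (filter (\<lambda>e. 0 < Y e) rw))" by auto
qed

lemma weight_row:
  assumes tab: "item_table tab" and "p < length tab"
  shows "point_weight p Y (concat tab) = (\<Sum>e\<leftarrow>tab ! p. Y e)"
proof -
  have "point_weight p Y (concat tab) = (\<Sum>rw\<leftarrow>tab. point_weight p Y rw)"
    unfolding weight_def by (induction tab) auto
  also have "\<dots> = (\<Sum>i<length tab. point_weight p Y (tab ! i))"
    by (simp add: sum_list_sum_nth atLeast0LessThan)
  also have "\<dots> = (\<Sum>i<length tab. if i = p then (\<Sum>e\<leftarrow>tab ! p. Y e) else 0)"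
  proof (rule sum.cong)
    fix i assume "i \<in> {..<length tab}"
    then have "\<forall>e\<in>set (tab ! i). item_point e = i" using tab by (simp add: item_table_def)
    then have "point_weight p Y (tab ! i) = (\<Sum>e\<leftarrow>tab ! i. if i = p then Y e else 0)"
      unfolding weight_def by (intro arg_cong[of _ _ sum_list] map_cong) auto
    then show "point_weight p Y (tab ! i) = (if i = p then (\<Sum>e\<leftarrow>tab ! p. Y e) else 0)"
      by auto
  qed simp
  also have "\<dots> = (\<Sum>e\<leftarrow>tab ! p. Y e)" using assms(2) by simp
  finally show ?thesis .
qed

lemma choice_point:
  assumes "item_table tab" "choice s tab"
  shows "length (filter (\<lambda>e. item_point e = p) s) = (if p < length tab then 1 else 0)"
proof -
  have len: "length s = length tab" using assms(2) by (auto simp: choice_def list_all2_lengthD)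
  have pt: "item_point (s ! i) = i" if "i < length s" for i
    using assms that len by (auto simp: choice_def item_table_def list_all2_conv_all_nth)
  have "length (filter (\<lambda>e. item_point e = p) s) = card {i. i < length s \<and> item_point (s ! i) = p}"
    by (rule length_filter_conv_card)
  also have "{i. i < length s \<and> item_point (s ! i) = p} = (if p < length tab then {p} else {})"
    using pt len by auto
  finally show ?thesis by simp
qed

lemma choice_subset: "choice s tab \<Longrightarrow> set s \<subseteq> set (concat tab)"
  unfolding choice_def by (auto simp: list_all2_conv_all_nth in_set_conv_nth) (metis nth_mem)

text \<open>Every round assigns each point once, so the multiplicities in a row sum to the number of
  rounds, a power of two; as many halvings as its exponent reduce the sum to 1.\<close>

lemma solve_rounds:
  assumes tab: "item_table tab" and h: "snd (run P tab st ks) = concat ss" "\<forall>s\<in>set ss. choice s tab"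
    and len: "length ss = 2 ^ length js"
  defines "h \<equiv> snd (run P tab st ks)" and "T \<equiv> 2 ^ length js" and "s \<equiv> solve P tab st ks js"
  shows "choice s tab"
    "\<bar>int T * int (cell_count K s) - int (cell_count K h)\<bar> < int T"
    "\<bar>int T * int (center_count K s) - int (center_count K h)\<bar> < int T"
    "T * total_cost s \<le> total_cost h"
proof -
  let ?es = "concat tab"
  let ?X = "\<lambda>e. length (filter (\<lambda>d. d = e) h)"
  have es: "distinct ?es" using tab by (simp add: item_table_def)
  have sub: "set h \<subseteq> set ?es"
    unfolding h_def h(1) using h(2) choice_subset by (simp only: set_concat) blast
  have X: "weight K ?X ?es = length (filter K h)" for K
    using weight_count[OF es sub, of "\<lambda>e. of_bool (K e)"] length_filter_sum[of K h]
    by (simp only: weight_alt)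
  have XC: "weighted_cost ?X ?es = total_cost h"
    unfolding weighted_cost_def total_cost_def by (rule weight_count[OF es sub])
  have "length (filter (\<lambda>e. item_point e = p) (concat ts))
      = length ts * (if p < length tab then 1 else 0)"
    if "\<forall>s\<in>set ts. choice s tab" for p ts
    using that by (induction ts) (simp_all add: choice_point[OF tab])
  then have tot: "point_weight p ?X ?es = 2 ^ length js * (if p < length tab then 1 else 0)" for p
    unfolding X using h len by (simp add: h_def)
  obtain Y where Y: "fold (\<lambda>_. halve) js (map (\<lambda>e. (e, ?X e)) ?es) = map (\<lambda>e. (e, Y e)) ?es"
      "\<forall>p. point_weight p Y ?es = (if p < length tab then 1 else 0)" "rounding T ?es ?X Y"
    using fold_halve_correct[of ?es ?X js "\<lambda>p. if p < length tab then 1 else 0", OF es tot]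
    unfolding T_def by blast
  note R = Y(3)[unfolded rounding_def X XC]
  let ?g = "\<lambda>rw. filter (\<lambda>e. 0 < Y e) rw"
  have one: "(\<Sum>e\<leftarrow>rw. Y e) = 1" if "rw \<in> set tab" for rw
  proof -
    obtain p where "p < length tab" "rw = tab ! p" using \<open>rw \<in> set tab\<close> by (metis in_set_conv_nth)
    then show ?thesis using Y(2) weight_row[OF tab, of p Y] by simp
  qed
  have "filter (\<lambda>e. \<exists>z\<in>set (map (\<lambda>e. (e, Y e)) ?es). fst z = e \<and> 0 < snd z) rw = ?g rw"
      if "rw \<in> set tab" for rw
    using that by (intro filter_cong) auto
  then have s: "s = map (\<lambda>rw. hd (?g rw)) tab"
    unfolding s_def solve_def Let_def h_def[symmetric] Y(1)
  proof (intro map_cong refl)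
    fix rw assume rw: "rw \<in> set tab"
      and eq: "\<And>rw. rw \<in> set tab \<Longrightarrow>
        filter (\<lambda>e. \<exists>z\<in>set (map (\<lambda>e. (e, Y e)) ?es). fst z = e \<and> 0 < snd z) rw = ?g rw"
    show "(case filter (\<lambda>e. \<exists>z\<in>set (map (\<lambda>e. (e, Y e)) ?es). fst z = e \<and> 0 < snd z) rw of
        [] \<Rightarrow> (0, 0, 0, 0) | e # _ \<Rightarrow> e) = hd (?g rw)"
      unfolding eq[OF rw] using sum_unit_row(1)[OF one[OF rw]] by (cases "?g rw") auto
  qed
  have sum: "(\<Sum>e\<leftarrow>s. f e) = (\<Sum>e\<leftarrow>?es. Y e * f e)" for f :: "item \<Rightarrow> nat"
  proof -
    have "(\<Sum>e\<leftarrow>s. f e) = (\<Sum>rw\<leftarrow>tab. \<Sum>e\<leftarrow>rw. Y e * f e)"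
      unfolding s map_map comp_def
      by (intro arg_cong[of _ _ sum_list] map_cong) (simp_all add: sum_unit_row(2)[OF one])
    also have "\<dots> = (\<Sum>e\<leftarrow>?es. Y e * f e)" by (induction tab) auto
    finally show ?thesis .
  qed
  show "choice s tab"
    unfolding choice_def s list_all2_conv_all_nth
  proof (intro conjI allI impI)
    fix i assume "i < length (map (\<lambda>rw. hd (?g rw)) tab)"
    then have i: "i < length tab" by simp
    then have "hd (?g (tab ! i)) \<in> set (?g (tab ! i))"
      by (intro hd_in_set sum_unit_row(1) one nth_mem)
    then show "map (\<lambda>rw. hd (?g rw)) tab ! i \<in> set (tab ! i)" using i by simp
  qed simp
  have W: "length (filter K s) = weight K Y ?es" for K
    unfolding weight_alt length_filter_sum by (rule sum)
  have cell: "cell_count K u = length (filter (\<lambda>e. cell_key e = (cell_color K, cell_center K)) u)"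
      for u
    unfolding cell_count_def cell_key_def by (simp add: prod_eq_iff)
  show "\<bar>int T * int (cell_count K s) - int (cell_count K h)\<bar> < int T"
    using R unfolding cell W by blast
  show "\<bar>int T * int (center_count K s) - int (center_count K h)\<bar> < int T"
    using R unfolding center_count_def W by blast
  have "total_cost s = weighted_cost Y ?es"
    unfolding total_cost_def weighted_cost_def by (rule sum)
  then show "T * total_cost s \<le> total_cost h" using R by simp
qed

text \<open>After division by \<open>T\<close>, the premises bound \<open>A * x\<close> by
  \<open>A * X / T + A\<close>, hence by \<open>B * Y / T + a / T + A\<close>, hence by
  \<open>B * y + B + A + a / T\<close>. The residual \<open>a / T\<close> is at most
  \<open>Q / n\<close>, which is just what \<open>A + B\<close> leaves free below
  \<open>2 * Q\<close>. The upper fairness bounds use \<open>A = Q\<close>, the lower ones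
  \<open>B = Q\<close>.\<close>

lemma rounding_slack:
  fixes A B Q n T a X Y x y :: nat
  assumes "0 < n" "0 < T" and XY: "A * X \<le> B * Y + a" and x: "T * x \<le> X + T" and y: "Y \<le> T * y + T"
    and a: "n * a \<le> T * Q" and AB: "n * (A + B) \<le> (2 * n - 1) * Q"
  shows "A * x \<le> B * y + 2 * Q"
proof -
  have "T * (A * x) = A * (T * x)" by simp
  also have "\<dots> \<le> A * (X + T)" by (intro mult_left_mono x) simp
  also have "\<dots> \<le> B * (T * y + T) + a + A * T"
    using XY mult_left_mono[OF y, of B] by (simp add: distrib_left)
  finally have "n * (T * (A * x)) \<le> n * (B * (T * y + T) + a + A * T)"
    by (intro mult_left_mono) simp_all
  also have "\<dots> = n * (B * (T * y)) + n * a + T * (n * (A + B))"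
    by (simp add: algebra_simps)
  also have "\<dots> \<le> n * (B * (T * y)) + T * Q + T * ((2 * n - 1) * Q)"
    by (intro add_mono mult_left_mono a AB) simp_all
  finally have "n * (T * (A * x)) \<le> n * (B * (T * y)) + T * Q + T * ((2 * n - 1) * Q)" .
  moreover have "T * Q + T * ((2 * n - 1) * Q) = T * (2 * n * Q)"
    using assms(1) by (cases n) (simp_all add: algebra_simps)
  ultimately have "n * (T * (A * x)) \<le> n * (B * (T * y)) + T * (2 * n * Q)" by linarith
  then have "n * T * (A * x) \<le> n * T * (B * y + 2 * Q)" by (simp add: algebra_simps)
  then show ?thesis using assms(1,2) by simp
qed

lemma potential_member:
  assumes "K \<in> set st"
  shows "(int (upper_queue K))\<^sup>2 \<le> potential st" "(int (lower_queue K))\<^sup>2 \<le> potential st"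
proof -
  have "(int (upper_queue K))\<^sup>2 + (int (lower_queue K))\<^sup>2 \<le> potential st"
    unfolding potential_def using assms
    by (intro member_le_sum_list) auto
  then show "(int (upper_queue K))\<^sup>2 \<le> potential st" "(int (lower_queue K))\<^sup>2 \<le> potential st"
    using zero_le_power2[of "int (upper_queue K)"] zero_le_power2[of "int (lower_queue K)"]
        by linarith+
qed

lemma count_le:
  "cell_count K s \<le> center_count K s" "center_count K s \<le> length s"
proof -
  show "cell_count K s \<le> center_count K s"
    unfolding cell_count_def center_count_def by (induction s) auto
  show "center_count K s \<le> length s" by (simp add: center_count_def)
qed

lemma choice_length: "choice s tab \<Longrightarrow> length s = length tab"
  by (auto simp: choice_def list_all2_lengthD)

lemma solve_choice:
  assumes "item_table tab" "length ks = 2 ^ length js"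
  shows "choice (solve P tab st ks js) tab"
proof -
  have "\<forall>rw\<in>set tab. rw \<noteq> []" using assms(1) by (simp add: item_table_def)
  from run_history[OF this, of ks P st] obtain ss where
    "length ss = length ks" "\<forall>s\<in>set ss. choice s tab" "snd (run P tab st ks) = concat ss" by blast
  then show ?thesis using solve_rounds(1)[OF assms(1), of P st ks ss js] assms(2) by simp
qed

lemma solve_correct:
  fixes Q E \<zeta> :: nat
  assumes tab: "item_table tab" "tab \<noteq> []" and "st \<noteq> []" "0 < Q" "0 < E" "0 < \<zeta>"
    and st: "initial Q st"
    and t: "choice t tab" "fair Q st t" and cost: "\<forall>e\<in>set (concat tab). item_cost e \<le> E"
    and len: "length ks = 2 ^ length js" "iterations \<zeta> (length st) (length tab) \<le> length ks"
  defines "V \<equiv> \<zeta> * length st * (Q * length tab) ^ 2"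
  defines "s \<equiv> solve (Q, (V, E)) tab st ks js"
  shows "\<zeta> * total_cost s \<le> \<zeta> * total_cost t + E"
    "K \<in> set st \<Longrightarrow> Q * cell_count K s \<le> cell_upper K * center_count K s + 2 * Q"
    "K \<in> set st \<Longrightarrow> Q \<le> length tab * (Q - cell_lower K) \<or> cell_count K s = center_count K s \<Longrightarrow>
      cell_lower K * center_count K s \<le> Q * cell_count K s + 2 * Q"
proof -
  let ?P = "(Q, V, E)"
  define n where "n = length tab"
  define T where "T = length ks"
  define W where "W = length st * (Q * n) ^ 2"
  obtain st' h where run: "run ?P tab st ks = (st', h)" by (metis prod.exhaust)
  define pot where "pot = potential st'"
  have n: "0 < n" using tab(2) by (simp add: n_def)
  have W: "0 < W" using n assms(3,4) by (simp add: W_def)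
  have V: "V = \<zeta> * W" by (simp add: V_def W_def n_def)
  have T: "0 < T" "T = 2 ^ length js" using len(1) by (simp_all add: T_def)
  have "\<forall>rw\<in>set tab. rw \<noteq> []" using tab(1) by (simp add: item_table_def)
  from run_history[OF this, of ks ?P st] obtain ss where
    ss: "length ss = length ks" "\<forall>s\<in>set ss. choice s tab" "snd (run ?P tab st ks) = concat ss"
        by blast
  have lss: "length ss = 2 ^ length js" using ss(1) len(1) by simp
  note R = solve_rounds[OF tab(1) ss(3,2) lss, folded s_def T(2), unfolded run snd_conv]
  note runs = run_correct[OF st t run]
  have drift: "int E * pot + 2 * int V * int (total_cost h)
      \<le> int T * (2 * int V * int (total_cost t) + 2 * int E * int W)"
    using runs(2) by (simp add: pot_def T_def W_def n_def mult.assoc)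
  have pot: "0 \<le> pot" unfolding pot_def potential_def by (intro sum_list_nonneg) auto
  have "2 * int V * int (total_cost h)
      \<le> int T * (2 * int V * int (total_cost t) + 2 * int E * int W)"
    using drift mult_nonneg_nonneg[of "int E" pot] pot by linarith
  then have "2 * int W * (int \<zeta> * int (total_cost h)) \<le>
      2 * int W * (int T * (int \<zeta> * int (total_cost t) + int E))"
    by (simp add: V algebra_simps)
  then have "int \<zeta> * int (total_cost h) \<le> int T * (int \<zeta> * int (total_cost t) + int E)"
    using W by simp
  then have ch: "\<zeta> * total_cost h \<le> T * (\<zeta> * total_cost t + E)"
    by (simp flip: of_nat_mult of_nat_add)
  have "T * (\<zeta> * total_cost s) = \<zeta> * (T * total_cost s)" by simp
  also have "\<dots> \<le> \<zeta> * total_cost h" by (intro mult_left_mono R(4)) simp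
  finally have "T * (\<zeta> * total_cost s) \<le> T * (\<zeta> * total_cost t + E)" using ch by linarith
  then show "\<zeta> * total_cost s \<le> \<zeta> * total_cost t + E" using T(1) by simp
  \<comment> \<open>Here the guess matters: the cost of \<open>t\<close> is comparable to
    \<open>E\<close>, so the factor \<open>E\<close> cancels from the bound on the
    potential.\<close>
  have "total_cost t \<le> n * E"
  proof -
    have "\<forall>e\<in>set t. item_cost e \<le> E" using choice_subset[OF t(1)] cost by blast
    then have "total_cost t \<le> length t * E" unfolding total_cost_def by (induction t) auto
    then show ?thesis using choice_length[OF t(1)] by (simp add: n_def)
  qed
  then have "int V * int (total_cost t) \<le> int V * (int n * int E)"
    by (intro mult_left_mono) (simp_all flip: of_nat_mult)
  moreover have "0 \<le> 2 * int V * int (total_cost h)" by simp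
  ultimately have "int E * pot \<le> int T * (2 * (int V * (int n * int E)) + 2 * int E * int W)"
    using drift mult_left_mono[of "2 * int V * int (total_cost t) + 2 * int E * int W"
        "2 * (int V * (int n * int E)) + 2 * int E * int W" "int T"] by linarith
  then have "int E * pot \<le> int E * (int T * (int W * (2 + 2 * int \<zeta> * int n)))"
    by (simp add: V algebra_simps)
  then have pot_le: "pot \<le> int T * (int W * (2 + 2 * int \<zeta> * int n))" using assms(5) by simp
  have queue: "n * a \<le> T * Q" if a: "(int a)\<^sup>2 \<le> pot" for a
  proof -
    have "(int (n * a))\<^sup>2 = (int n)\<^sup>2 * (int a)\<^sup>2" by (simp add: power_mult_distrib)
    also have "\<dots> \<le> (int n)\<^sup>2 * (int T * (int W * (2 + 2 * int \<zeta> * int n)))"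
      using a pot_le by (intro mult_left_mono) auto
    also have "\<dots> = int T * ((int Q)\<^sup>2 * int (iterations \<zeta> (length st) n))"
      by (simp add: W_def iterations_def power_mult_distrib algebra_simps eval_nat_numeral)
    also have "\<dots> \<le> int T * ((int Q)\<^sup>2 * int T)"
      using len(2) by (intro mult_left_mono) (simp_all add: T_def n_def)
    also have "\<dots> = (int (T * Q))\<^sup>2" by (simp add: power2_eq_square)
    finally have "int (n * a) \<le> int (T * Q)" by (rule power2_le_imp_le) simp
    then show ?thesis by (simp only: of_nat_le_iff)
  qed
  have q: "\<exists>a b. Q * cell_count K h \<le> cell_upper K * center_count K h + a \<and> n * a \<le> T * Q \<and>
      cell_lower K * center_count K h \<le> Q * cell_count K h + b \<and> n * b
          \<le> T * Q" if "K \<in> set st" for K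
  proof -
    have "fst K \<in> fst ` set st" using that by simp
    also have "fst ` set st = fst ` set st'" using arg_cong[OF runs(1), of set] by simp
    finally obtain K' where K': "K' \<in> set st'" "fst K = fst K'" by auto
    then have "cell_count K h = cell_count K' h" "center_count K h = center_count K' h"
      by (simp_all add: cell_count_def center_count_def)
    then show ?thesis
      using runs(3) K' queue potential_member[OF K'(1)]
      unfolding queue_fair_def pot_def
      by (intro exI[of _ "upper_queue K'"] exI[of _ "lower_queue K'"]) simp
  qed
  have nat_R: "T * cell_count K s \<le> cell_count K h + T" "cell_count K h \<le> T * cell_count K s + T"
    "T * center_count K s \<le> center_count K h + T" "center_count K h \<le> T * center_count K s + T"
        for K
  proof -
    have ar: "x \<le> y + z \<and> y \<le> x + z" if "\<bar>int x - int y\<bar> < int z" for x y z :: nat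
      using that by linarith
    show "T * cell_count K s \<le> cell_count K h + T" "cell_count K h \<le> T * cell_count K s + T"
      using ar[of "T * cell_count K s" "cell_count K h" T] R(2)[of K] by simp_all
    show "T * center_count K s \<le> center_count K h + T" "center_count K h \<le> T * center_count K s + T"
      using ar[of "T * center_count K s" "center_count K h" T] R(3)[of K] by simp_all
  qed
  \<comment> \<open>The condition says that \<open>U / Q\<close> is at most
    \<open>1 - 1 / n\<close>, which leaves room for the residual violation of the averaged
    rounds.\<close>
  have slack: "n * (Q + U) \<le> (2 * n - 1) * Q" if "Q \<le> n * (Q - U)" "U \<le> Q" for U
  proof -
    obtain d where "Q = U + d" using \<open>U \<le> Q\<close> le_Suc_ex by blast
    then have "n * (Q + U) + n * (Q - U) = 2 * n * Q" by (simp add: algebra_simps)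
    moreover have "(2 * n - 1) * Q = 2 * n * Q - Q" by (simp add: diff_mult_distrib)
    ultimately show ?thesis using that(1) by linarith
  qed
  have le_Q: "cell_lower K \<le> Q" "cell_upper K \<le> Q" if "K \<in> set st" for K
    using st that by (auto simp: initial_def)
  \<comment> \<open>In the remaining case a cluster, having at most \<open>n\<close> points, exceeds
    the upper bound by at most 1 even if it is monochromatic.\<close>
  have small: "(Q - U) * center_count K s \<le> Q" if "n * (Q - U) < Q" for K U
  proof -
    have "center_count K s \<le> n" using count_le(2)[of K s] choice_length[OF R(1)]
        by (simp add: n_def)
    then have "center_count K s * (Q - U) \<le> n * (Q - U)" by (intro mult_right_mono) simp_all
    then show ?thesis using that mult.commute[of "Q - U" "center_count K s"] by linarith
  qed
  show "Q * cell_count K s \<le> cell_upper K * center_count K s + 2 * Q" if K: "K \<in> set st"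
  proof (cases "Q \<le> n * (Q - cell_upper K)")
    case True
    obtain a where "Q * cell_count K h \<le> cell_upper K * center_count K h + a" "n * a \<le> T * Q"
      using q[OF K] by blast
    then show ?thesis
      using rounding_slack[OF n T(1) _ nat_R(1,4)] slack[OF True] le_Q[OF K] by blast
  next
    case False
    have "Q * cell_count K s \<le> Q * center_count K s" by (intro mult_left_mono count_le) simp
    also have "\<dots> = cell_upper K * center_count K s + (Q - cell_upper K) * center_count K s"
      using le_Q[OF K] by (simp flip: distrib_right)
    also have "\<dots> \<le> cell_upper K * center_count K s + Q" using False small by simp
    finally show ?thesis by simp
  qed
  show "cell_lower K * center_count K s \<le> Q * cell_count K s + 2 * Q"
    if K: "K \<in> set st" and alt: "Q \<le> length tab * (Q - cell_lower K) \<or> cell_count K s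
        = center_count K s"
    using alt
  proof
    assume "Q \<le> length tab * (Q - cell_lower K)"
    then have sl: "n * (cell_lower K + Q) \<le> (2 * n - 1) * Q"
      using slack[of "cell_lower K"] le_Q[OF K] by (simp add: n_def add.commute)
    obtain b where "cell_lower K * center_count K h \<le> Q * cell_count K h + b" "n * b \<le> T * Q"
      using q[OF K] by blast
    then show ?thesis using rounding_slack[OF n T(1) _ nat_R(3,2)] sl by blast
  next
    assume "cell_count K s = center_count K s"
    then show ?thesis using le_Q[OF K] by (simp add: mult_right_mono trans_le_add1)
  qed
qed

section \<open>Guessing the largest cost in the comparison assignment\<close>

lemma allowed_eq_filter: "\<exists>P. allowed D rw = filter P rw"
proof (cases "filter (\<lambda>e. item_cost e \<le> D) rw")
  case Nil
  then show ?thesis by (intro exI[of _ "\<lambda>_. True"]) (simp add: allowed_def)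
next
  case (Cons e es)
  then show ?thesis by (intro exI[of _ "\<lambda>e. item_cost e \<le> D"]) (simp add: allowed_def)
qed

lemma allowed_subset: "set (allowed D rw) \<subseteq> set rw"
  using allowed_eq_filter[of D rw] by auto

lemma item_table_allowed:
  assumes "item_table tab"
  shows "item_table (map (allowed D) tab)"
proof -
  have "distinct (concat (map (allowed D) tab))" if "distinct (concat tab)"
    using that
  proof (induction tab)
    case (Cons rw tab)
    have "set (concat (map (allowed D) tab)) \<subseteq> set (concat tab)" using allowed_subset by fastforce
    moreover have "distinct (allowed D rw)"
      using allowed_eq_filter[of D rw] Cons.prems by (auto intro: distinct_filter)
    ultimately show ?case using Cons allowed_subset[of D rw] by auto
  qed simp
  moreover have "allowed D rw \<noteq> []" if "rw \<noteq> []" for rw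
    using that by (auto simp: allowed_def split: list.split)
  moreover have "item_point e = i" if "i < length tab" "e \<in> set (allowed D (tab ! i))" for i e
    using that allowed_subset[of D "tab ! i"] assms by (auto simp: item_table_def)
  ultimately show ?thesis using assms by (auto simp: item_table_def)
qed

lemma choice_allowed: "choice s (map (allowed D) tab) \<Longrightarrow> choice s tab"
  using allowed_subset by (fastforce simp: choice_def list_all2_conv_all_nth)

text \<open>The cost \<open>D\<close> of the most expensive item of \<open>t\<close> is among the
  guesses, and \<open>t\<close> survives the restriction to items of cost at most \<open>D\<close>.
  As \<open>D\<close> is at most the cost of \<open>t\<close>, the additive error turns into the
  factor \<open>1 + 1 / \<zeta>\<close>.\<close>

lemma best_candidate_correct:
  fixes Q \<zeta> :: nat
  assumes tab: "item_table tab" "tab \<noteq> []" and "st \<noteq> []" "0 < Q" "2 \<le> \<zeta>"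
    and st: "initial Q st"
    and t: "choice t tab" "fair Q st t"
    and mono: "\<forall>K\<in>set st. Q \<le> length tab * (Q - cell_lower K) \<or>
      (\<forall>e\<in>set (concat tab). item_color e = cell_color K)"
  defines "s \<equiv> best_candidate \<zeta> Q tab st"
  shows "choice s tab" "nearly_fair Q st s" "\<zeta> * total_cost s \<le> (\<zeta> + 1) * total_cost t"
proof -
  define N where "N = iterations \<zeta> (length st) (length tab)"
  define V where "V = \<zeta> * length st * (Q * length tab) ^ 2"
  define ks where "ks = replicate (2 ^ blen N) ()"
  define cand where "cand D = solve (Q, (V, if D = 0 then 1
      else D)) (map (allowed D) tab) st ks (bits N)" for D
  have cands: "candidates \<zeta> Q tab st = map cand (map item_cost (concat tab))"
    unfolding candidates_def Let_def cand_def N_def V_def ks_def by simp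
  have choice: "choice (cand D) tab" for D
    unfolding cand_def
    by (rule choice_allowed, rule solve_choice[OF item_table_allowed[OF tab(1)]]) (simp add: ks_def)
  have lt: "length t = length tab" using choice_length[OF t(1)] .
  then have "t \<noteq> []" using tab(2) by auto
  define D where "D = Max (item_cost ` set t)"
  have "D \<in> item_cost ` set t" unfolding D_def using \<open>t \<noteq> []\<close> by (intro Max_in) auto
  then obtain d where d: "d \<in> set t" "D = item_cost d" by blast
  have le_D: "item_cost e \<le> D" if "e \<in> set t" for e
    unfolding D_def using that by (intro Max_ge) auto
  have D_cost: "D \<le> total_cost t"
    unfolding d(2) total_cost_def using d(1) by (intro member_le_sum_list) auto
  let ?tab = "map (allowed D) tab" let ?E = "if D = 0 then 1 else D"
  have al: "t ! i \<in> set (allowed D (tab ! i)) \<and> (\<forall>e\<in>set (allowed D (tab ! i)). item_cost e \<le> D)"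
    if "i < length tab" for i
  proof -
    have ti: "t ! i \<in> set (filter (\<lambda>e. item_cost e \<le> D) (tab ! i))"
      using t(1) that le_D[of "t ! i"] lt by (auto simp: choice_def list_all2_conv_all_nth)
    then have "allowed D (tab ! i) = filter (\<lambda>e. item_cost e \<le> D) (tab ! i)"
      by (cases "filter (\<lambda>e. item_cost e \<le> D) (tab ! i)") (auto simp: allowed_def)
    then show ?thesis using ti by simp
  qed
  have t': "choice t ?tab" using al lt by (auto simp: choice_def list_all2_conv_all_nth)
  have cost: "\<forall>e\<in>set (concat ?tab). item_cost e \<le> D"
  proof
    fix e assume "e \<in> set (concat ?tab)"
    then obtain rw where "rw \<in> set tab" "e \<in> set (allowed D rw)" by auto
    then show "item_cost e \<le> D" using al by (metis in_set_conv_nth)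
  qed
  then have cost': "\<forall>e\<in>set (concat ?tab). item_cost e \<le> ?E"
  proof (intro ballI)
    fix e assume "e \<in> set (concat ?tab)"
    with cost have "item_cost e \<le> D" by blast
    then show "item_cost e \<le> ?E" by simp
  qed
  have N: "iterations \<zeta> (length st) (length ?tab) \<le> length ks"
    using less_exp_blen[of N] by (simp add: N_def ks_def)
  have pos: "0 < ?E" "0 < \<zeta>" "?tab \<noteq> []" "length ks = 2 ^ length (bits N)"
    using assms(5) tab(2) by (auto simp: ks_def)
  have lens: "length ?tab = length tab" by simp
  note S = solve_correct[OF item_table_allowed[OF tab(1)] pos(3) assms(3,4) pos(1,2) st t' t(2)
      cost' pos(4) N,
      unfolded lens, folded V_def, folded cand_def]
  have "cell_count K (cand D) = center_count K (cand D)"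
    if "\<forall>e\<in>set (concat tab). item_color e = cell_color K" for K
    using choice_subset[OF choice[of D]] that
    unfolding cell_count_def center_count_def by (intro arg_cong[of _ _ length] filter_cong) auto
  then have "nearly_fair Q st (cand D)"
    unfolding nearly_fair_def using S(2,3) mono by blast
  moreover have "cand D \<in> set (candidates \<zeta> Q tab st)"
    unfolding cands using d choice_subset[OF t(1)] by auto
  ultimately have mem: "cand D \<in> set (filter (nearly_fair Q st) (candidates \<zeta> Q tab st))" by simp
  then obtain u us where us: "filter (nearly_fair Q st) (candidates \<zeta> Q tab st) = u # us"
    by (cases "filter (nearly_fair Q st) (candidates \<zeta> Q tab st)") auto
  then have s: "s = least_by (\<lambda>s. (total_cost s, 0)) u us" by (simp add: s_def best_candidate_def)
  then have "s \<in> set (filter (nearly_fair Q st) (candidates \<zeta> Q tab st))"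
    unfolding us by (simp only: least_by_in)
  then show "nearly_fair Q st s" "choice s tab" using choice unfolding cands by auto
  have "total_cost s \<le> total_cost (cand D)"
    using least_by_le[of "cand D" u us "\<lambda>s. (total_cost s, 0)"] mem unfolding us s by simp
  then have "\<zeta> * total_cost s \<le> \<zeta> * total_cost (cand D)" by (intro mult_left_mono) simp_all
  also have "\<dots> \<le> (\<zeta> + 1) * total_cost t"
  \<comment> \<open>For \<open>D = 0\<close> the additive error would be governed by the replacement
    value 1, but then all allowed items are free and the candidate costs nothing.\<close>
  proof (cases "D = 0")
    case True
    have "choice (cand D) ?tab"
      unfolding cand_def by (rule solve_choice[OF item_table_allowed[OF tab(1)] pos(4)])
    then have "set (cand D) \<subseteq> set (concat ?tab)" by (rule choice_subset)
    then have "\<forall>e\<in>set (cand D). item_cost e = 0" using cost True by auto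
    then have "total_cost (cand D) = 0" by (simp add: total_cost_def)
    then show ?thesis by simp
  next
    case False
    then show ?thesis using S(1) D_cost by simp
  qed
  finally show "\<zeta> * total_cost s \<le> (\<zeta> + 1) * total_cost t" .
qed

section \<open>From instances to tables\<close>

definition raw :: "dc_instance \<Rightarrow> raw_instance" where
  "raw I =
    ((map (\<lambda>p. map (\<lambda>q. quotient_of (distance I p q)) [0..<num_points I]) [0..<num_points I],
      max_clusters I, map (color I) [0..<num_points I],
      map (\<lambda>h. (center_lower I h, center_upper I h)) [0..<num_colors I]),
     map (\<lambda>h. (quotient_of (group_lower I h), quotient_of (group_upper I h))) [0..<num_colors I])"

lemma enc_list_map: "(\<And>x. f x = encode (g x)) \<Longrightarrow> enc_list f xs = encode (map g xs)"
  by (simp add: encode_list_def enc_list_def comp_def foldr_map)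

lemma enc_rat_eq: "enc_rat r = encode (quotient_of r)"
  by (simp add: enc_rat_def encode_prod_def encode_int_def split: prod.split)

text \<open>The input tree is already the encoding of nested lists and pairs, so polynomial-time
  functions on \<open>raw_instance\<close> apply to it directly.\<close>

lemma encode_raw: "enc_dc_instance I = encode (raw I)"
proof -
  have "enc_list (\<lambda>p. enc_list (\<lambda>q. enc_rat (distance I p q)) [0..<num_points I]) [0..<num_points I]
      =
      encode (map (\<lambda>p. map (\<lambda>q. quotient_of (distance I p q)) [0..<num_points I])
          [0..<num_points I])"
    by (intro enc_list_map enc_rat_eq)
  moreover have "enc_list (\<lambda>p. enc_nat (color I p)) [0..<num_points I] =
      encode (map (color I) [0..<num_points I])"
    by (intro enc_list_map) (simp add: encode_nat_def)
  moreover have "enc_list (\<lambda>h. Node (enc_int (center_lower I h)) (enc_int (center_upper I h)))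
      [0..<num_colors I] =
      encode (map (\<lambda>h. (center_lower I h, center_upper I h)) [0..<num_colors I])"
    by (intro enc_list_map) (simp add: encode_int_def)
  moreover have "enc_list (\<lambda>h. Node (enc_rat (group_lower I h)) (enc_rat (group_upper I h)))
      [0..<num_colors I] =
      encode (map (\<lambda>h. (quotient_of (group_lower I h), quotient_of (group_upper I h)))
          [0..<num_colors I])"
    by (intro enc_list_map) (simp add: enc_rat_eq)
  ultimately show ?thesis
    by (simp add: enc_dc_instance_def enc_ds_instance_def raw_def encode_nat_def)
qed

lemma encode_clustering:
  "enc_clustering I S = encode (sorted_list_of_set (fst S), map (snd S) [0..<num_points I])"
proof -
  have "enc_list enc_nat (sorted_list_of_set (fst S)) = encode (sorted_list_of_set (fst S))"
    by (simp add: encode_list_def encode_nat_def)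
  moreover have "enc_list (\<lambda>p. enc_nat (snd S p)) [0..<num_points I]
      = encode (map (snd S) [0..<num_points I])"
    by (intro enc_list_map) (simp add: encode_nat_def)
  ultimately show ?thesis by (simp add: enc_clustering_def)
qed

lemma denom_pos: "0 < denom (quotient_of x)"
  using quotient_of_denom_pos'[of x] by (simp add: denom_def)

text \<open>Each denominator divides the product, so the division in \<open>scale\<close> is
  exact.\<close>

lemma scale_correct:
  assumes "0 \<le> x" "denom (quotient_of x) \<in> set ds"
  shows "real (scale ds (quotient_of x)) = real (prod_list ds) * real_of_rat x"
proof -
  obtain a b where ab: "quotient_of x = (a, b)" by (metis prod.exhaust)
  then have b: "0 < b" and x: "x = of_int a / of_int b"
    using quotient_of_denom_pos quotient_of_div by blast+
  then have a: "0 \<le> a" using assms(1) by (simp add: zero_le_divide_iff)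
  have "k \<in> set ks \<Longrightarrow> k dvd prod_list ks" for k and ks :: "nat list"
    by (induction ks) auto
  then have "nat b dvd prod_list ds" using assms(2) ab b by (simp add: denom_def)
  then have "real (prod_list ds div nat b) = real (prod_list ds) / real (nat b)"
    by (rule real_of_nat_div)
  moreover have "scale ds (quotient_of x) = nat a * (prod_list ds div nat b)"
    using ab a b \<open>nat b dvd prod_list ds\<close> by (simp add: scale_def denom_def div_mult_swap)
  ultimately show ?thesis using a b x by (simp add: of_rat_divide)
qed

lemma zip_map_self: "zip xs (map f xs) = map (\<lambda>x. (x, f x)) xs"
  by (induction xs) auto

lemma prod_list_pos: "\<forall>k\<in>set ks. 0 < k \<Longrightarrow> 0 < prod_list (ks :: nat list)"
  by (induction ks) auto

text \<open>\<open>S\<^sub>0\<close> stands for the output of the given algorithm and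
  \<open>S\<^sub>f\<close> for an optimal fair clustering. The latter enters the analysis only; the
  algorithm never sees it.\<close>

locale reassignment =
  fixes I :: dc_instance and S\<^sub>0 S\<^sub>f :: clustering and q \<zeta> :: nat
  assumes valid: "valid_dc_instance I" and S0: "S\<^sub>0 \<in> ds_solutions I"
      and Sf: "S\<^sub>f \<in> dc_solutions 0 I"
    and zeta: "2 \<le> \<zeta>"
begin

abbreviation n :: nat where "n \<equiv> num_points I"
abbreviation d :: "nat \<Rightarrow> nat \<Rightarrow> real" where "d p c \<equiv> real_of_rat (distance I p c)"
abbreviation C :: "nat set" where "C \<equiv> fst S\<^sub>0"

definition dens :: "nat list" where
  "dens = map denom (concat (fst (fst (raw I))))"

definition w :: "nat \<Rightarrow> nat \<Rightarrow> nat" where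
  "w p c = scale dens (quotient_of (distance I p c)) ^ q"

definition item :: "nat \<Rightarrow> nat \<Rightarrow> item" where
  "item p c = (p, color I p, c, w p c)"

definition tab :: "item list list" where
  "tab = map (\<lambda>p. map (item p) (filter (\<lambda>c. c \<in> C) [0..<n])) [0..<n]"

definition fdens :: "nat list" where
  "fdens = fair_denoms (snd (raw I))"

definition Q :: nat where "Q = prod_list fdens"

definition lower :: "nat \<Rightarrow> nat" where "lower h = scale fdens (quotient_of (group_lower I h))"
definition upper :: "nat \<Rightarrow> nat" where "upper h = scale fdens (quotient_of (group_upper I h))"

definition cells :: "cell list" where
  "cells = concat (map (\<lambda>h. map (\<lambda>c. (((h, c), (lower h, upper h)), (0, 0))) (sorted_list_of_set C))
      [0..<num_colors I])"

definition assignment :: "(nat \<Rightarrow> nat) \<Rightarrow> item list" where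
  "assignment \<phi> = map (\<lambda>p. item p (\<phi> p)) [0..<n]"

lemma metric: "Metric_space (points I) d"
  using valid by (simp add: valid_dc_instance_def valid_ds_instance_def)

lemma n_pos: "0 < n"
  using valid by (simp add: valid_dc_instance_def valid_ds_instance_def)

lemma C: "C \<subseteq> points I" "finite C" "snd S\<^sub>0 \<in> points I \<rightarrow>\<^sub>E C"
proof -
  show "C \<subseteq> points I" "snd S\<^sub>0 \<in> points I \<rightarrow>\<^sub>E C"
    using S0 by (auto simp: ds_solutions_def clusterings_def)
  then show "finite C" using finite_subset by blast
qed

lemma C_nonempty: "C \<noteq> {}"
proof -
  have "snd S\<^sub>0 0 \<in> C" using C(3) n_pos by auto
  then show ?thesis by auto
qed

lemma set_centers: "set (sorted_list_of_set C) = C"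
  using C(2) by simp

lemma tab_eq:
  "all_rows q (fst (fst (raw I))) (fst (snd (snd (fst (raw I))))) (sorted_list_of_set C) = tab"
proof -
  have len: "length (map (color I) [0..<n]) = n" by simp
  have "zip [0..<n] (zip (map (color I) [0..<n])
      (map (\<lambda>p. map (\<lambda>q. quotient_of (distance I p q)) [0..<n]) [0..<n])) =
      map (\<lambda>p. (p, (color I p, map (\<lambda>q. quotient_of (distance I p q)) [0..<n]))) [0..<n]"
    by (simp add: zip_map_map zip_same_conv_map zip_map_self)
  moreover have "(\<exists>c\<in>set (sorted_list_of_set C). c = c') \<longleftrightarrow> c' \<in> C" for c'
    using set_centers by auto
  ultimately show ?thesis
    unfolding all_rows_def tab_def Let_def
    by (simp add: raw_def zip_map_self filter_map comp_def item_def w_def dens_def)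
qed

lemma cells_eq: "all_cells (snd (raw I)) (sorted_list_of_set C) = cells"
  unfolding all_cells_def cells_def Let_def
  by (simp add: raw_def zip_map_self comp_def lower_def upper_def fdens_def)

lemma w_real: "p < n \<Longrightarrow> c < n \<Longrightarrow> real (w p c) = (real (prod_list dens) * d p c) ^ q"
proof -
  assume "p < n" "c < n"
  then have "denom (quotient_of (distance I p c)) \<in> set dens"
    by (auto simp: dens_def raw_def intro!: imageI bexI[of _ p])
  moreover have "0 \<le> distance I p c"
    using Metric_space.nonneg[OF metric, of p c] by (simp add: zero_le_of_rat_iff)
  ultimately show ?thesis by (simp add: w_def scale_correct)
qed

lemma prod_dens_pos: "0 < prod_list dens"
proof -
  have "\<forall>k\<in>set dens. 0 < k" using denom_pos by (auto simp: dens_def raw_def)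
  then show ?thesis by (rule prod_list_pos)
qed

lemma Q_pos: "0 < Q"
proof -
  have "\<forall>k\<in>set fdens. 0 < k" using denom_pos by (auto simp: fdens_def fair_denoms_def raw_def)
  then show ?thesis unfolding Q_def by (rule prod_list_pos)
qed

lemma bounds_real:
  assumes "h < num_colors I"
  shows "real (lower h) = real Q * real_of_rat (group_lower I h)"
    "real (upper h) = real Q * real_of_rat (group_upper I h)" "lower h \<le> Q" "upper h \<le> Q"
proof -
  have g: "0 \<le> group_lower I h" "group_lower I h \<le> group_upper I h" "group_upper I h \<le> 1"
    using valid assms by (auto simp: valid_dc_instance_def)
  have "denom (quotient_of (group_lower I h)) \<in> set fdens"
      "denom (quotient_of (group_upper I h)) \<in> set fdens"
    using assms by (auto simp: fdens_def fair_denoms_def raw_def)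
  then show *: "real (lower h) = real Q * real_of_rat (group_lower I h)"
    "real (upper h) = real Q * real_of_rat (group_upper I h)"
    using g by (simp_all add: lower_def upper_def Q_def scale_correct)
  have "real_of_rat (group_lower I h) \<le> 1" "real_of_rat (group_upper I h) \<le> 1"
    using g by (auto simp: of_rat_le_1_iff)
  then have "real (lower h) \<le> real Q" "real (upper h) \<le> real Q"
    unfolding * using mult_left_le[of _ "real Q"] by auto
  then show "lower h \<le> Q" "upper h \<le> Q" by simp_all
qed

lemma item_table_tab: "item_table tab"
proof -
  have "concat (map (\<lambda>p. map (item p) cs) ps) = map (\<lambda>z. item (fst z) (snd z)) (List.product ps cs)"
      for ps cs
    by (induction ps) (auto simp: comp_def)
  moreover have "inj_on (\<lambda>z. item (fst z) (snd z)) A" for A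
    by (auto simp: inj_on_def item_def)
  ultimately have "distinct (concat tab)"
    unfolding tab_def by (simp add: distinct_map distinct_product)
  moreover have "filter (\<lambda>c. c \<in> C) [0..<n] \<noteq> []"
    using C(1) C_nonempty by (auto simp: filter_empty_conv)
  ultimately show ?thesis by (auto simp: item_table_def tab_def item_def)
qed

lemma choice_assignment: "\<phi> \<in> points I \<rightarrow> C \<Longrightarrow> choice (assignment \<phi>) tab"
  unfolding choice_def assignment_def tab_def using C(1)
  by (auto simp: list_all2_conv_all_nth)

lemma choice_imp_assignment:
  assumes "choice s tab"
  obtains \<phi> where "\<phi> \<in> points I \<rightarrow>\<^sub>E C" "s = assignment \<phi>"
proof -
  let ?f = "restrict (\<lambda>p. item_center (s ! p)) (points I)"
  have len: "length s = n" using choice_length[OF assms] by (simp add: tab_def)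
  have "s ! p \<in> item p ` C" if "p < n" for p
    using assms that len by (auto simp: choice_def tab_def list_all2_conv_all_nth)
  then have p: "item_center (s ! p) \<in> C" "s ! p = item p (item_center (s ! p))" if "p < n" for p
    using that by (auto simp: item_def dest!: meta_spec[of _ p])
  have "s = assignment ?f"
    unfolding assignment_def using len p(2) by (intro nth_equalityI) simp_all
  moreover have "?f \<in> points I \<rightarrow>\<^sub>E C" using p(1) by auto
  ultimately show ?thesis by (rule that[rotated])
qed

lemma counts_assignment:
  "center_count K (assignment \<phi>) = card {p \<in> points I. \<phi> p = cell_center K}"
  "cell_count K (assignment \<phi>) = card ({p \<in> points I. \<phi> p
      = cell_center K} \<inter> color_class I (cell_color K))"
proof -
  have *: "length (filter P (map f [0..<n])) = card {p \<in> points I. P (f p)}" for P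
      and f :: "nat \<Rightarrow> item"
    by (subst length_filter_conv_card) (auto intro: arg_cong[of _ _ card])
  show "center_count K (assignment \<phi>) = card {p \<in> points I. \<phi> p = cell_center K}"
    unfolding center_count_def assignment_def * by (simp add: item_def)
  have "{p \<in> points I. \<phi> p = cell_center K} \<inter> color_class I (cell_color K) =
      {p \<in> points I. color I p = cell_color K \<and> \<phi> p = cell_center K}"
    by (auto simp: color_class_def)
  then show "cell_count K (assignment \<phi>)
      = card ({p \<in> points I. \<phi> p = cell_center K} \<inter> color_class I (cell_color K))"
    unfolding cell_count_def assignment_def * by (simp add: item_def)
qed

lemma cost_assignment:
  assumes "\<phi> \<in> points I \<rightarrow> C"
  shows "real (total_cost (assignment \<phi>))
      = real (prod_list dens) ^ q * (\<Sum>p\<in>points I. d p (\<phi> p) ^ q)"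
proof -
  have "real (total_cost (assignment \<phi>)) = (\<Sum>p\<in>points I. real (w p (\<phi> p)))"
    by (simp add: total_cost_def assignment_def item_def comp_def interv_sum_list_conv_sum_set_nat
        atLeast0LessThan)
  also have "\<dots> = (\<Sum>p\<in>points I. real (prod_list dens) ^ q * d p (\<phi> p) ^ q)"
    using assms C(1) by (intro sum.cong) (auto simp: w_real power_mult_distrib Pi_iff)
  finally show ?thesis by (simp add: sum_distrib_left)
qed

lemma in_cells:
  "K \<in> set cells \<longleftrightarrow> (\<exists>h<num_colors I. \<exists>c\<in>C. K = (((h, c), (lower h, upper h)), (0, 0)))"
  unfolding cells_def using set_centers by auto

definition nearest :: "nat \<Rightarrow> nat" where
  "nearest c = (ARG_MIN (d c) c'. c' \<in> C)"

lemma nearest: "nearest c \<in> C" "c' \<in> C \<Longrightarrow> d c (nearest c) \<le> d c c'"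
  using arg_min_if_finite[OF C(2) C_nonempty, of "d c"]
      arg_min_least[OF C(2) C_nonempty, of _ "d c"]
  by (auto simp: nearest_def arg_min_on_def)

lemma Sf_map: "snd S\<^sub>f \<in> points I \<rightarrow> fst S\<^sub>f" "fst S\<^sub>f \<subseteq> points I"
  using Sf by (auto simp: dc_solutions_def ds_solutions_def clusterings_def)

text \<open>The center \<open>snd S\<^sub>0 p\<close> competes in the choice of the center nearest
  to \<open>snd S\<^sub>f p\<close>; two triangle inequalities do the rest.\<close>

lemma nearest_dist:
  assumes "p \<in> points I"
  shows "d p (nearest (snd S\<^sub>f p)) \<le> 2 * d p (snd S\<^sub>f p) + d p (snd S\<^sub>0 p)"
proof -
  interpret M: Metric_space "points I" d by (rule metric)
  let ?c = "snd S\<^sub>f p"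
  have in_pts: "?c \<in> points I" "snd S\<^sub>0 p \<in> C" "snd S\<^sub>0 p \<in> points I" "nearest ?c \<in> points I"
    using Sf_map assms C(1,3) nearest(1) by blast+
  have "d p (nearest ?c) \<le> d p ?c + d ?c (nearest ?c)"
    using M.triangle assms in_pts by blast
  also have "d ?c (nearest ?c) \<le> d ?c (snd S\<^sub>0 p)" by (rule nearest(2)[OF in_pts(2)])
  also have "d ?c (snd S\<^sub>0 p) \<le> d ?c p + d p (snd S\<^sub>0 p)"
    using M.triangle assms in_pts by blast
  also have "d ?c p = d p ?c" by (rule M.commute)
  finally show ?thesis by simp
qed

lemma Sf_fair:
  assumes "c \<in> fst S\<^sub>f" "h < num_colors I"
  shows "real_of_rat (group_lower I h) * real (card (cluster I S\<^sub>f c))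
      \<le> real (card (cluster I S\<^sub>f c \<inter> color_class I h))"
    "real (card (cluster I S\<^sub>f c \<inter> color_class I h))
        \<le> real_of_rat (group_upper I h) * real (card (cluster I S\<^sub>f c))"
proof -
  have "group_lower I h * of_nat (card (cluster I S\<^sub>f c))
      \<le> of_nat (card (cluster I S\<^sub>f c \<inter> color_class I h))"
    "of_nat (card (cluster I S\<^sub>f c \<inter> color_class I h))
        \<le> group_upper I h * of_nat (card (cluster I S\<^sub>f c))"
    using Sf assms by (auto simp: dc_solutions_def group_fair_def)
  from this[THEN of_rat_less_eq[where 'a = real, THEN iffD2]]
  show "real_of_rat (group_lower I h) * real (card (cluster I S\<^sub>f c))
      \<le> real (card (cluster I S\<^sub>f c \<inter> color_class I h))"
    "real (card (cluster I S\<^sub>f c \<inter> color_class I h))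
        \<le> real_of_rat (group_upper I h) * real (card (cluster I S\<^sub>f c))"
    by (simp_all add: of_rat_mult)
qed

text \<open>Moving each fair cluster as a whole to the nearest center keeps the clusters fair.\<close>

lemma fair_nearest: "fair Q cells (assignment (\<lambda>p. nearest (snd S\<^sub>f p)))"
  unfolding fair_def
proof
  fix K assume "K \<in> set cells"
  then obtain h c where K: "h < num_colors I" "c \<in> C" "K = (((h, c), (lower h, upper h)), (0, 0))"
    using in_cells by auto
  let ?A = "{c' \<in> fst S\<^sub>f. nearest c' = c}"
  have fin: "finite ?A" using Sf_map(2) by (auto intro: finite_subset)
  have eq: "{p \<in> points I. nearest (snd S\<^sub>f p) = c} = (\<Union>c'\<in>?A. cluster I S\<^sub>f c')"
    using Sf_map(1) by (auto simp: cluster_def)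
  have disj: "disjoint_family_on (cluster I S\<^sub>f) ?A"
      by (auto simp: disjoint_family_on_def cluster_def)
  have 1: "real (card {p \<in> points I. nearest (snd S\<^sub>f p) = c})
      = (\<Sum>c'\<in>?A. real (card (cluster I S\<^sub>f c')))"
    unfolding eq using fin disj
    by (subst card_UN_disjoint) (auto simp: disjoint_family_on_def cluster_def)
  have 2: "real (card ({p \<in> points I. nearest (snd S\<^sub>f p) = c} \<inter> color_class I h)) =
      (\<Sum>c'\<in>?A. real (card (cluster I S\<^sub>f c' \<inter> color_class I h)))"
    unfolding eq UN_extend_simps using fin
    by (subst card_UN_disjoint) (auto simp: cluster_def)
  have "real_of_rat (group_lower I h) * real (card {p \<in> points I. nearest (snd S\<^sub>f p) = c})
      \<le> real (card ({p \<in> points I. nearest (snd S\<^sub>f p) = c} \<inter> color_class I h))"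
    unfolding 1 2 sum_distrib_left by (intro sum_mono Sf_fair(1) K(1)) auto
  moreover have "real (card ({p \<in> points I. nearest (snd S\<^sub>f p) = c} \<inter> color_class I h))
      \<le> real_of_rat (group_upper I h) * real (card {p \<in> points I. nearest (snd S\<^sub>f p) = c})"
    unfolding 1 2 sum_distrib_left by (intro sum_mono Sf_fair(2) K(1)) auto
  ultimately have
    "real (upper h) * real (card {p \<in> points I. nearest (snd S\<^sub>f p) = c})
      \<ge> real Q * real (card ({p \<in> points I. nearest (snd S\<^sub>f p) = c} \<inter> color_class I h))"
    "real (lower h) * real (card {p \<in> points I. nearest (snd S\<^sub>f p) = c})
      \<le> real Q * real (card ({p \<in> points I. nearest (snd S\<^sub>f p) = c} \<inter> color_class I h))"
    unfolding bounds_real(1,2)[OF K(1)] mult.assoc by (intro mult_left_mono; simp)+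
  then show "Q * cell_count K (assignment (\<lambda>p. nearest (snd S\<^sub>f p))) \<le>
      cell_upper K * center_count K (assignment (\<lambda>p. nearest (snd S\<^sub>f p))) \<and>
      cell_lower K * center_count K (assignment (\<lambda>p. nearest (snd S\<^sub>f p))) \<le>
      Q * cell_count K (assignment (\<lambda>p. nearest (snd S\<^sub>f p)))"
    unfolding counts_assignment K(3) by (simp flip: of_nat_mult)
qed

text \<open>A lower bound above \<open>1 - 1 / n\<close> forces,
    by integrality, every fair cluster to be monochromatic.\<close>

lemma near_one_lower:
  assumes "h < num_colors I" "\<not> Q \<le> n * (Q - lower h)" "p \<in> points I"
  shows "color I p = h"
proof -
  let ?l = "real_of_rat (group_lower I h)"
  let ?A = "cluster I S\<^sub>f (snd S\<^sub>f p)"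
  have "real (n * (Q - lower h)) < real Q" using assms(2) by (simp only: of_nat_less_iff not_le)
  then have "real n * (real Q - real (lower h)) < real Q"
    using bounds_real(3)[OF assms(1)] by (simp add: of_nat_diff)
  then have "real Q * (real n * (1 - ?l)) < real Q * 1"
    unfolding bounds_real(1)[OF assms(1)] by (simp add: algebra_simps)
  then have l: "real n * (1 - ?l) < 1" using Q_pos by simp
  have A: "finite ?A" "card ?A \<le> n"
    using card_mono[of "points I" ?A] by (auto simp: cluster_def)
  have "real Q * ?l \<le> real Q * 1"
    using of_nat_mono[OF bounds_real(3)[OF assms(1)], where 'a = real] bounds_real(1)[OF assms(1)]
        by simp
  then have "?l \<le> 1" using Q_pos by simp
  then have "real (card ?A) * (1 - ?l) \<le> real n * (1 - ?l)"
    using A(2) by (intro mult_right_mono) auto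
  moreover have "snd S\<^sub>f p \<in> fst S\<^sub>f" using Sf_map(1) assms(3) by blast
  note Sf_fair(1)[OF this assms(1)]
  ultimately have "real (card ?A) < real (card (?A \<inter> color_class I h)) + 1"
    using l by (simp add: algebra_simps)
  then have "card ?A \<le> card (?A \<inter> color_class I h)" by simp
  then have "?A \<inter> color_class I h = ?A" using A(1) by (intro card_seteq) auto
  moreover have "p \<in> ?A" using assms(3) by (simp add: cluster_def)
  ultimately show ?thesis by (auto simp: color_class_def)
qed

lemma reassign_correct:
  shows "\<exists>S\<in>dc_solutions 2 I.
    encode (reassign q \<zeta> (raw I, sorted_list_of_set C, map (snd S\<^sub>0) [0..<n])) = enc_clustering I S
        \<and>
    real \<zeta> * (\<Sum>p\<in>points I. d p (snd S p) ^ q) \<le>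
      (real \<zeta> + 1) * (\<Sum>p\<in>points I. (2 * d p (snd S\<^sub>f p) + d p (snd S\<^sub>0 p)) ^ q)"
proof -
  define s where "s = best_candidate \<zeta> Q tab cells"
  let ?x = "\<lambda>p. nearest (snd S\<^sub>f p)"
  have x: "?x \<in> points I \<rightarrow> C" using nearest(1) by blast
  have r: "reassign q \<zeta> (raw I, sorted_list_of_set C, map (snd S\<^sub>0) [0..<n]) =
      (sorted_list_of_set C, map item_center s)"
    unfolding reassign_def s_def Q_def fdens_def fst_conv snd_conv tab_eq cells_eq ..
  have m: "0 < num_colors I"
    using valid n_pos by (auto simp: valid_dc_instance_def valid_ds_instance_def Pi_iff)
  have "cells \<noteq> []"
  proof -
    obtain c where "c \<in> C" using C_nonempty by blast
    then show ?thesis using m in_cells by (metis empty_iff list.set(1))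
  qed
  moreover have "tab \<noteq> []" using n_pos by (simp add: tab_def)
  moreover have "initial Q cells"
    using in_cells bounds_real(3,4) by (auto simp: initial_def)
  \<comment> \<open>Lower bounds too close to 1 for the rounding argument occur only if all points
    have the color in question.\<close>
  moreover have "\<forall>K\<in>set cells. Q \<le> length tab * (Q - cell_lower K) \<or>
      (\<forall>e\<in>set (concat tab). item_color e = cell_color K)"
    using in_cells near_one_lower by (auto simp: tab_def item_def)
  ultimately have B: "choice s tab" "nearly_fair Q cells s"
    "\<zeta> * total_cost s \<le> (\<zeta> + 1) * total_cost (assignment ?x)"
    using best_candidate_correct[OF item_table_tab _ _ Q_pos zeta _ choice_assignment[OF x]
        fair_nearest]
    unfolding s_def by blast+
  obtain \<phi> where phi: "\<phi> \<in> points I \<rightarrow>\<^sub>E C" "s = assignment \<phi>"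
    using choice_imp_assignment[OF B(1)] .
  then have phi': "\<phi> \<in> points I \<rightarrow> C" by auto
  have "map item_center s = map \<phi> [0..<n]" by (simp add: phi(2) assignment_def item_def)
  then have enc: "encode (reassign q \<zeta> (raw I, sorted_list_of_set C, map (snd S\<^sub>0) [0..<n]))
      = enc_clustering I (C, \<phi>)"
    by (simp add: r encode_clustering)
  have "group_fair I 2 (cluster I (C, \<phi>) c)" if "c \<in> C" for c
    unfolding group_fair_def
  proof (intro ballI)
    fix h assume "h \<in> colors I"
    then have h: "h < num_colors I" by simp
    let ?A = "cluster I (C, \<phi>) c"
    let ?K = "(((h, c), (lower h, upper h)), (0, 0)) :: cell"
    have "?K \<in> set cells" using in_cells h that by blast
    then have "Q * cell_count ?K s \<le> upper h * center_count ?K s + 2 * Q \<and>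
        lower h * center_count ?K s \<le> Q * cell_count ?K s + 2 * Q"
      using B(2) unfolding nearly_fair_def by fastforce
    moreover have "center_count ?K s = card ?A" "cell_count ?K s = card (?A \<inter> color_class I h)"
      unfolding phi(2) counts_assignment by (simp_all add: cluster_def)
    ultimately have "Q * card (?A \<inter> color_class I h) \<le> upper h * card ?A + 2 * Q"
      "lower h * card ?A \<le> Q * card (?A \<inter> color_class I h) + 2 * Q" by simp_all
    then have "real Q * real (card (?A \<inter> color_class I h)) \<le> real (upper h) * real (card ?A)
        + 2 * real Q"
      "real (lower h) * real (card ?A) \<le> real Q * real (card (?A \<inter> color_class I h)) + 2 * real Q"
      by (simp_all flip: of_nat_mult of_nat_add)
    then have "real Q * real (card (?A \<inter> color_class I h)) \<le>
        real Q * (real_of_rat (group_upper I h) * real (card ?A) + 2)"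
      "real Q * (real_of_rat (group_lower I h) * real (card ?A)) \<le>
        real Q * (real (card (?A \<inter> color_class I h)) + 2)"
      unfolding bounds_real(1,2)[OF h] by (simp_all add: algebra_simps)
    then have "real (card (?A \<inter> color_class I h)) \<le> real_of_rat (group_upper I h) * real (card ?A)
        + 2"
      "real_of_rat (group_lower I h) * real (card ?A) \<le> real (card (?A \<inter> color_class I h)) + 2"
      using Q_pos by simp_all
    then have "real_of_rat (of_nat (card (?A \<inter> color_class I h))) \<le>
        real_of_rat (group_upper I h * of_nat (card ?A) + 2)"
      "real_of_rat (group_lower I h * of_nat (card ?A) - 2)
          \<le> real_of_rat (of_nat (card (?A \<inter> color_class I h)))"
      by (simp_all add: of_rat_mult of_rat_add of_rat_diff)
    then show "group_lower I h * of_nat (card ?A) - 2 \<le> of_nat (card (?A \<inter> color_class I h)) \<and>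
        of_nat (card (?A \<inter> color_class I h)) \<le> group_upper I h * of_nat (card ?A) + 2"
      by (simp only: of_rat_less_eq)
  qed
  \<comment> \<open>Diversity is a property of the centers alone, and these are kept from
    \<open>S\<^sub>0\<close>.\<close>
  moreover have "(C, \<phi>) \<in> ds_solutions I"
    using S0 phi(1) by (auto simp: ds_solutions_def clusterings_def)
  ultimately have sol: "(C, \<phi>) \<in> dc_solutions 2 I" by (simp add: dc_solutions_def)
  let ?W = "real (prod_list dens) ^ q"
  have W: "0 < ?W" using prod_dens_pos by simp
  have "real (\<zeta> * total_cost s) \<le> real ((\<zeta> + 1) * total_cost (assignment ?x))"
    using B(3) by (rule of_nat_mono)
  then have "?W * (real \<zeta> * (\<Sum>p\<in>points I. d p (\<phi> p) ^ q)) \<le>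
      ?W * ((real \<zeta> + 1) * (\<Sum>p\<in>points I. d p (?x p) ^ q))"
    unfolding phi(2) of_nat_mult of_nat_add cost_assignment[OF phi'] cost_assignment[OF x]
    by (simp add: algebra_simps)
  then have "real \<zeta> * (\<Sum>p\<in>points I. d p (\<phi> p) ^ q) \<le> (real \<zeta> + 1) * (\<Sum>p\<in>points I. d p (?x p) ^ q)"
    using W by simp
  also have "\<dots> \<le> (real \<zeta> + 1) * (\<Sum>p\<in>points I. (2 * d p (snd S\<^sub>f p) + d p (snd S\<^sub>0 p)) ^ q)"
    by (intro mult_left_mono sum_mono power_mono nearest_dist Metric_space.nonneg[OF metric])
        simp_all
  finally show ?thesis using sol enc by (intro bexI[of _ "(C, \<phi>)"]) auto
qed

end

section \<open>The approximation algorithms\<close>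

text \<open>The given algorithm expects instances without fairness bounds. The encoding of the
  restricted instance is the left subtree of the full encoding, so it is obtained by a single
  projection.\<close>

abbreviation restricted :: "dc_instance \<Rightarrow> ds_instance" where
  "restricted \<equiv> ds_instance.truncate"

lemma restricted_simps:
  "num_points (restricted I) = num_points I" "distance (restricted I) = distance I"
  "max_clusters (restricted I) = max_clusters I" "num_colors (restricted I) = num_colors I"
  "color (restricted I) = color I" "center_lower (restricted I) = center_lower I"
  "center_upper (restricted I) = center_upper I"
  by (simp_all add: ds_instance.defs)

lemma restricted_eq:
  "enc_ds_instance (restricted I) = enc_ds_instance I"
  "ds_solutions (restricted I) = ds_solutions I"
  "valid_ds_instance (restricted I) = valid_ds_instance I"
  "enc_clustering (restricted I) = enc_clustering I"
proof -
  show "enc_ds_instance (restricted I) = enc_ds_instance I"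
    by (simp add: enc_ds_instance_def restricted_simps)
  have "color_class (restricted I) = color_class I"
    by (simp add: color_class_def restricted_simps fun_eq_iff)
  then show "ds_solutions (restricted I) = ds_solutions I"
    by (simp add: ds_solutions_def clusterings_def diverse_centers_def restricted_simps)
  show "valid_ds_instance (restricted I) = valid_ds_instance I"
    by (simp add: valid_ds_instance_def restricted_simps)
  show "enc_clustering (restricted I) = enc_clustering I"
    by (simp add: enc_clustering_def restricted_simps fun_eq_iff)
qed

definition power_cost :: "nat \<Rightarrow> 'a ds_instance_scheme \<Rightarrow> clustering \<Rightarrow> real" where
  "power_cost q I S = (\<Sum>p\<in>points I. real_of_rat (distance I p (snd S p)) ^ q)"

lemma median_cost_eq: "median_cost = power_cost 1"
  by (simp add: fun_eq_iff median_cost_def power_cost_def)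

lemma means_cost_eq: "means_cost = power_cost 2"
  by (simp add: fun_eq_iff means_cost_def power_cost_def)

lemma power_cost_restricted: "power_cost q (restricted I) = power_cost q I"
  by (simp add: fun_eq_iff power_cost_def restricted_simps)

lemma finite_solutions: "finite (ds_solutions I)" "finite (dc_solutions \<rho> J)"
proof -
  show *: "finite (ds_solutions I)" for I :: "'b ds_instance_scheme"
    using finite_clusterings[of I] by (rule rev_finite_subset) (auto simp: ds_solutions_def)
  show "finite (dc_solutions \<rho> J)"
    using *[of J] by (rule rev_finite_subset) (auto simp: dc_solutions_def)
qed

text \<open>With shared subtrees, the running time of the given algorithm does not bound the size of
  its output; that the output encodes a clustering does.\<close>

lemma csize_clustering:
  assumes "S \<in> ds_solutions I" and "num_points I \<le> N"
  shows "size (enc_clustering I S) \<le> 2 * (N * (2 * N + 1)) + 1"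
proof -
  have S: "fst S \<subseteq> points I" "snd S \<in> points I \<rightarrow> fst S"
    using assms(1) by (auto simp: ds_solutions_def clusterings_def)
  have le: "csize is \<le> N * (2 * N + 1)" if "\<And>i. i \<in> set is \<Longrightarrow> i < N" "length is \<le> N"
      for "is" :: "nat list"
  proof -
    have "csize is \<le> length is * (2 * N + 1)"
      using that(1) by (intro csize_nat_list_le less_imp_le)
    also have "\<dots> \<le> N * (2 * N + 1)" using that(2) by (rule mult_right_mono) simp
    finally show ?thesis .
  qed
  have fin: "finite (fst S)" using S(1) finite_subset by blast
  have "card (fst S) \<le> N" using card_mono[OF _ S(1)] assms(2) by simp
  then have "csize (sorted_list_of_set (fst S)) \<le> N * (2 * N + 1)"
    using S(1) fin assms(2) by (intro le) auto
  moreover have "csize (map (snd S) [0..<num_points I]) \<le> N * (2 * N + 1)"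
    using S assms(2) by (intro le) fastforce+
  ultimately show ?thesis unfolding encode_clustering by simp
qed

lemma num_points_le: "num_points I \<le> size (enc_dc_instance I)"
proof -
  have "num_points I \<le> csize (map (color I) [0..<num_points I])"
    using length_le_csize[of "map (color I) [0..<num_points I]"] by simp
  also have "\<dots> \<le> csize (raw I)" by (simp add: raw_def)
  finally show ?thesis by (simp add: encode_raw)
qed

text \<open>The combined program saves the input in a variable \<open>v\<close> foreign to
  \<open>A\<close>, runs \<open>A\<close> on the left subtree, pairs the saved input with the output
  and runs the program for \<open>f\<close>.\<close>

lemma compose_algorithm:
  fixes f :: "raw_instance \<times> nat list \<times> nat list \<Rightarrow> nat list \<times> nat list"
  assumes A: "ds_approximation cost \<alpha> A" and f: "ptime f"
    and correct: "\<And>I S. valid_dc_instance I \<Longrightarrow> dc_solutions 0 I \<noteq> {} \<Longrightarrow> S \<in> ds_solutions I \<Longrightarrow>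
      cost (restricted I) S \<le> \<alpha> * Min (cost (restricted I) ` ds_solutions I) \<Longrightarrow>
      \<exists>S'\<in>dc_solutions \<rho> I.
        encode (f (raw I, sorted_list_of_set (fst S), map (snd S) [0..<num_points I]))
            = enc_clustering I S' \<and>
        cost' I S' \<le> \<beta> * Min (cost' I ` dc_solutions 0 I)"
  shows "\<exists>B. dc_approximation cost' \<rho> \<beta> B"
proof -
  obtain p where p: "\<And>J :: ds_instance. valid_ds_instance J \<Longrightarrow> ds_solutions J \<noteq> {} \<Longrightarrow>
      \<exists>t s. exec A ((\<lambda>_. Leaf)(0 := enc_ds_instance J)) t s \<and> t \<le> poly p (size (enc_ds_instance J))
          \<and>
        (\<exists>S\<in>ds_solutions J. s 0 = enc_clustering J S \<and> cost J S
            \<le> \<alpha> * Min (cost J ` ds_solutions J))"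
    using A unfolding ds_approximation_def poly_time_solves_def by blast
  obtain c T where c: "pbound T" "\<And>x s. s 0 = encode x \<Longrightarrow>
      \<exists>t s'. exec c s t s' \<and> s' 0 = encode (f x) \<and> t \<le> T x"
    using f unfolding ptime_def by blast
  obtain r where r: "\<And>x. T x \<le> poly r (csize x)" using c(1) unfolding pbound_def by blast
  define V where "V = insert 0 (com_vars A)"
  obtain v where v: "v \<notin> V" using ex_new_if_finite[of V] finite_com_vars[of A] by (auto simp: V_def)
  have v0: "v \<noteq> 0" using v by (auto simp: V_def)
  define B where "B = Seq (Assign v (Var 0)) (Seq (Assign 0 (HdE (Var 0))) (Seq A
      (Seq (Assign 0 (ConsE (Var v) (Var 0))) c)))"
  \<comment> \<open>An instance of size \<open>N\<close>, a clustering of size at most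
    \<open>2 * (N * (2 * N + 1)) + 1\<close> and one joining node make
    \<open>2 + 3 * N + 4 * N^2\<close>.\<close>
  define b :: "nat poly" where "b = [:2, 3, 4:]"
  define P where "P = p + pcompose r b + [:20:]"
  have "\<exists>t s. exec B ((\<lambda>_. Leaf)(0 := enc_dc_instance I)) t s \<and> t
      \<le> poly P (size (enc_dc_instance I)) \<and>
      (\<exists>S\<in>dc_solutions \<rho> I. s 0 = enc_clustering I S \<and> cost' I S
          \<le> \<beta> * Min (cost' I ` dc_solutions 0 I))"
    if I: "valid_dc_instance I" "dc_solutions 0 I \<noteq> {}" for I
  proof -
    let ?x = "size (enc_dc_instance I)"
    have "valid_ds_instance (restricted I)" "ds_solutions (restricted I) \<noteq> {}"
      using I by (auto simp: restricted_eq valid_dc_instance_def dc_solutions_def)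
    from p[OF this, unfolded restricted_eq] obtain t u S where
      t: "exec A ((\<lambda>_. Leaf)(0 := enc_ds_instance I)) t u" "t \<le> poly p (size (enc_ds_instance I))"
      and S: "S \<in> ds_solutions I" "u 0 = enc_clustering I S"
        "cost (restricted I) S \<le> \<alpha> * Min (cost (restricted I) ` ds_solutions I)"
      by blast
    obtain S' where S': "S' \<in> dc_solutions \<rho> I"
      "encode (f (raw I, sorted_list_of_set (fst S), map (snd S) [0..<num_points I]))
          = enc_clustering I S'"
      "cost' I S' \<le> \<beta> * Min (cost' I ` dc_solutions 0 I)"
      using correct[OF I S(1,3)] by blast
    let ?s0 = "(\<lambda>_. Leaf)(0 := enc_dc_instance I)"
    let ?s1 = "?s0(v := enc_dc_instance I)"
    let ?s2 = "?s1(0 := enc_ds_instance I)"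
    let ?s3 = "\<lambda>w. if w \<in> V then u w else ?s2 w"
    let ?y = "(raw I, sorted_list_of_set (fst S), map (snd S) [0..<num_points I])"
    let ?s4 = "?s3(0 := encode ?y)"
    have 1: "exec (Assign v (Var 0)) ?s0 2 ?s1"
      using exec.Assign[of v "Var 0" ?s0] by (simp add: eval_nat_numeral)
    have 2: "exec (Assign 0 (HdE (Var 0))) ?s1 3 ?s2"
      using exec.Assign[of 0 "HdE (Var 0)" ?s1] v0
          by (simp add: eval_nat_numeral enc_dc_instance_def)
    \<comment> \<open>The run of \<open>A\<close> is known for a store that is empty outside
      \<open>0\<close>; here \<open>v\<close> is occupied as well.\<close>
    have 3: "exec A ?s2 t ?s3"
      by (rule exec_cong[OF t(1)]) (use v in \<open>auto simp: V_def\<close>)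
    have "?s3 v = encode (raw I)" "?s3 0
        = encode (sorted_list_of_set (fst S), map (snd S) [0..<num_points I])"
      using v v0 S(2) by (simp_all add: V_def encode_raw encode_clustering)
    then have 4: "exec (Assign 0 (ConsE (Var v) (Var 0))) ?s3 4 ?s4"
      using exec.Assign[of 0 "ConsE (Var v) (Var 0)" ?s3] by (simp add: eval_nat_numeral)
    have "?s4 0 = encode ?y" by simp
    then obtain t' s' where 5: "exec c ?s4 t' s'" "s' 0 = encode (f ?y)" "t' \<le> T ?y" using c(2)
        by blast
    have "exec B ?s0 (2 + (3 + (t + (4 + t' + 1) + 1) + 1) + 1) s'"
      unfolding B_def by (rule exec.Seq[OF 1 exec.Seq[OF 2 exec.Seq[OF 3 exec.Seq[OF 4 5(1)]]]])
    moreover have "2 + (3 + (t + (4 + t' + 1) + 1) + 1) + 1 \<le> poly P ?x"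
    proof -
      have "t \<le> poly p ?x"
        using t(2) poly_nat_mono[of "size (enc_ds_instance I)" ?x p]
            by (simp add: enc_dc_instance_def)
      moreover have "csize ?y \<le> poly b ?x"
        using csize_clustering[OF S(1) num_points_le]
        by (simp add: b_def algebra_simps encode_raw encode_clustering)
      then have "t' \<le> poly r (poly b ?x)" using 5(3) r[of ?y] poly_nat_mono[of "csize ?y" _ r]
          by (meson le_trans)
      ultimately show ?thesis by (simp add: P_def poly_pcompose)
    qed
    ultimately show ?thesis using S' 5(2) by metis
  qed
  then have "dc_approximation cost' \<rho> \<beta> B"
    unfolding dc_approximation_def poly_time_solves_def by blast
  then show ?thesis by blast
qed

text \<open>Two points at distance 1 and a single center have positive optimum.\<close>

lemma approximation_factor_ge_1:
  assumes "ds_approximation (power_cost q) \<alpha> A" "0 < q"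
  shows "1 \<le> \<alpha>"
proof -
  define I :: ds_instance where
    "I = \<lparr>num_points = 2, distance = (\<lambda>p q. if p = q then 0 else 1), max_clusters = 1, num_colors
        = 1,
      color = (\<lambda>_. 0), center_lower = (\<lambda>_. 0), center_upper = (\<lambda>_. 1)\<rparr>"
  have "valid_ds_instance I"
    unfolding valid_ds_instance_def
        by (auto simp: I_def intro!: Metric_space.intro split: if_splits)
  moreover have "({0}, restrict (\<lambda>_. 0) (points I)) \<in> ds_solutions I"
    by (auto simp: ds_solutions_def clusterings_def diverse_centers_def color_class_def I_def)
  ultimately obtain S where S: "S \<in> ds_solutions I"
      "power_cost q I S \<le> \<alpha> * Min (power_cost q I ` ds_solutions I)"
    using assms(1) unfolding ds_approximation_def poly_time_solves_def by blast
  let ?M = "Min (power_cost q I ` ds_solutions I)"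
  have fin: "finite (power_cost q I ` ds_solutions I)" using finite_solutions(1) by blast
  have "0 < power_cost q I S'" if "S' \<in> ds_solutions I" for S'
  proof -
    have S': "fst S' \<subseteq> {..<2}" "card (fst S') \<le> 1" "snd S' 0 \<in> fst S'" "snd S' 1 \<in> fst S'"
      using that by (auto simp: ds_solutions_def clusterings_def I_def)
    have "finite (fst S')" using finite_subset[OF S'(1)] by simp
    \<comment> \<open>A single center serves both points, so one of them is at distance 1 from
      it.\<close>
    then have "snd S' 0 = snd S' 1" using card_le_Suc0_iff_eq[of "fst S'"] S' by simp
    then have "\<exists>p\<in>points I. snd S' p \<noteq> p" by (auto simp: I_def lessThan_Suc numeral_2_eq_2)
    then show ?thesis
      unfolding power_cost_def using assms(2) by (auto intro!: sum_pos2 simp: I_def)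
  qed
  then have "0 < ?M" using Min_in[OF fin] S(1) by fastforce
  moreover have "?M \<le> power_cost q I S" using fin S(1) by (intro Min_le) auto
  then have "1 * ?M \<le> \<alpha> * ?M" using S(2) by simp
  ultimately show ?thesis by (rule mult_right_le_imp_le[rotated])
qed

text \<open>The last premise isolates the estimate that differs between medians and means:
  \<open>x\<close> and \<open>y\<close> stand for the distances of the points in an optimal fair
  clustering and in the given solution, and the two factors with \<open>\<zeta>\<close> express the
  relative loss \<open>1 + 1 / \<zeta>\<close> of the reassignment.\<close>

lemma doubly_constrained_approximation:
  assumes A: "ds_approximation (power_cost q) \<alpha> A" and "0 < q" and "2 \<le> \<zeta>"
    and bound: "\<And>(P :: nat set) x y. finite P \<Longrightarrow> (\<And>p. 0 \<le> x p) \<Longrightarrow> (\<And>p. 0 \<le> y p) \<Longrightarrow>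
      (\<Sum>p\<in>P. y p ^ q) \<le> \<alpha> * (\<Sum>p\<in>P. x p ^ q) \<Longrightarrow>
      (real \<zeta> + 1) * (\<Sum>p\<in>P. (2 * x p + y p) ^ q) \<le> real \<zeta> * (\<beta> * (\<Sum>p\<in>P. x p ^ q))"
  shows "\<exists>B. dc_approximation (power_cost q) 2 \<beta> B"
proof (rule compose_algorithm[OF A ptime_reassign[of q \<zeta>]])
  fix I S
  assume I: "valid_dc_instance I" "dc_solutions 0 I \<noteq> {}" and S: "S \<in> ds_solutions I"
    and le: "power_cost q (restricted I) S \<le> \<alpha> * Min (power_cost q (restricted I) ` ds_solutions I)"
  have "Min (power_cost q I ` dc_solutions 0 I) \<in> power_cost q I ` dc_solutions 0 I"
    using I(2) finite_solutions(2) by (intro Min_in) auto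
  then obtain Sf where Sf: "Sf \<in> dc_solutions 0 I" "Min (power_cost q I ` dc_solutions 0 I)
      = power_cost q I Sf"
    by auto
  interpret R: reassignment I S Sf q \<zeta> by unfold_locales (use I S Sf assms(3) in auto)
  have nonneg: "0 \<le> real_of_rat (distance I a b)" for a b
    using Metric_space.nonneg[OF R.metric] .
  have Min_le: "Min (power_cost q I ` ds_solutions I) \<le> power_cost q I Sf"
    using Sf(1) finite_solutions(1) by (intro Min_le) (auto simp: dc_solutions_def)
  have "power_cost q I S \<le> \<alpha> * Min (power_cost q I ` ds_solutions I)"
    using le unfolding power_cost_restricted .
  \<comment> \<open>Every doubly constrained solution also solves the problem without group
    fairness, so its optimum is at most the cost of \<open>Sf\<close>. Multiplying by
    \<open>\<alpha>\<close> keeps the inequality because an approximation factor is at least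
    1.\<close>
  also have "\<dots> \<le> \<alpha> * power_cost q I Sf"
    using approximation_factor_ge_1[OF A assms(2)] by (intro mult_left_mono Min_le) simp
  finally have "power_cost q I S \<le> \<alpha> * power_cost q I Sf" .
  then have b: "(real \<zeta> + 1) * (\<Sum>p\<in>points I. (2 * real_of_rat (distance I p (snd Sf p))
      + real_of_rat (distance I p (snd S p))) ^ q)
      \<le> real \<zeta> * (\<beta> * power_cost q I Sf)"
    unfolding power_cost_def by (intro bound nonneg) auto
  obtain S' where S': "S' \<in> dc_solutions 2 I"
    "encode (reassign q \<zeta> (raw I, sorted_list_of_set (fst S), map (snd S) [0..<num_points I]))
        = enc_clustering I S'"
    "real \<zeta> * power_cost q I S' \<le> (real \<zeta> + 1) *
      (\<Sum>p\<in>points I. (2 * real_of_rat (distance I p (snd Sf p))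
          + real_of_rat (distance I p (snd S p))) ^ q)"
    using R.reassign_correct unfolding power_cost_def by blast
  have "real \<zeta> * power_cost q I S' \<le> real \<zeta> * (\<beta> * power_cost q I Sf)"
    using S'(3) b by linarith
  then have "power_cost q I S' \<le> \<beta> * power_cost q I Sf" using assms(3) by simp
  then show "\<exists>S'\<in>dc_solutions 2 I.
      encode (reassign q \<zeta> (raw I, sorted_list_of_set (fst S), map (snd S) [0..<num_points I]))
          = enc_clustering I S' \<and>
      power_cost q I S' \<le> \<beta> * Min (power_cost q I ` dc_solutions 0 I)"
    using S' Sf(2) by metis
qed

theorem theorem5:
  shows "(\<forall>(\<alpha>_med :: real) A. ds_approximation median_cost \<alpha>_med A \<longrightarrow>
           (\<exists>B. dc_approximation median_cost 2 (\<alpha>_med + 3) B)) \<and>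
         (\<forall>(\<alpha>_means :: real) A. ds_approximation means_cost \<alpha>_means A \<longrightarrow>
           (\<exists>B. dc_approximation means_cost 2 ((sqrt (1 + (sqrt \<alpha>_means + 1)\<^sup>2) + 1)\<^sup>2) B))"
proof (intro conjI allI impI)
  fix \<alpha> :: real and A
  assume "ds_approximation median_cost \<alpha> A"
  then have A: "ds_approximation (power_cost 1) \<alpha> A" by (simp add: median_cost_eq)
  then have \<alpha>: "1 \<le> \<alpha>" by (rule approximation_factor_ge_1) simp
  \<comment> \<open>This is exactly what
    \<open>(1 + 1 / \<zeta>) * (\<alpha> + 2) \<le> \<alpha> + 3\<close> requires.\<close>
  obtain \<zeta> :: nat where \<zeta>: "\<alpha> + 2 \<le> real \<zeta>" using real_arch_simple by blast
  have "\<exists>B. dc_approximation (power_cost 1) 2 (\<alpha> + 3) B"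
  proof (rule doubly_constrained_approximation[OF A])
    show "2 \<le> \<zeta>" using \<alpha> \<zeta> by linarith
    fix P :: "nat set" and x y :: "nat \<Rightarrow> real"
    assume fin: "finite P" and nn: "\<And>p. 0 \<le> x p" "\<And>p. 0 \<le> y p"
      and le: "(\<Sum>p\<in>P. y p ^ 1) \<le> \<alpha> * (\<Sum>p\<in>P. x p ^ 1)"
    have X: "0 \<le> sum x P" using nn by (simp add: sum_nonneg)
    have "(real \<zeta> + 1) * (\<Sum>p\<in>P. (2 * x p + y p) ^ 1) = (real \<zeta> + 1) * (2 * sum x P + sum y P)"
      by (simp add: sum.distrib sum_distrib_left)
    also have "\<dots> \<le> (real \<zeta> + 1) * ((\<alpha> + 2) * sum x P)"
      using le by (intro mult_left_mono) (simp_all add: algebra_simps)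
    also have "\<dots> = real \<zeta> * ((\<alpha> + 2) * sum x P) + (\<alpha> + 2) * sum x P" by (simp add: algebra_simps)
    also have "\<dots> \<le> real \<zeta> * ((\<alpha> + 2) * sum x P) + real \<zeta> * sum x P"
      using \<zeta> X by (intro add_left_mono mult_right_mono)
    also have "\<dots> = real \<zeta> * ((\<alpha> + 3) * (\<Sum>p\<in>P. x p ^ 1))" by (simp add: algebra_simps)
    finally show "(real \<zeta> + 1) * (\<Sum>p\<in>P. (2 * x p + y p) ^ 1)
        \<le> real \<zeta> * ((\<alpha> + 3) * (\<Sum>p\<in>P. x p ^ 1))" .
  qed simp
  then show "\<exists>B. dc_approximation median_cost 2 (\<alpha> + 3) B" by (simp add: median_cost_eq)
next
  fix \<alpha> :: real and A
  assume "ds_approximation means_cost \<alpha> A"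
  then have A: "ds_approximation (power_cost 2) \<alpha> A" by (simp add: means_cost_eq)
  then have \<alpha>: "1 \<le> \<alpha>" by (rule approximation_factor_ge_1) simp
  let ?\<gamma> = "(sqrt \<alpha> + 2)\<^sup>2" let ?\<beta> = "(sqrt (1 + (sqrt \<alpha> + 1)\<^sup>2) + 1)\<^sup>2"
  \<comment> \<open>Hence the target factor strictly exceeds \<open>?\<gamma>\<close>, the factor
    that Minkowski's inequality gives for \<open>2 * x p + y p\<close>; the choice of
    \<open>\<zeta>\<close> spends this gap.\<close>
  have "sqrt \<alpha> + 1 < sqrt (1 + (sqrt \<alpha> + 1)\<^sup>2)" using \<alpha> by (intro real_less_rsqrt) simp
  then have "?\<gamma> < ?\<beta>" using \<alpha> by (intro power_strict_mono) auto
  then have gap: "0 < ?\<beta> - ?\<gamma>" by simp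
  obtain \<zeta> :: nat where \<zeta>: "max 2 (?\<gamma> / (?\<beta> - ?\<gamma>)) \<le> real \<zeta>" using real_arch_simple by blast
  then have \<zeta>': "?\<gamma> \<le> real \<zeta> * (?\<beta> - ?\<gamma>)" using gap by (simp add: divide_le_eq)
  have "\<exists>B. dc_approximation (power_cost 2) 2 ?\<beta> B"
  proof (rule doubly_constrained_approximation[OF A])
    show "2 \<le> \<zeta>" using \<zeta> by simp
    fix P :: "nat set" and x y :: "nat \<Rightarrow> real"
    assume fin: "finite P" and nn: "\<And>p. 0 \<le> x p" "\<And>p. 0 \<le> y p"
      and le: "(\<Sum>p\<in>P. (y p)\<^sup>2) \<le> \<alpha> * (\<Sum>p\<in>P. (x p)\<^sup>2)"
    let ?X = "\<Sum>p\<in>P. (x p)\<^sup>2"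
    have X: "0 \<le> ?X" by (simp add: sum_nonneg)
    have "L2_set (\<lambda>p. 2 * x p + y p) P \<le> L2_set (\<lambda>p. 2 * x p) P + L2_set y P"
      by (rule L2_set_triangle_ineq)
    also have "L2_set (\<lambda>p. 2 * x p) P = 2 * sqrt ?X"
      by (simp add: L2_set_def power_mult_distrib real_sqrt_mult flip: sum_distrib_left)
    also have "L2_set y P \<le> sqrt \<alpha> * sqrt ?X"
      unfolding L2_set_def using le by (simp flip: real_sqrt_mult)
    finally have "L2_set (\<lambda>p. 2 * x p + y p) P \<le> (sqrt \<alpha> + 2) * sqrt ?X"
        by (simp add: algebra_simps)
    then have "(L2_set (\<lambda>p. 2 * x p + y p) P)\<^sup>2 \<le> ((sqrt \<alpha> + 2) * sqrt ?X)\<^sup>2"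
      by (intro power_mono L2_set_nonneg)
    then have "(\<Sum>p\<in>P. (2 * x p + y p)\<^sup>2) \<le> ?\<gamma> * ?X"
      using X by (simp add: L2_set_def power_mult_distrib sum_nonneg)
    then have "(real \<zeta> + 1) * (\<Sum>p\<in>P. (2 * x p + y p)\<^sup>2) \<le> (real \<zeta> + 1) * (?\<gamma> * ?X)"
      by (intro mult_left_mono) simp_all
    also have "\<dots> = real \<zeta> * (?\<gamma> * ?X) + ?\<gamma> * ?X" by (simp add: algebra_simps)
    also have "\<dots> \<le> real \<zeta> * (?\<gamma> * ?X) + (real \<zeta> * (?\<beta> - ?\<gamma>)) * ?X"
      using \<zeta>' X by (intro add_left_mono mult_right_mono)
    also have "\<dots> = real \<zeta> * (?\<beta> * ?X)" by (simp add: algebra_simps)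
    finally show "(real \<zeta> + 1) * (\<Sum>p\<in>P. (2 * x p + y p)\<^sup>2) \<le> real \<zeta> * (?\<beta> * ?X)" .
  qed simp
  then show "\<exists>B. dc_approximation means_cost 2 ?\<beta> B" by (simp add: means_cost_eq)
qed

end
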